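(* Let $\mathcal{L}=(\mathcal{L},\mathcal{U})$ be a quasi-uniform biframe and let $\rho: CB\mathcal{L}\twoheadrightarrow\mathcal{L}$ be its Samuel compactification. For each $U\in\mathcal{U}$ let $K_U=\bigcup_{(u,v)\in U}{\downarrow}(\rho^1_*(u),\rho^2_*(v))$, a downset of $(CB\mathcal{L})_1\times(CB\mathcal{L})_2$, and let $k_U=\bigvee_{(x,y)\in K_U}x\wedge y\in(CB\mathcal{L})_0$. Let $\Theta_{\mathcal{L}}=\bigvee_{U\in\mathcal{U}}\Delta_{k_U}$ and let $\nu$ be the biframe quotient map from $CB\mathcal{L}$ to its quotient by the congruence $\Theta_{\mathcal{L}}$. Then: (a) the underlying biframe of the bicompletion $C\mathcal{L}$ is the quotient of $CB\mathcal{L}$ by $\Theta_{\mathcal{L}}$; (b) the images ${\downarrow}(\nu_1\times\nu_2)(K_U)$, $U\in\mathcal{U}$, of the downsets $K_U$ under $\nu_1\times\nu_2$ form a base for the quasi-uniformity on $C\mathcal{L}$; (c) the bicompletion morphism $\gamma:C\mathcal{L}\twoheadrightarrow\mathcal{L}$ is given by factoring $\rho$ through $\nu$ (that is, $\rho=\gamma\nu$).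
   Context: **Biframes.** A biframe is a triple of frames $\mathcal{L}=(\mathcal{L}_0,\mathcal{L}_1,\mathcal{L}_2)$ where $\mathcal{L}_1,\mathcal{L}_2$ are subframes of $\mathcal{L}_0$ which together generate $\mathcal{L}_0$; $\mathcal{L}_0$ is the total part, $\mathcal{L}_1$ the first part, $\mathcal{L}_2$ the second part. A biframe homomorphism $h:\mathcal{L}\to\mathcal{M}$ is a frame homomorphism $h_0:\mathcal{L}_0\to\mathcal{M}_0$ with $h_0(\mathcal{L}_i)\subseteq\mathcal{M}_i$ for $i=1,2$; its restrictions are $h_i:\mathcal{L}_i\to\mathcal{M}_i$. The right adjoint of $h_i$ is denoted $h^i_*:\mathcal{M}_i\to\mathcal{L}_i$. $h$ is surjective if $h_1$ and $h_2$ are surjective, and dense if $h_0(x)=0$ implies $x=0$. Below $i,j\in\{1,2\}$ with $i\neq j$. Smallest and largest elements of frames are $0$ and $1$. A frame congruence on a frame $M$ is an equivalence relation on $M$ which is a subframe of $M\times M$; the frame congruences form a frame under inclusion, in which joins are taken. For $a\in M$, $\Delta_a=\{(x,y)\in M\times M\mid x\wedge a=y\wedge a\}$. The quotient of a biframe $\mathcal{M}$ by a frame congruence $\Theta$ on $\mathcal{M}_0$ has total part $\mathcal{M}_0/\Theta$ and first and second parts the images of $\mathcal{M}_1$ and $\mathcal{M}_2$. **Quasi-uniform biframes.** A paircover on $\mathcal{L}$ is a downset $U\subseteq\mathcal{L}_1\times\mathcal{L}_2$ with $\bigvee_{(x,y)\in U}x\wedge y=1$. It is strong if it is generated as a downset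 by pairs $(x,y)$ with $x\wedge y\neq 0$, and finite if it is finitely generated as a downset. For $x\in\mathcal{L}_i$, $\mathrm{st}_i(x,U)=\bigvee\{u_i\mid (u_1,u_2)\in U,\ x\wedge u_j\neq 0\}$, and $U^*={\downarrow}\{(\mathrm{st}_1(u_1,U),\mathrm{st}_2(u_2,U))\mid (u_1,u_2)\in U\}$. A quasi-uniformity on $\mathcal{L}$ is a filter $\mathcal{U}$ (with respect to inclusion) of paircovers such that (i) every $U\in\mathcal{U}$ contains a strong $V\in\mathcal{U}$; (ii) for every $U\in\mathcal{U}$ there is $V\in\mathcal{U}$ with $V^*\subseteq U$; (iii) for all $x\in\mathcal{L}_i$, $x=\bigvee\{y\in\mathcal{L}_i\mid \exists U\in\mathcal{U}.\ \mathrm{st}_i(y,U)\le x\}$. A quasi-uniform homomorphism $f:(\mathcal{L},\mathcal{U})\to(\mathcal{M},\mathcal{V})$ is a biframe homomorphism such that ${\downarrow}(f_1\times f_2)(U)\in\mathcal{V}$ for all $U\in\mathcal{U}$. It is a quasi-uniform surjection if moreover $f$ is a surjective biframe homomorphism and the downsets ${\downarrow}(f_1\times f_2)(U)$, $U\in\mathcal{U}$, form a base of the filter $\mathcal{V}$. A quasi-uniform biframe $\mathcal{L}$ is bicomplete if every dense quasi-uniform surjection $\mathcal{M}\twoheadrightarrow\mathcal{L}$ from a quasi-uniform biframe $\mathcal{M}$ is an isomorphism. The bicompletion of a quasi-uniform biframe $\mathcal{L}$ is the (unique up to isomorphism over $\mathcal{L}$) dense quasi-uniform surjection $\gamma_{\mathcal{L}}:C\mathcal{L}\twoheadrightarrow\mathcal{L}$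 with $C\mathcal{L}$ bicomplete. The totally bounded coreflection $B\mathcal{L}$ of $(\mathcal{L},\mathcal{U})$ is the biframe $\mathcal{L}$ equipped with the quasi-uniformity generated by the finite paircovers in $\mathcal{U}$. The Samuel compactification of $(\mathcal{L},\mathcal{U})$ is the bicompletion $\rho:CB\mathcal{L}\twoheadrightarrow B\mathcal{L}$ of $B\mathcal{L}$, regarded as a biframe homomorphism onto the underlying biframe $\mathcal{L}$; $CB\mathcal{L}$ is compact. *)

theory Defs
  imports "HOL-Algebra.Complete_Lattice"
begin

section \<open>Frames\<close>

locale frame = complete_lattice +
  assumes meet_Sup_distrib:
    "\<lbrakk>x \<in> carrier L; A \<subseteq> carrier L\<rbrakk> \<Longrightarrow> x \<sqinter> (\<Squnion>A) = \<Squnion>((\<lambda>a. x \<sqinter> a) ` A)"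

definition subframe :: "'a set \<Rightarrow> ('a, 'r) gorder_scheme \<Rightarrow> bool" where
  "subframe S L \<longleftrightarrow> S \<subseteq> carrier L \<and> \<top>\<^bsub>L\<^esub> \<in> S
     \<and> (\<forall>x\<in>S. \<forall>y\<in>S. x \<sqinter>\<^bsub>L\<^esub> y \<in> S) \<and> (\<forall>A\<subseteq>S. \<Squnion>\<^bsub>L\<^esub>A \<in> S)"

definition frame_hom :: "('a, 'r) gorder_scheme \<Rightarrow> ('b, 's) gorder_scheme \<Rightarrow> ('a \<Rightarrow> 'b) \<Rightarrow> bool" where
  "frame_hom L M h \<longleftrightarrow> h \<in> carrier L \<rightarrow> carrier M \<and> h \<top>\<^bsub>L\<^esub> = \<top>\<^bsub>M\<^esub>
     \<and> (\<forall>x\<in>carrier L. \<forall>y\<in>carrier L. h (x \<sqinter>\<^bsub>L\<^esub> y) = h x \<sqinter>\<^bsub>M\<^esub> h y)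
     \<and> (\<forall>A\<subseteq>carrier L. h (\<Squnion>\<^bsub>L\<^esub>A) = \<Squnion>\<^bsub>M\<^esub>(h ` A))"

definition square_order :: "('a, 'r) gorder_scheme \<Rightarrow> ('a \<times> 'a) gorder" where
  "square_order M = \<lparr>carrier = carrier M \<times> carrier M, eq = (=),
     le = (\<lambda>p q. fst p \<sqsubseteq>\<^bsub>M\<^esub> fst q \<and> snd p \<sqsubseteq>\<^bsub>M\<^esub> snd q)\<rparr>"

definition frame_congruence :: "('a, 'r) gorder_scheme \<Rightarrow> ('a \<times> 'a) set \<Rightarrow> bool" where
  "frame_congruence M \<Theta> \<longleftrightarrow> equiv (carrier M) \<Theta> \<and> subframe \<Theta> (square_order M)"

definition congruence_frame :: "('a, 'r) gorder_scheme \<Rightarrow> ('a \<times> 'a) set gorder" where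
  "congruence_frame M = \<lparr>carrier = {\<Theta>. frame_congruence M \<Theta>}, eq = (=), le = (\<subseteq>)\<rparr>"

definition Delta :: "('a, 'r) gorder_scheme \<Rightarrow> 'a \<Rightarrow> ('a \<times> 'a) set" where
  "Delta M a = {(x, y) \<in> carrier M \<times> carrier M. x \<sqinter>\<^bsub>M\<^esub> a = y \<sqinter>\<^bsub>M\<^esub> a}"


section \<open>Biframes\<close>

text \<open>The order itself is the total part; the two other parts are subsets of its carrier.\<close>

record 'a biframe = "'a gorder" +
  part1 :: "'a set"
  part2 :: "'a set"

locale biframe = frame L for L :: "('a, 'r) biframe_scheme" (structure) +
  assumes subframe_part1: "subframe (part1 L) L"
    and subframe_part2: "subframe (part2 L) L"
    and generated: "\<And>S. \<lbrakk>subframe S L; part1 L \<union> part2 L \<subseteq> S\<rbrakk> \<Longrightarrow> S = carrier L"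

definition biframe_hom ::
  "('a, 'r) biframe_scheme \<Rightarrow> ('b, 's) biframe_scheme \<Rightarrow> ('a \<Rightarrow> 'b) \<Rightarrow> bool" where
  "biframe_hom L M h \<longleftrightarrow> frame_hom L M h \<and> h ` part1 L \<subseteq> part1 M \<and> h ` part2 L \<subseteq> part2 M"

definition surjective_hom ::
  "('a, 'r) biframe_scheme \<Rightarrow> ('b, 's) biframe_scheme \<Rightarrow> ('a \<Rightarrow> 'b) \<Rightarrow> bool" where
  "surjective_hom L M h \<longleftrightarrow> h ` part1 L = part1 M \<and> h ` part2 L = part2 M"

definition dense_hom ::
  "('a, 'r) biframe_scheme \<Rightarrow> ('b, 's) biframe_scheme \<Rightarrow> ('a \<Rightarrow> 'b) \<Rightarrow> bool" where
  "dense_hom L M h \<longleftrightarrow> (\<forall>x\<in>carrier L. h x = \<bottom>\<^bsub>M\<^esub> \<longrightarrow> x = \<bottom>\<^bsub>L\<^esub>)"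

text \<open>The right adjoint of the restriction of \<open>h\<close> to a subframe \<open>S\<close> of the domain \<open>L\<close>.\<close>

definition right_adjoint ::
  "('a, 'r) gorder_scheme \<Rightarrow> 'a set \<Rightarrow> ('b, 's) gorder_scheme \<Rightarrow> ('a \<Rightarrow> 'b) \<Rightarrow> 'b \<Rightarrow> 'a" where
  "right_adjoint L S M h b = \<Squnion>\<^bsub>L\<^esub>{x \<in> S. h x \<sqsubseteq>\<^bsub>M\<^esub> b}"

lemma right_adjoint_galois:
  assumes "frame L" "subframe S L" "complete_lattice M" "frame_hom L M h" "b \<in> carrier M"
  shows "right_adjoint L S M h b \<in> S"
    and "x \<in> S \<Longrightarrow> h x \<sqsubseteq>\<^bsub>M\<^esub> b \<longleftrightarrow> x \<sqsubseteq>\<^bsub>L\<^esub> right_adjoint L S M h b"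
proof -
  interpret L: frame L by fact
  interpret M: complete_lattice M by fact
  let ?A = "{x \<in> S. h x \<sqsubseteq>\<^bsub>M\<^esub> b}"
  have S: "S \<subseteq> carrier L" and closed: "\<And>A. A \<subseteq> S \<Longrightarrow> \<Squnion>\<^bsub>L\<^esub>A \<in> S"
    using assms(2) by (auto simp: subframe_def)
  have A: "?A \<subseteq> carrier L" using S by auto
  have h: "h y \<in> carrier M" if "y \<in> carrier L" for y
    using assms(4) that by (auto simp: frame_hom_def)
  show in_S: "right_adjoint L S M h b \<in> S"
    unfolding right_adjoint_def by (rule closed) auto
  assume x: "x \<in> S"
  show "h x \<sqsubseteq>\<^bsub>M\<^esub> b \<longleftrightarrow> x \<sqsubseteq>\<^bsub>L\<^esub> right_adjoint L S M h b"
  proof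
    assume "h x \<sqsubseteq>\<^bsub>M\<^esub> b"
    with x A show "x \<sqsubseteq>\<^bsub>L\<^esub> right_adjoint L S M h b"
      unfolding right_adjoint_def by (intro L.sup_upper) auto
  next
    let ?r = "right_adjoint L S M h b"
    assume le: "x \<sqsubseteq>\<^bsub>L\<^esub> ?r"
    have xr: "x \<in> carrier L" "?r \<in> carrier L" using x in_S S by auto
    have "x = x \<sqinter>\<^bsub>L\<^esub> ?r" using le xr by (metis L.le_iff_join)
    then have "h x = h x \<sqinter>\<^bsub>M\<^esub> h ?r"
      using assms(4) xr unfolding frame_hom_def by metis
    then have "h x \<sqsubseteq>\<^bsub>M\<^esub> h ?r" using h xr by (metis M.meet_right)
    also have "h ?r = \<Squnion>\<^bsub>M\<^esub>(h ` ?A)"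
      using assms(4) A unfolding frame_hom_def right_adjoint_def by blast
    finally have "h x \<sqsubseteq>\<^bsub>M\<^esub> \<Squnion>\<^bsub>M\<^esub>(h ` ?A)" .
    moreover have "\<Squnion>\<^bsub>M\<^esub>(h ` ?A) \<sqsubseteq>\<^bsub>M\<^esub> b"
      using assms(5) A h by (intro M.sup_least) auto
    moreover have "\<Squnion>\<^bsub>M\<^esub>(h ` ?A) \<in> carrier M"
      using A h by (intro M.sup_closed) auto
    ultimately show "h x \<sqsubseteq>\<^bsub>M\<^esub> b"
      using h xr assms(5) by (blast intro: M.le_trans)
  qed
qed

definition quotient_map :: "('a \<times> 'a) set \<Rightarrow> 'a \<Rightarrow> 'a set" where
  "quotient_map \<Theta> x = \<Theta> `` {x}"

text \<open>For a frame congruence \<open>\<Theta>\<close>, one has \<open>[x] \<sqinter> [y] = [x \<sqinter> y]\<close> in the quotient, so \<open>[x]\<close> lies below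
  \<open>[y]\<close> iff \<open>x\<close> and \<open>x \<sqinter> y\<close> are congruent. Equivalently, some representative of \<open>[x]\<close> lies below
  some representative of \<open>[y]\<close>.\<close>

definition quotient_biframe :: "('a, 'r) biframe_scheme \<Rightarrow> ('a \<times> 'a) set \<Rightarrow> 'a set biframe" where
  "quotient_biframe M \<Theta> =
     \<lparr>carrier = carrier M // \<Theta>, eq = (=), le = (\<lambda>A B. \<exists>x\<in>A. \<exists>y\<in>B. x \<sqsubseteq>\<^bsub>M\<^esub> y),
      part1 = quotient_map \<Theta> ` part1 M, part2 = quotient_map \<Theta> ` part2 M\<rparr>"


section \<open>Paircovers and quasi-uniformities\<close>

definition down :: "('a, 'r) biframe_scheme \<Rightarrow> ('a \<times> 'a) set \<Rightarrow> ('a \<times> 'a) set" where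
  "down L S = {(x, y) \<in> part1 L \<times> part2 L. \<exists>(a, b)\<in>S. x \<sqsubseteq>\<^bsub>L\<^esub> a \<and> y \<sqsubseteq>\<^bsub>L\<^esub> b}"

text \<open>The join of all \<open>x \<sqinter> y\<close> with \<open>(x, y)\<close> in \<open>U\<close>, taken in the total part.\<close>

definition pairs_join :: "('a, 'r) biframe_scheme \<Rightarrow> ('a \<times> 'a) set \<Rightarrow> 'a" where
  "pairs_join L U = \<Squnion>\<^bsub>L\<^esub>((\<lambda>(x, y). x \<sqinter>\<^bsub>L\<^esub> y) ` U)"

definition paircover :: "('a, 'r) biframe_scheme \<Rightarrow> ('a \<times> 'a) set \<Rightarrow> bool" where
  "paircover L U \<longleftrightarrow> U \<subseteq> part1 L \<times> part2 L \<and> down L U \<subseteq> U \<and> pairs_join L U = \<top>\<^bsub>L\<^esub>"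

definition strong :: "('a, 'r) biframe_scheme \<Rightarrow> ('a \<times> 'a) set \<Rightarrow> bool" where
  "strong L U \<longleftrightarrow> (\<exists>S \<subseteq> part1 L \<times> part2 L. (\<forall>(x, y)\<in>S. x \<sqinter>\<^bsub>L\<^esub> y \<noteq> \<bottom>\<^bsub>L\<^esub>) \<and> U = down L S)"

definition finitely_generated :: "('a, 'r) biframe_scheme \<Rightarrow> ('a \<times> 'a) set \<Rightarrow> bool" where
  "finitely_generated L U \<longleftrightarrow> (\<exists>S \<subseteq> part1 L \<times> part2 L. finite S \<and> U = down L S)"

definition st1 :: "('a, 'r) biframe_scheme \<Rightarrow> 'a \<Rightarrow> ('a \<times> 'a) set \<Rightarrow> 'a" where
  "st1 L x U = \<Squnion>\<^bsub>L\<^esub>{u1. \<exists>u2. (u1, u2) \<in> U \<and> x \<sqinter>\<^bsub>L\<^esub> u2 \<noteq> \<bottom>\<^bsub>L\<^esub>}"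

definition st2 :: "('a, 'r) biframe_scheme \<Rightarrow> 'a \<Rightarrow> ('a \<times> 'a) set \<Rightarrow> 'a" where
  "st2 L x U = \<Squnion>\<^bsub>L\<^esub>{u2. \<exists>u1. (u1, u2) \<in> U \<and> x \<sqinter>\<^bsub>L\<^esub> u1 \<noteq> \<bottom>\<^bsub>L\<^esub>}"

definition star_cover :: "('a, 'r) biframe_scheme \<Rightarrow> ('a \<times> 'a) set \<Rightarrow> ('a \<times> 'a) set" where
  "star_cover L U = down L ((\<lambda>(u1, u2). (st1 L u1 U, st2 L u2 U)) ` U)"

text \<open>The intersection of two paircovers is again a paircover, so a filter of paircovers is a
  nonempty family that is upward closed among the paircovers and closed under binary intersection.\<close>

definition paircover_filter :: "('a, 'r) biframe_scheme \<Rightarrow> ('a \<times> 'a) set set \<Rightarrow> bool" where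
  "paircover_filter L \<U> \<longleftrightarrow> \<U> \<noteq> {} \<and> (\<forall>U\<in>\<U>. paircover L U)
     \<and> (\<forall>U\<in>\<U>. \<forall>V. paircover L V \<and> U \<subseteq> V \<longrightarrow> V \<in> \<U>) \<and> (\<forall>U\<in>\<U>. \<forall>V\<in>\<U>. U \<inter> V \<in> \<U>)"

record 'a qubiframe = "'a biframe" +
  quni :: "('a \<times> 'a) set set"

locale qu_biframe = biframe L for L :: "('a, 'r) qubiframe_scheme" (structure) +
  assumes filter: "paircover_filter L (quni L)"
    and strong_refinement: "U \<in> quni L \<Longrightarrow> \<exists>V\<in>quni L. strong L V \<and> V \<subseteq> U"
    and star_refinement: "U \<in> quni L \<Longrightarrow> \<exists>V\<in>quni L. star_cover L V \<subseteq> U"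
    and admissible1:
      "x \<in> part1 L \<Longrightarrow> x = \<Squnion>{y \<in> part1 L. \<exists>U\<in>quni L. st1 L y U \<sqsubseteq> x}"
    and admissible2:
      "x \<in> part2 L \<Longrightarrow> x = \<Squnion>{y \<in> part2 L. \<exists>U\<in>quni L. st2 L y U \<sqsubseteq> x}"

definition base_of :: "'c set set \<Rightarrow> 'c set set \<Rightarrow> bool" where
  "base_of \<B> \<V> \<longleftrightarrow> \<B> \<subseteq> \<V> \<and> (\<forall>V\<in>\<V>. \<exists>B\<in>\<B>. B \<subseteq> V)"

definition image_cover ::
  "('b, 's) biframe_scheme \<Rightarrow> ('a \<Rightarrow> 'b) \<Rightarrow> ('a \<times> 'a) set \<Rightarrow> ('b \<times> 'b) set" where
  "image_cover M f U = down M (map_prod f f ` U)"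

definition qu_hom ::
  "('a, 'r) qubiframe_scheme \<Rightarrow> ('b, 's) qubiframe_scheme \<Rightarrow> ('a \<Rightarrow> 'b) \<Rightarrow> bool" where
  "qu_hom L M f \<longleftrightarrow> biframe_hom L M f \<and> (\<forall>U\<in>quni L. image_cover M f U \<in> quni M)"

definition qu_surjection ::
  "('a, 'r) qubiframe_scheme \<Rightarrow> ('b, 's) qubiframe_scheme \<Rightarrow> ('a \<Rightarrow> 'b) \<Rightarrow> bool" where
  "qu_surjection L M f \<longleftrightarrow> qu_hom L M f \<and> surjective_hom L M f
     \<and> base_of (image_cover M f ` quni L) (quni M)"

definition qu_iso ::
  "('a, 'r) qubiframe_scheme \<Rightarrow> ('b, 's) qubiframe_scheme \<Rightarrow> ('a \<Rightarrow> 'b) \<Rightarrow> bool" where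
  "qu_iso L M f \<longleftrightarrow> qu_hom L M f \<and> (\<exists>g. qu_hom M L g
     \<and> (\<forall>x\<in>carrier L. g (f x) = x) \<and> (\<forall>y\<in>carrier M. f (g y) = y))"


section \<open>Bicompletion\<close>

text \<open>A formula of HOL cannot quantify over types, so the type \<open>'m\<close> carrying the biframes \<open>M\<close> is a
  parameter of bicompleteness. To assert bicompleteness one proves it for a schematic \<open>'m\<close>. To
  assume it, the instance \<open>('a \<times> 'a) set\<close> is enough, since every dense quasi-uniform
  surjection \<open>h\<close> from some \<open>M\<close> onto \<open>L\<close> is isomorphic to one from a biframe carried by that type:
  writing \<open>h\<^sub>i\<^sub>*\<close> for the right adjoint of the restriction of \<open>h\<close> to the \<open>i\<close>-th parts, density gives
  \<open>h\<^sub>i\<^sub>* (h y) \<le> st\<^sub>i(y, U)\<close> for every \<open>y\<close> in the \<open>i\<close>-th part and every \<open>U\<close>, hence the elements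
  \<open>h\<^sub>1\<^sub>* a \<sqinter> h\<^sub>2\<^sub>* b\<close> are join-dense in \<open>M\<close> and \<open>m \<mapsto> {(a, b). h\<^sub>1\<^sub>* a \<sqinter> h\<^sub>2\<^sub>* b \<le> m}\<close> is injective.\<close>

definition bicomplete :: "'m itself \<Rightarrow> ('a, 'r) qubiframe_scheme \<Rightarrow> bool" where
  "bicomplete _ L \<longleftrightarrow> (\<forall>(M :: 'm qubiframe) h.
     qu_biframe M \<and> qu_surjection M L h \<and> dense_hom M L h \<longrightarrow> qu_iso M L h)"

definition is_bicompletion :: "'m itself \<Rightarrow> ('b, 's) qubiframe_scheme \<Rightarrow> ('b \<Rightarrow> 'a) \<Rightarrow>
    ('a, 'r) qubiframe_scheme \<Rightarrow> bool" where
  "is_bicompletion m C \<gamma> L \<longleftrightarrow>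
     qu_biframe C \<and> qu_surjection C L \<gamma> \<and> dense_hom C L \<gamma> \<and> bicomplete m C"

text \<open>Finite paircovers are closed under intersection, so the filter they generate consists of the
  paircovers that contain one of them.\<close>

definition totally_bounded_coreflection :: "'a qubiframe \<Rightarrow> 'a qubiframe" where
  "totally_bounded_coreflection L = L\<lparr>quni :=
     {V. paircover L V \<and> (\<exists>U\<in>quni L. finitely_generated L U \<and> U \<subseteq> V)}\<rparr>"

definition is_samuel_compactification ::
  "'m itself \<Rightarrow> 'b qubiframe \<Rightarrow> ('b \<Rightarrow> 'a) \<Rightarrow> 'a qubiframe \<Rightarrow> bool" where
  "is_samuel_compactification m K \<rho> L \<longleftrightarrow>
     is_bicompletion m K \<rho> (totally_bounded_coreflection L)"


section \<open>The congruence on the Samuel compactification\<close>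

definition samuel_K ::
  "'b qubiframe \<Rightarrow> ('b \<Rightarrow> 'a) \<Rightarrow> 'a qubiframe \<Rightarrow> ('a \<times> 'a) set \<Rightarrow> ('b \<times> 'b) set" where
  "samuel_K CBL \<rho> L U = (\<Union>(u, v)\<in>U.
     down CBL {(right_adjoint CBL (part1 CBL) L \<rho> u, right_adjoint CBL (part2 CBL) L \<rho> v)})"

definition samuel_Theta :: "'b qubiframe \<Rightarrow> ('b \<Rightarrow> 'a) \<Rightarrow> 'a qubiframe \<Rightarrow> ('b \<times> 'b) set" where
  "samuel_Theta CBL \<rho> L = \<Squnion>\<^bsub>congruence_frame CBL\<^esub>
     ((\<lambda>U. Delta CBL (pairs_join CBL (samuel_K CBL \<rho> L U))) ` quni L)"

end

(* A dense quasi-uniform surjection h from M onto L is determined by closed sets of pairs: sending m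
   to the pairs (a, b) for which the meet of the right adjoints of h at a and b lies below m embeds M
   into the frame of those downsets of L1 x L2 that satisfy the relations expressed by uclosed. The
   frame of all such sets carries a dense quasi-uniform surjection onto L, hence if L is bicomplete
   then each of its closed sets consists of the pairs with meet below some fixed element. Conversely,
   M is bicomplete if every closed set of pairs of L comes from an element of M.

   A closed set D for L pulls back to a closed set for the bicomplete CBL, which therefore comes from
   an element k, and D comes from k as well because L and BL have the same uniformly-below relation.
   By the covering condition on D, the congruence generated by the open congruences of the k_U
   identifies no element below k with one that is not, so D also comes from the class of k in the
   quotient of CBL. Thus the quotient, with the lifted covers, is bicomplete. *)

theory Submission
  imports Defs
begin

section \<open>Frames\<close>

text \<open>The clauses of \<open>uclosed\<close> record what every dense quasi-uniform surjection
  onto L forces on the elements \<open>wedge M (adj_pair p)\<close>: right adjoints are monotone,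
  density sends pairs of zero meet to zero, admissibility makes a lift the join of the lifts of
  uniformly smaller pairs, and uniform covers lift to covers. No clause speaks of arbitrary joins,
  because right adjoints need not preserve them; this is the room in which L differs from its
  completion. HOL shapes the route: bicompleteness of CBL is given only for biframes carried by sets
  of pairs of CBL, while the quotient has to be bicomplete for an arbitrary type. The hypothesis is
  therefore spent once, on the biframe of closed sets of CBL, and an arbitrary surjection onto the
  quotient is handled through its traces on pairs of L. The quotient takes its covers from L along
  \<gamma>. Lifting along \<rho> need not give covers, since k_U may be smaller than 1; in the
  quotient each k_U becomes 1, which is the purpose of the congruence.\<close>

context frame
begin

lemma sup_le_iff: "A \<subseteq> carrier L \<Longrightarrow> z \<in> carrier L \<Longrightarrow> \<Squnion>A \<sqsubseteq> z \<longleftrightarrow> (\<forall>a\<in>A. a \<sqsubseteq> z)"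
  by (meson le_trans sup_closed sup_least sup_upper subsetD)

lemma le_meet_iff:
  "\<lbrakk>x \<in> carrier L; y \<in> carrier L; z \<in> carrier L\<rbrakk> \<Longrightarrow> z \<sqsubseteq> x \<sqinter> y \<longleftrightarrow> z \<sqsubseteq> x \<and> z \<sqsubseteq> y"
  by (meson le_trans meet_closed meet_le meet_left meet_right)

lemma meet_mono:
  "\<lbrakk>x \<sqsubseteq> x'; y \<sqsubseteq> y'; x \<in> carrier L; x' \<in> carrier L; y \<in> carrier L; y' \<in> carrier L\<rbrakk>
    \<Longrightarrow> x \<sqinter> y \<sqsubseteq> x' \<sqinter> y'"
  by (meson le_trans meet_closed meet_le meet_left meet_right)

lemma meet_absorb: "\<lbrakk>x \<sqsubseteq> y; x \<in> carrier L; y \<in> carrier L\<rbrakk> \<Longrightarrow> x \<sqinter> y = x"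
  by (metis le_iff_join)

lemma meet_idem: "x \<in> carrier L \<Longrightarrow> x \<sqinter> x = x"
  by (simp add: meet_absorb)

lemma meet_top: "x \<in> carrier L \<Longrightarrow> x \<sqinter> \<top> = x"
  by (simp add: meet_absorb)

lemma sup_empty: "\<Squnion>{} = \<bottom>"
  using weak_sup_empty by (simp add: eq_is_equal)

lemma le_bottom_iff: "x \<in> carrier L \<Longrightarrow> x \<sqsubseteq> \<bottom> \<longleftrightarrow> x = \<bottom>"
  by (auto intro: le_antisym)

lemma top_le_iff: "x \<in> carrier L \<Longrightarrow> \<top> \<sqsubseteq> x \<longleftrightarrow> x = \<top>"
  by (auto intro: le_antisym)

lemma meet_bottom: "x \<in> carrier L \<Longrightarrow> x \<sqinter> \<bottom> = \<bottom>"
  by (metis bottom_closed bottom_lower meet_absorb meet_comm)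

lemma meet_sup_le_iff:
  assumes "x \<in> carrier L" "A \<subseteq> carrier L" "z \<in> carrier L"
  shows "x \<sqinter> \<Squnion>A \<sqsubseteq> z \<longleftrightarrow> (\<forall>a\<in>A. x \<sqinter> a \<sqsubseteq> z)"
proof -
  have "(\<lambda>a. x \<sqinter> a) ` A \<subseteq> carrier L" using assms by auto
  then show ?thesis using assms by (simp add: meet_Sup_distrib sup_le_iff)
qed

lemma sup_meet_sup_le_iff:
  assumes "A \<subseteq> carrier L" "B \<subseteq> carrier L" "z \<in> carrier L"
  shows "\<Squnion>A \<sqinter> \<Squnion>B \<sqsubseteq> z \<longleftrightarrow> (\<forall>a\<in>A. \<forall>b\<in>B. a \<sqinter> b \<sqsubseteq> z)"
proof -
  have "\<Squnion>A \<sqinter> \<Squnion>B \<sqsubseteq> z \<longleftrightarrow> (\<forall>b\<in>B. b \<sqinter> \<Squnion>A \<sqsubseteq> z)"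
    using assms by (subst meet_sup_le_iff) (simp_all add: meet_comm)
  also have "\<dots> \<longleftrightarrow> (\<forall>b\<in>B. \<forall>a\<in>A. b \<sqinter> a \<sqsubseteq> z)"
    using assms by (intro ball_cong refl meet_sup_le_iff) auto
  finally show ?thesis by (metis meet_comm)
qed

lemma meet_left_commute:
  "\<lbrakk>x \<in> carrier L; y \<in> carrier L; z \<in> carrier L\<rbrakk> \<Longrightarrow> x \<sqinter> (y \<sqinter> z) = y \<sqinter> (x \<sqinter> z)"
  by (metis meet_assoc meet_comm)

lemma sup_eqI:
  assumes "A \<subseteq> carrier L" "s \<in> carrier L"
    and "\<And>z. z \<in> carrier L \<Longrightarrow> s \<sqsubseteq> z \<longleftrightarrow> (\<forall>a\<in>A. a \<sqsubseteq> z)"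
  shows "\<Squnion>A = s"
  using assms by (metis le_antisym le_refl sup_closed sup_le_iff)

lemma bottom_eqI: "b \<in> carrier L \<Longrightarrow> (\<And>x. x \<in> carrier L \<Longrightarrow> b \<sqsubseteq> x) \<Longrightarrow> \<bottom> = b"
  by (metis bottom_closed le_bottom_iff)

lemma top_eqI: "b \<in> carrier L \<Longrightarrow> (\<And>x. x \<in> carrier L \<Longrightarrow> x \<sqsubseteq> b) \<Longrightarrow> \<top> = b"
  by (metis top_closed top_le_iff)

lemma subframeD:
  assumes "subframe S L"
  shows "S \<subseteq> carrier L" "\<top> \<in> S" "x \<in> S \<Longrightarrow> y \<in> S \<Longrightarrow> x \<sqinter> y \<in> S" "A \<subseteq> S \<Longrightarrow> \<Squnion>A \<in> S"
  using assms by (auto simp: subframe_def simp flip: sup_empty)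

lemma subframe_carrier: "subframe (carrier L) L"
  by (simp add: subframe_def)

end

text \<open>The order-theoretic operations of \<open>HOL-Algebra\<close> are choices; this rule identifies them with
  given ones while proving the frame axioms.\<close>

lemma frame_of_operations:
  fixes Q (structure)
  assumes eq: "(.=) = (=)"
    and reflexive: "\<And>x. x \<in> carrier Q \<Longrightarrow> x \<sqsubseteq> x"
    and antisymmetric: "\<And>x y. \<lbrakk>x \<in> carrier Q; y \<in> carrier Q; x \<sqsubseteq> y; y \<sqsubseteq> x\<rbrakk> \<Longrightarrow> x = y"
    and transitive: "\<And>x y z. \<lbrakk>x \<in> carrier Q; y \<in> carrier Q; z \<in> carrier Q; x \<sqsubseteq> y; y \<sqsubseteq> z\<rbrakk> \<Longrightarrow> x \<sqsubseteq> z"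
    and S_closed: "\<And>A. A \<subseteq> carrier Q \<Longrightarrow> S A \<in> carrier Q"
    and S: "\<And>A z. \<lbrakk>A \<subseteq> carrier Q; z \<in> carrier Q\<rbrakk> \<Longrightarrow> S A \<sqsubseteq> z \<longleftrightarrow> (\<forall>a\<in>A. a \<sqsubseteq> z)"
    and m_closed: "\<And>x y. \<lbrakk>x \<in> carrier Q; y \<in> carrier Q\<rbrakk> \<Longrightarrow> m x y \<in> carrier Q"
    and m: "\<And>x y z. \<lbrakk>x \<in> carrier Q; y \<in> carrier Q; z \<in> carrier Q\<rbrakk>
      \<Longrightarrow> z \<sqsubseteq> m x y \<longleftrightarrow> z \<sqsubseteq> x \<and> z \<sqsubseteq> y"
    and distrib: "\<And>x A. \<lbrakk>x \<in> carrier Q; A \<subseteq> carrier Q\<rbrakk> \<Longrightarrow> m x (S A) \<sqsubseteq> S (m x ` A)"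
  shows "frame Q"
    and "A \<subseteq> carrier Q \<Longrightarrow> \<Squnion>A = S A"
    and "x \<in> carrier Q \<Longrightarrow> y \<in> carrier Q \<Longrightarrow> x \<sqinter> y = m x y"
proof -
  interpret partial_order Q
  proof unfold_locales
    show "x \<sqsubseteq> x" if "x \<in> carrier Q" for x using that by (rule reflexive)
    show "x .= y" if "x \<sqsubseteq> y" "y \<sqsubseteq> x" "x \<in> carrier Q" "y \<in> carrier Q" for x y
      unfolding eq using that(3,4,1,2) by (rule antisymmetric)
    show "x \<sqsubseteq> z" if "x \<sqsubseteq> y" "y \<sqsubseteq> z" "x \<in> carrier Q" "y \<in> carrier Q" "z \<in> carrier Q" for x y z
      using that(3,4,5,1,2) by (rule transitive)
    show "x \<sqsubseteq> z \<longleftrightarrow> y \<sqsubseteq> w" if "x .= y" "z .= w" for x y z w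
      using that unfolding eq by blast
    show "(.=) = (=)" by (rule eq)
  qed (unfold eq, blast+)
  have lub: "is_lub Q (S A) A" if A: "A \<subseteq> carrier Q" for A
  proof (rule least_UpperI)
    show "x \<sqsubseteq> S A" if "x \<in> A" for x
      using S[OF A S_closed[OF A]] reflexive[OF S_closed[OF A]] that by simp
    show "S A \<sqsubseteq> y" if "y \<in> Upper Q A" for y
    proof -
      have "y \<in> carrier Q" "\<forall>a\<in>A. a \<sqsubseteq> y" using that A unfolding Upper_def by (simp_all add: subset_iff)
      then show ?thesis by (simp add: S[OF A])
    qed
  qed (simp_all add: A S_closed)
  have glb: "is_glb Q (S {z \<in> carrier Q. \<forall>a\<in>A. z \<sqsubseteq> a}) A" if A: "A \<subseteq> carrier Q" for A
  proof (rule greatest_LowerI)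
    let ?B = "{z \<in> carrier Q. \<forall>a\<in>A. z \<sqsubseteq> a}"
    have B: "?B \<subseteq> carrier Q" by simp
    show "S ?B \<sqsubseteq> x" if "x \<in> A" for x using S[OF B, of x] subsetD[OF A that] that by simp
    show "y \<sqsubseteq> S ?B" if "y \<in> Lower Q A" for y
    proof -
      have "y \<in> ?B" using that A unfolding Lower_def by (simp add: subset_iff)
      then show ?thesis using S[OF B S_closed[OF B]] reflexive[OF S_closed[OF B]] by simp
    qed
    show "S ?B \<in> carrier Q" by (rule S_closed[OF B])
  qed (rule A)
  interpret complete_lattice Q
    by unfold_locales (rule exI, erule lub, rule exI, erule glb)
  show sup: "\<Squnion>A = S A" if "A \<subseteq> carrier Q" for A
    by (rule least_unique[OF sup_lub[OF that] lub[OF that]])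
  show meet: "x \<sqinter> y = m x y" if xy: "x \<in> carrier Q" "y \<in> carrier Q" for x y
  proof (rule le_antisym)
    show "x \<sqinter> y \<sqsubseteq> m x y" using xy m[OF xy, of "x \<sqinter> y"] by (simp add: meet_left meet_right)
    show "m x y \<sqsubseteq> x \<sqinter> y"
      using xy m[OF xy m_closed[OF xy]] reflexive[OF m_closed[OF xy]] m_closed[OF xy] by (simp add: meet_le)
  qed (use xy m_closed in auto)
  show "frame Q"
  proof unfold_locales
    fix x A assume x: "x \<in> carrier Q" and A: "A \<subseteq> carrier Q"
    have im: "(\<lambda>a. x \<sqinter> a) ` A = m x ` A" using x A by (intro image_cong) (simp_all add: meet subset_iff)
    have mA: "m x ` A \<subseteq> carrier Q" using x A m_closed by blast
    show "x \<sqinter> \<Squnion>A = \<Squnion>((\<lambda>a. x \<sqinter> a) ` A)"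
    proof (rule le_antisym)
      show "x \<sqinter> \<Squnion>A \<sqsubseteq> \<Squnion>((\<lambda>a. x \<sqinter> a) ` A)"
        using distrib[OF x A] by (simp only: im sup[OF A] sup[OF mA] meet[OF x S_closed[OF A]])
      show "\<Squnion>((\<lambda>a. x \<sqinter> a) ` A) \<sqsubseteq> x \<sqinter> \<Squnion>A"
      proof (rule sup_least)
        fix y assume "y \<in> (\<lambda>a. x \<sqinter> a) ` A"
        then obtain a where a: "a \<in> A" "y = x \<sqinter> a" by (rule imageE)
        then have "a \<in> carrier Q" "a \<sqsubseteq> \<Squnion>A" using A by (simp_all add: sup_upper subset_iff)
        then show "y \<sqsubseteq> x \<sqinter> \<Squnion>A"
          using a x A le_trans[OF meet_right[of x a]] by (simp add: meet_le meet_left)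
      qed (use x A mA in \<open>simp_all add: im\<close>)
    qed (use x A mA in \<open>simp_all add: im\<close>)
  qed
qed

section \<open>Biframes with indexed parts\<close>

text \<open>The index \<open>True\<close> selects the first part or component and \<open>False\<close> the second, so that the two
  halves of each symmetric argument are treated at once.\<close>

definition part :: "bool \<Rightarrow> ('a, 'r) biframe_scheme \<Rightarrow> 'a set" where
  "part i L = (if i then part1 L else part2 L)"

definition component :: "bool \<Rightarrow> 'a \<times> 'a \<Rightarrow> 'a" where
  "component i p = (if i then fst p else snd p)"

definition pairs :: "('a, 'r) biframe_scheme \<Rightarrow> ('a \<times> 'a) set" where
  "pairs L = part1 L \<times> part2 L"

definition wedge :: "('a, 'r) gorder_scheme \<Rightarrow> 'a \<times> 'a \<Rightarrow> 'a" where
  "wedge L p = fst p \<sqinter>\<^bsub>L\<^esub> snd p"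

definition pair_meet :: "('a, 'r) gorder_scheme \<Rightarrow> 'a \<times> 'a \<Rightarrow> 'a \<times> 'a \<Rightarrow> 'a \<times> 'a" where
  "pair_meet L p q = (fst p \<sqinter>\<^bsub>L\<^esub> fst q, snd p \<sqinter>\<^bsub>L\<^esub> snd q)"

definition star :: "bool \<Rightarrow> ('a, 'r) biframe_scheme \<Rightarrow> 'a \<Rightarrow> ('a \<times> 'a) set \<Rightarrow> 'a" where
  "star i L x U = \<Squnion>\<^bsub>L\<^esub>(component i ` {u \<in> U. x \<sqinter>\<^bsub>L\<^esub> component (\<not> i) u \<noteq> \<bottom>\<^bsub>L\<^esub>})"

lemma component_pair [simp]: "component True (a, b) = a" "component False (a, b) = b"
  by (simp_all add: component_def)

lemma component_pair_meet [simp]: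
  "component i (pair_meet L p q) = component i p \<sqinter>\<^bsub>L\<^esub> component i q"
  by (simp add: component_def pair_meet_def)

lemma wedge_component: "wedge L p = component True p \<sqinter>\<^bsub>L\<^esub> component False p"
  by (simp add: component_def wedge_def)

lemma wedge_component': "wedge L p = component i p \<sqinter>\<^bsub>L\<^esub> component (\<not> i) p"
  by (cases i) (simp_all add: component_def wedge_def meet_comm)

lemma component_map_prod [simp]: "component i (map_prod f f p) = f (component i p)"
  by (simp add: component_def map_prod_def split: prod.split)

lemma mem_pairs_iff: "p \<in> pairs L \<longleftrightarrow> (\<forall>i. component i p \<in> part i L)"
  by (cases p) (simp add: pairs_def part_def component_def all_bool_eq)

lemma pairsD: "p \<in> pairs L \<Longrightarrow> component i p \<in> part i L"
  by (simp add: mem_pairs_iff)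

lemma mem_down_iff:
  "p \<in> down L S \<longleftrightarrow> p \<in> pairs L \<and> (\<exists>q\<in>S. \<forall>i. component i p \<sqsubseteq>\<^bsub>L\<^esub> component i q)"
  by (cases p) (simp add: down_def pairs_def component_def all_bool_eq case_prod_unfold)

lemma pairs_join_wedge: "pairs_join L U = \<Squnion>\<^bsub>L\<^esub>(wedge L ` U)"
  unfolding pairs_join_def wedge_def by (simp add: case_prod_unfold)

lemma st1_eq_star: "st1 L x U = star True L x U"
proof -
  have "{u1. \<exists>u2. (u1, u2) \<in> U \<and> x \<sqinter>\<^bsub>L\<^esub> u2 \<noteq> \<bottom>\<^bsub>L\<^esub>} = component True ` {u \<in> U. x \<sqinter>\<^bsub>L\<^esub> component (\<not> True) u \<noteq> \<bottom>\<^bsub>L\<^esub>}"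
    by (force simp: component_def)
  then show ?thesis by (simp add: st1_def star_def)
qed

lemma st2_eq_star: "st2 L x U = star False L x U"
proof -
  have "{u2. \<exists>u1. (u1, u2) \<in> U \<and> x \<sqinter>\<^bsub>L\<^esub> u1 \<noteq> \<bottom>\<^bsub>L\<^esub>} = component False ` {u \<in> U. x \<sqinter>\<^bsub>L\<^esub> component (\<not> False) u \<noteq> \<bottom>\<^bsub>L\<^esub>}"
    by (force simp: component_def)
  then show ?thesis by (simp add: st2_def star_def)
qed

lemma mem_star_cover_iff:
  "p \<in> star_cover L U \<longleftrightarrow>
    p \<in> pairs L \<and> (\<exists>u\<in>U. \<forall>i. component i p \<sqsubseteq>\<^bsub>L\<^esub> star i L (component i u) U)"
  by (simp add: star_cover_def mem_down_iff case_prod_unfold st1_eq_star st2_eq_star all_bool_eq component_def)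

lemma mem_image_cover_iff:
  "p \<in> image_cover M f U \<longleftrightarrow>
    p \<in> pairs M \<and> (\<exists>u\<in>U. \<forall>i. component i p \<sqsubseteq>\<^bsub>M\<^esub> f (component i u))"
  by (simp add: image_cover_def mem_down_iff)

lemma image_part_iff:
  "h ` part1 L \<subseteq> part1 M \<and> h ` part2 L \<subseteq> part2 M \<longleftrightarrow> (\<forall>i. h ` part i L \<subseteq> part i M)"
  by (simp add: part_def all_bool_eq)

context biframe
begin

lemma subframe_part: "subframe (part i L) L"
  using subframe_part1 subframe_part2 by (simp add: part_def)

lemmas part_subset = subframeD(1)[OF subframe_part]
  and part_top [simp] = subframeD(2)[OF subframe_part]
  and part_meet [simp] = subframeD(3)[OF subframe_part]
  and part_sup = subframeD(4)[OF subframe_part]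

lemma part_carrier [simp]: "x \<in> part i L \<Longrightarrow> x \<in> carrier L"
  using part_subset by blast

lemma pairs_carrier [simp]: "p \<in> pairs L \<Longrightarrow> component i p \<in> carrier L"
  using pairsD part_carrier by blast

lemma wedge_closed [simp]: "p \<in> pairs L \<Longrightarrow> wedge L p \<in> carrier L"
  by (simp add: wedge_component)

lemma wedge_le: "p \<in> pairs L \<Longrightarrow> wedge L p \<sqsubseteq> component i p"
  by (cases i) (simp_all add: wedge_component meet_left meet_right)

lemma pair_meet_pairs [simp]: "p \<in> pairs L \<Longrightarrow> q \<in> pairs L \<Longrightarrow> pair_meet L p q \<in> pairs L"
  by (simp add: mem_pairs_iff)

lemma wedge_pair_meet:
  "p \<in> pairs L \<Longrightarrow> q \<in> pairs L \<Longrightarrow> wedge L (pair_meet L p q) = wedge L p \<sqinter> wedge L q"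
  by (simp add: wedge_component meet_assoc meet_left_commute[of "component False p"])

lemma wedge_mono:
  "\<lbrakk>p \<in> pairs L; q \<in> pairs L; \<And>i. component i p \<sqsubseteq> component i q\<rbrakk> \<Longrightarrow> wedge L p \<sqsubseteq> wedge L q"
  by (simp add: wedge_component meet_mono)

lemma wedge_image_carrier: "U \<subseteq> pairs L \<Longrightarrow> wedge L ` U \<subseteq> carrier L"
  by auto

lemma pairs_join_closed [simp]: "U \<subseteq> pairs L \<Longrightarrow> pairs_join L U \<in> carrier L"
  by (simp add: pairs_join_wedge wedge_image_carrier)

lemma meet_pairs_join_le_iff:
  "\<lbrakk>x \<in> carrier L; U \<subseteq> pairs L; z \<in> carrier L\<rbrakk> \<Longrightarrow>
    x \<sqinter> pairs_join L U \<sqsubseteq> z \<longleftrightarrow> (\<forall>u\<in>U. x \<sqinter> wedge L u \<sqsubseteq> z)"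
  by (simp add: pairs_join_wedge meet_sup_le_iff wedge_image_carrier)

lemma pairs_join_le_iff:
  "\<lbrakk>U \<subseteq> pairs L; z \<in> carrier L\<rbrakk> \<Longrightarrow> pairs_join L U \<sqsubseteq> z \<longleftrightarrow> (\<forall>u\<in>U. wedge L u \<sqsubseteq> z)"
  by (simp add: pairs_join_wedge sup_le_iff wedge_image_carrier)

lemma wedge_le_pairs_join:
  "\<lbrakk>U \<subseteq> pairs L; u \<in> U\<rbrakk> \<Longrightarrow> wedge L u \<sqsubseteq> pairs_join L U"
  unfolding pairs_join_wedge by (intro sup_upper wedge_image_carrier imageI)

lemma component_image_carrier: "U \<subseteq> pairs L \<Longrightarrow> component i ` {u \<in> U. P u} \<subseteq> part i L"
  using pairsD by blast

lemma star_closed: "U \<subseteq> pairs L \<Longrightarrow> star i L x U \<in> part i L"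
  unfolding star_def by (intro part_sup component_image_carrier)

lemma star_carrier [simp]: "U \<subseteq> pairs L \<Longrightarrow> star i L x U \<in> carrier L"
  using star_closed part_carrier by blast

lemma star_le_iff:
  assumes "U \<subseteq> pairs L" "z \<in> carrier L"
  shows "star i L x U \<sqsubseteq> z \<longleftrightarrow> (\<forall>u\<in>U. x \<sqinter> component (\<not> i) u \<noteq> \<bottom> \<longrightarrow> component i u \<sqsubseteq> z)"
proof -
  have "component i ` {u \<in> U. x \<sqinter> component (\<not> i) u \<noteq> \<bottom>} \<subseteq> carrier L"
    using component_image_carrier[OF assms(1)] part_subset by blast
  then show ?thesis using assms(2) unfolding star_def by (subst sup_le_iff) auto
qed

lemma star_upper:
  assumes "U \<subseteq> pairs L" "u \<in> U" "x \<sqinter> component (\<not> i) u \<noteq> \<bottom>"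
  shows "component i u \<sqsubseteq> star i L x U"
  using star_le_iff[OF assms(1) star_carrier[OF assms(1)], of i x i x] assms by (simp add: assms(1))

lemma down_subset: "down L S \<subseteq> pairs L"
  by (auto simp: mem_down_iff)

lemma subset_down: "S \<subseteq> pairs L \<Longrightarrow> S \<subseteq> down L S"
  by (meson le_refl mem_down_iff pairs_carrier subset_iff)

lemma down_down: "S \<subseteq> pairs L \<Longrightarrow> down L (down L S) \<subseteq> down L S"
proof
  assume S: "S \<subseteq> pairs L"
  fix p assume "p \<in> down L (down L S)"
  then obtain q where "p \<in> pairs L" "q \<in> down L S" "\<forall>i. component i p \<sqsubseteq> component i q"
    unfolding mem_down_iff[of p] by blast
  moreover from this obtain r where "q \<in> pairs L" "r \<in> S" "\<forall>i. component i q \<sqsubseteq> component i r"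
    unfolding mem_down_iff[of q] by blast
  ultimately show "p \<in> down L S"
    using S by (meson le_trans mem_down_iff pairs_carrier subsetD)
qed

lemma paircover_iff:
  "paircover L U \<longleftrightarrow> U \<subseteq> pairs L \<and> down L U \<subseteq> U \<and> pairs_join L U = \<top>"
  by (simp add: paircover_def pairs_def)

text \<open>The elements that are the join of the wedges below them form a subframe containing both
  parts, so the generation axiom makes this subframe everything. Wedges are thus join-dense in the
  total part.\<close>

lemma wedges_generate:
  assumes "z \<in> carrier L"
  shows "z = \<Squnion>(wedge L ` {p \<in> pairs L. wedge L p \<sqsubseteq> z})"
proof -
  \<comment> \<open>Membership is tested against upper bounds of the wedges instead of by the
    equation to be proved. In this form closure under joins is immediate; only the meet needs the
    equation, which \<open>eq\<close> restores.\<close>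
  define S where "S = {z \<in> carrier L. \<forall>y\<in>carrier L. (\<forall>p\<in>pairs L. wedge L p \<sqsubseteq> z \<longrightarrow> wedge L p \<sqsubseteq> y) \<longrightarrow> z \<sqsubseteq> y}"
  have W: "wedge L ` {p \<in> pairs L. wedge L p \<sqsubseteq> z} \<subseteq> carrier L" for z by auto
  have parts: "part i L \<subseteq> S" for i
  proof
    fix x assume x: "x \<in> part i L"
    \<comment> \<open>Padding with \<top> in the other coordinate writes an element of either part
      as a wedge.\<close>
    define p where "p = (if i then (x, \<top>) else (\<top>, x))"
    have "p \<in> pairs L"
      using x by (cases i) (simp_all add: p_def mem_pairs_iff all_bool_eq)
    moreover have "wedge L p = x"
      using x part_carrier[OF x] meet_top[of x]
      by (cases i) (simp_all add: p_def wedge_component meet_comm[of L \<top>])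
    ultimately
    show "x \<in> S" using x by (auto simp: S_def dest: bspec[of _ _ p])
  qed
  have "subframe S L"
    unfolding subframe_def
  proof (intro conjI ballI allI impI)
    show "S \<subseteq> carrier L" by (auto simp: S_def)
    show "\<top> \<in> S" using parts part_top by blast
  next
    fix x y assume xy: "x \<in> S" "y \<in> S"
    have c: "x \<in> carrier L" "y \<in> carrier L" using xy by (auto simp: S_def)
    have eq: "v = \<Squnion>(wedge L ` {p \<in> pairs L. wedge L p \<sqsubseteq> v})" if "v \<in> S" for v
    proof (rule le_antisym)
      have "v \<in> carrier L" using that by (simp add: S_def)
      then show "\<Squnion>(wedge L ` {p \<in> pairs L. wedge L p \<sqsubseteq> v}) \<sqsubseteq> v"
        using W by (subst sup_le_iff) auto
      show "v \<sqsubseteq> \<Squnion>(wedge L ` {p \<in> pairs L. wedge L p \<sqsubseteq> v})"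
        using that sup_upper[OF W[of v]] sup_closed[OF W[of v]] unfolding S_def by blast
    qed (use that W in \<open>auto simp: S_def\<close>)
    show "x \<sqinter> y \<in> S"
      unfolding S_def
    proof (intro CollectI conjI ballI impI)
      fix t assume t: "t \<in> carrier L" "\<forall>p\<in>pairs L. wedge L p \<sqsubseteq> x \<sqinter> y \<longrightarrow> wedge L p \<sqsubseteq> t"
      \<comment> \<open>The meet of two wedges is the wedge of \<open>pair_meet L p q\<close>, so
        distributivity turns the meet of two joins of wedges into a join of wedges below
        \<open>x \<sqinter> y\<close>.\<close>
      have "wedge L p \<sqinter> wedge L q \<sqsubseteq> t"
        if "p \<in> pairs L" "q \<in> pairs L" "wedge L p \<sqsubseteq> x" "wedge L q \<sqsubseteq> y" for p q
        using t(2) that c meet_mono[OF that(3,4)] pair_meet_pairs[OF that(1,2)]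
        by (simp flip: wedge_pair_meet)
      then have "\<Squnion>(wedge L ` {p \<in> pairs L. wedge L p \<sqsubseteq> x}) \<sqinter> \<Squnion>(wedge L ` {p \<in> pairs L. wedge L p \<sqsubseteq> y}) \<sqsubseteq> t"
        using W t(1) by (subst sup_meet_sup_le_iff) auto
      then show "x \<sqinter> y \<sqsubseteq> t" using eq[OF xy(1)] eq[OF xy(2)] by simp
    qed (use c in simp)
  next
    fix A assume A: "A \<subseteq> S"
    then have Ac: "A \<subseteq> carrier L" by (auto simp: S_def)
    show "\<Squnion>A \<in> S"
      unfolding S_def
    proof (intro CollectI conjI ballI impI)
      fix t assume t: "t \<in> carrier L" "\<forall>p\<in>pairs L. wedge L p \<sqsubseteq> \<Squnion>A \<longrightarrow> wedge L p \<sqsubseteq> t"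
      have "a \<sqsubseteq> t" if "a \<in> A" for a
      proof -
        have "a \<sqsubseteq> \<Squnion>A" "a \<in> carrier L" "\<Squnion>A \<in> carrier L" using that Ac by (auto intro: sup_upper)
        then have "\<forall>p\<in>pairs L. wedge L p \<sqsubseteq> a \<longrightarrow> wedge L p \<sqsubseteq> t"
          using t(2) by (metis le_trans wedge_closed)
        then show ?thesis using A that t(1) by (auto simp: S_def)
      qed
      then show "\<Squnion>A \<sqsubseteq> t" using Ac t(1) by (simp add: sup_le_iff)
    qed (use Ac in simp)
  qed
  then have "S = carrier L"
    using parts[of True] parts[of False] by (intro generated) (auto simp: part_def)
  then have "z \<in> S" using assms by simp
  show ?thesis
  proof (rule le_antisym)
    show "\<Squnion>(wedge L ` {p \<in> pairs L. wedge L p \<sqsubseteq> z}) \<sqsubseteq> z"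
      using W assms by (subst sup_le_iff) auto
    show "z \<sqsubseteq> \<Squnion>(wedge L ` {p \<in> pairs L. wedge L p \<sqsubseteq> z})"
      using \<open>z \<in> S\<close> sup_upper[OF W[of z]] sup_closed[OF W[of z]] unfolding S_def by blast
  qed (use assms W in auto)
qed

lemma le_iff_wedges:
  assumes "x \<in> carrier L" "y \<in> carrier L"
  shows "x \<sqsubseteq> y \<longleftrightarrow> (\<forall>p\<in>pairs L. wedge L p \<sqsubseteq> x \<longrightarrow> wedge L p \<sqsubseteq> y)"
proof -
  have "\<Squnion>(wedge L ` {p \<in> pairs L. wedge L p \<sqsubseteq> x}) \<sqsubseteq> y \<longleftrightarrow> (\<forall>p\<in>pairs L. wedge L p \<sqsubseteq> x \<longrightarrow> wedge L p \<sqsubseteq> y)"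
    using assms by (subst sup_le_iff) auto
  then show ?thesis by (simp flip: wedges_generate[OF assms(1)])
qed

end

section \<open>Quasi-uniformities\<close>

text \<open>This is the uniformly-below relation of the i-th part: admissibility says that each
  element of the part is the join of the elements in this relation to it.\<close>

definition below :: "bool \<Rightarrow> ('a, 'r) qubiframe_scheme \<Rightarrow> 'a \<Rightarrow> 'a \<Rightarrow> bool" where
  "below i L y x \<longleftrightarrow> y \<in> part i L \<and> (\<exists>U\<in>quni L. star i L y U \<sqsubseteq>\<^bsub>L\<^esub> x)"

lemma below_part: "below i L y x \<Longrightarrow> y \<in> part i L"
  by (simp add: below_def)

context biframe
begin

lemma star_mono:
  assumes "x \<sqsubseteq> x'" "U \<subseteq> U'" "U' \<subseteq> pairs L" "x \<in> carrier L" "x' \<in> carrier L"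
  shows "star i L x U \<sqsubseteq> star i L x' U'"
proof -
  have U: "U \<subseteq> pairs L" using assms by blast
  have "component i u \<sqsubseteq> star i L x' U'" if u: "u \<in> U" "x \<sqinter> component (\<not> i) u \<noteq> \<bottom>" for u
  proof (rule star_upper)
    have c: "component (\<not> i) u \<in> carrier L" using U u(1) pairs_carrier by blast
    show "x' \<sqinter> component (\<not> i) u \<noteq> \<bottom>"
    proof
      assume "x' \<sqinter> component (\<not> i) u = \<bottom>"
      then have "x \<sqinter> component (\<not> i) u \<sqsubseteq> \<bottom>"
        using meet_mono[OF assms(1) le_refl[OF c]] assms c by simp
      then show False using u(2) assms(4) c by (simp add: le_bottom_iff)
    qed
  qed (use u assms(2,3) in blast)+
  then show ?thesis using U assms(3) by (simp add: star_le_iff)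
qed

text \<open>If \<open>v\<close> meets the star of \<open>y\<close>, it already meets the i-th
  component of some \<open>w\<close> in V whose other component meets \<open>y\<close>. The pair of
  stars of \<open>w\<close> belongs to V* and so to U; its i-th component contains that of
  \<open>v\<close>, and its other component still meets \<open>y\<close>. The hypothesis
  \<open>cover\<close> is what V contributes by being a cover.\<close>

lemma star_star_le:
  assumes "star_cover L V \<subseteq> U" "V \<subseteq> pairs L" "U \<subseteq> pairs L" "y \<in> carrier L"
    and cover: "\<And>i x. x \<in> part i L \<Longrightarrow> x \<sqsubseteq> star i L x V"
  shows "star i L (star i L y V) V \<sqsubseteq> star i L y U"
proof -
  have "component i v \<sqsubseteq> star i L y U"
    if v: "v \<in> V" "star i L y V \<sqinter> component (\<not> i) v \<noteq> \<bottom>" for v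
  proof -
    have vp: "v \<in> pairs L" using v assms by blast
    let ?A = "component i ` {u \<in> V. y \<sqinter> component (\<not> i) u \<noteq> \<bottom>}"
    have A: "?A \<subseteq> carrier L" using component_image_carrier[OF assms(2)] part_subset by blast
    have "\<not> component (\<not> i) v \<sqinter> \<Squnion>?A \<sqsubseteq> \<bottom>"
      using v A vp by (simp add: star_def le_bottom_iff meet_comm)
    then obtain w where w: "w \<in> V" "y \<sqinter> component (\<not> i) w \<noteq> \<bottom>"
      "\<not> component (\<not> i) v \<sqinter> component i w \<sqsubseteq> \<bottom>"
      unfolding meet_sup_le_iff[OF pairs_carrier[OF vp] A bottom_closed] by blast
    then have w3: "component i w \<sqinter> component (\<not> i) v \<noteq> \<bottom>"
      by (metis bottom_closed le_refl meet_comm)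
    define p where "p = (star True L (fst w) V, star False L (snd w) V)"
    have p: "component j p = star j L (component j w) V" for j
      by (cases j) (simp_all add: p_def component_def)
    have wp: "w \<in> pairs L" using w assms by blast
    have "p \<in> pairs L" using assms(2) by (simp add: mem_pairs_iff p star_closed)
    then have "p \<in> star_cover L V"
      unfolding mem_star_cover_iff using w(1) p by (metis le_refl pairs_carrier)
    then have pU: "p \<in> U" using assms by blast
    have "component (\<not> i) w \<sqsubseteq> component (\<not> i) p" unfolding p using wp by (intro cover pairsD)
    then have "y \<sqinter> component (\<not> i) w \<sqsubseteq> y \<sqinter> component (\<not> i) p"
      using assms(4) wp \<open>p \<in> pairs L\<close> by (intro meet_mono) simp_all
    then have "y \<sqinter> component (\<not> i) p \<noteq> \<bottom>"
      using w(2) assms(4) wp by (metis le_bottom_iff meet_closed pairs_carrier)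
    then have "component i p \<sqsubseteq> star i L y U" using assms(3) pU by (intro star_upper)
    moreover have "component i v \<sqsubseteq> component i p"
      unfolding p using assms(2) v(1) w3 by (intro star_upper)
    ultimately show ?thesis
      using vp \<open>p \<in> pairs L\<close> assms(3) by (meson le_trans pairs_carrier star_carrier)
  qed
  then show ?thesis using assms by (simp add: star_le_iff)
qed

text \<open>The cover splits \<open>x\<close> into the pieces \<open>x \<sqinter> wedge L u\<close>.
  A piece is zero if \<open>x\<close> misses the other component of \<open>u\<close>, and otherwise
  it lies under the i-th component, which is one of the joinands of the star.\<close>

lemma le_starI:
  assumes "U \<subseteq> pairs L" "pairs_join L U = \<top>" "x \<in> carrier L"
  shows "x \<sqsubseteq> star i L x U"
proof -
  have "x \<sqinter> wedge L u \<sqsubseteq> star i L x U" if u: "u \<in> U" for u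
  proof -
    have up: "u \<in> pairs L" using u assms by blast
    show ?thesis
    proof (cases "x \<sqinter> component (\<not> i) u = \<bottom>")
      case True
      have "x \<sqinter> wedge L u \<sqsubseteq> x \<sqinter> component (\<not> i) u"
        using up assms by (intro meet_mono wedge_le) simp_all
      then show ?thesis using True assms up by (simp add: le_bottom_iff)
    next
      case False
      then have "component i u \<sqsubseteq> star i L x U" by (intro star_upper assms u)
      moreover have "x \<sqinter> wedge L u \<sqsubseteq> component i u"
        using up assms wedge_le[OF up, of i] meet_right[of x "wedge L u"]
        by (meson le_trans meet_closed pairs_carrier wedge_closed)
      ultimately show ?thesis using up assms
        by (meson le_trans meet_closed pairs_carrier wedge_closed star_carrier)
    qed
  qed
  then have "x \<sqinter> pairs_join L U \<sqsubseteq> star i L x U"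
    unfolding meet_pairs_join_le_iff[OF assms(3,1) star_carrier[OF assms(1)]] by (rule ballI)
  then show ?thesis using assms(2,3) by (simp add: meet_top)
qed

end

context qu_biframe
begin

lemma quni_paircover: "U \<in> quni L \<Longrightarrow> paircover L U"
  using filter unfolding paircover_filter_def by blast

lemma quni_subset: "U \<in> quni L \<Longrightarrow> U \<subseteq> pairs L"
  using quni_paircover paircover_iff by blast

lemma quni_pairs: "U \<in> quni L \<Longrightarrow> u \<in> U \<Longrightarrow> u \<in> pairs L"
  using quni_subset by blast

lemma quni_join: "U \<in> quni L \<Longrightarrow> pairs_join L U = \<top>"
  using quni_paircover paircover_iff by blast

lemma quni_Int: "U \<in> quni L \<Longrightarrow> V \<in> quni L \<Longrightarrow> U \<inter> V \<in> quni L"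
  using filter unfolding paircover_filter_def by blast

lemma quni_nonempty: "\<exists>U. U \<in> quni L"
  using filter unfolding paircover_filter_def by blast

lemma quni_upward: "U \<in> quni L \<Longrightarrow> paircover L V \<Longrightarrow> U \<subseteq> V \<Longrightarrow> V \<in> quni L"
  using filter unfolding paircover_filter_def by blast

lemma quni_down:
  "\<lbrakk>U \<in> quni L; u \<in> U; p \<in> pairs L; \<And>i. component i p \<sqsubseteq> component i u\<rbrakk> \<Longrightarrow> p \<in> U"
  using quni_paircover[of U] unfolding paircover_iff mem_down_iff subset_iff by blast

lemma star_quni_part [simp]: "U \<in> quni L \<Longrightarrow> star i L x U \<in> part i L"
  by (simp add: star_closed quni_subset)

lemma le_star: "U \<in> quni L \<Longrightarrow> x \<in> carrier L \<Longrightarrow> x \<sqsubseteq> star i L x U"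
  by (simp add: le_starI quni_join quni_subset)

lemma le_by_cover:
  assumes "U \<in> quni L" "x \<in> carrier L" "z \<in> carrier L" "\<And>u. u \<in> U \<Longrightarrow> x \<sqinter> wedge L u \<sqsubseteq> z"
  shows "x \<sqsubseteq> z"
proof -
  have "x \<sqinter> pairs_join L U \<sqsubseteq> z" using assms by (simp add: meet_pairs_join_le_iff quni_subset)
  then show ?thesis using assms by (simp add: quni_join meet_top)
qed

lemma below_le: "below i L y x \<Longrightarrow> x \<in> carrier L \<Longrightarrow> y \<sqsubseteq> x"
  unfolding below_def using le_star by (meson le_trans part_carrier star_quni_part)

lemma below_mono_right: "\<lbrakk>below i L y x; x \<sqsubseteq> x'; x \<in> carrier L; x' \<in> carrier L\<rbrakk> \<Longrightarrow> below i L y x'"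
  unfolding below_def by (meson le_trans part_carrier star_quni_part)

lemma below_meet:
  assumes "below i L y x" "below i L y' x'" "x \<in> carrier L" "x' \<in> carrier L"
  shows "below i L (y \<sqinter> y') (x \<sqinter> x')"
proof -
  obtain U U' where U: "U \<in> quni L" "star i L y U \<sqsubseteq> x" "U' \<in> quni L" "star i L y' U' \<sqsubseteq> x'"
    using assms unfolding below_def by blast
  have y: "y \<in> part i L" "y' \<in> part i L" using assms by (simp_all add: below_def)
  have c: "y \<sqinter> y' \<in> carrier L" using y by simp
  have I: "U \<inter> U' \<in> quni L" using U quni_Int by blast
  have "star i L (y \<sqinter> y') (U \<inter> U') \<sqsubseteq> star i L y U"
    using y U c by (intro star_mono meet_left) (simp_all add: quni_subset)
  moreover have "star i L (y \<sqinter> y') (U \<inter> U') \<sqsubseteq> star i L y' U'"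
    using y U c by (intro star_mono meet_right) (simp_all add: quni_subset)
  ultimately have "star i L (y \<sqinter> y') (U \<inter> U') \<sqsubseteq> x \<sqinter> x'"
    using I U assms by (meson le_meet_iff le_trans part_carrier star_quni_part)
  then show ?thesis using I y unfolding below_def by auto
qed

text \<open>The interpolant is the star of \<open>y\<close> in a star refinement V of a cover
  witnessing the relation; \<open>star_star_le\<close> leaves room for the second star.\<close>

lemma below_interpolate:
  assumes "below i L y x" "x \<in> carrier L"
  obtains z where "below i L y z" "below i L z x"
proof -
  obtain U where U: "U \<in> quni L" "star i L y U \<sqsubseteq> x" and y: "y \<in> part i L"
    using assms unfolding below_def by blast
  obtain V where V: "V \<in> quni L" "star_cover L V \<subseteq> U" using star_refinement U by blast
  have "star i L (star i L y V) V \<sqsubseteq> star i L y U"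
    using V U y by (intro star_star_le) (simp_all add: quni_subset le_star)
  then have "star i L (star i L y V) V \<sqsubseteq> x"
    using U V assms by (meson le_trans part_carrier star_quni_part)
  then show thesis
    using V y by (intro that[of "star i L y V"]) (auto simp: below_def quni_subset intro!: bexI[of _ V])
qed

lemma admissible: "x \<in> part i L \<Longrightarrow> x = \<Squnion>{y. below i L y x}"
proof -
  assume x: "x \<in> part i L"
  show "x = \<Squnion>{y. below i L y x}"
  proof (cases i)
    case True
    then have "x \<in> part1 L" using x by (simp add: part_def)
    from admissible1[OF this] show ?thesis
      using True by (simp add: below_def part_def st1_eq_star)
  next
    case False
    then have "x \<in> part2 L" using x by (simp add: part_def)
    from admissible2[OF this] show ?thesis
      using False by (simp add: below_def part_def st2_eq_star)
  qed
qed

lemma below_carrier: "{y. below i L y x} \<subseteq> carrier L"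
  by (auto dest: below_part)

text \<open>Both components are joins of the elements uniformly below them, and the binary meet
  distributes over the two joins. This is the approximation clause of \<open>uclosed\<close> for the
  pairs with wedge below \<open>z\<close>.\<close>

lemma wedge_le_iff_below:
  assumes "p \<in> pairs L" "z \<in> carrier L"
  shows "wedge L p \<sqsubseteq> z \<longleftrightarrow>
    (\<forall>q\<in>pairs L. (\<forall>i. below i L (component i q) (component i p)) \<longrightarrow> wedge L q \<sqsubseteq> z)"
proof -
  let ?B = "\<lambda>i. {y. below i L y (component i p)}"
  have "wedge L p = \<Squnion>(?B True) \<sqinter> \<Squnion>(?B False)"
    by (simp add: wedge_component pairsD[OF assms(1)] flip: admissible)
  moreover have "\<Squnion>(?B True) \<sqinter> \<Squnion>(?B False) \<sqsubseteq> z \<longleftrightarrow> (\<forall>a\<in>?B True. \<forall>b\<in>?B False. a \<sqinter> b \<sqsubseteq> z)"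
    using below_carrier assms by (intro sup_meet_sup_le_iff) simp_all
  moreover have "(\<forall>a\<in>?B True. \<forall>b\<in>?B False. a \<sqinter> b \<sqsubseteq> z) \<longleftrightarrow>
    (\<forall>q\<in>pairs L. (\<forall>i. below i L (component i q) (component i p)) \<longrightarrow> wedge L q \<sqsubseteq> z)"
    using below_part[of True L] below_part[of False L]
    by (auto simp: all_bool_eq pairs_def part_def component_def wedge_def)
  ultimately show ?thesis by simp
qed

end

text \<open>The closed sets of pairs present the completion: \<open>(a, b)\<close> stands for the meet of the largest
  lifts of \<open>a\<close> and \<open>b\<close> to a completion, and an element of the completion for the set of pairs
  whose meet lies below it.\<close>

definition uclosed :: "('a, 'r) qubiframe_scheme \<Rightarrow> ('a \<times> 'a) set \<Rightarrow> bool" where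
  "uclosed L D \<longleftrightarrow> D \<subseteq> pairs L
    \<and> (\<forall>p\<in>pairs L. \<forall>q\<in>D. (\<forall>i. component i p \<sqsubseteq>\<^bsub>L\<^esub> component i q) \<longrightarrow> p \<in> D)
    \<and> (\<forall>p\<in>pairs L. wedge L p = \<bottom>\<^bsub>L\<^esub> \<longrightarrow> p \<in> D)
    \<and> (\<forall>p\<in>pairs L. (\<forall>q\<in>pairs L. (\<forall>i. below i L (component i q) (component i p)) \<longrightarrow> q \<in> D) \<longrightarrow> p \<in> D)
    \<and> (\<forall>p\<in>pairs L. \<forall>U\<in>quni L. (\<forall>u\<in>U. pair_meet L p u \<in> D) \<longrightarrow> p \<in> D)"

lemma uclosedD:
  assumes "uclosed L D"
  shows "p \<in> D \<Longrightarrow> p \<in> pairs L"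
    and "\<lbrakk>p \<in> pairs L; q \<in> D; \<And>i. component i p \<sqsubseteq>\<^bsub>L\<^esub> component i q\<rbrakk> \<Longrightarrow> p \<in> D"
    and "\<lbrakk>p \<in> pairs L; wedge L p = \<bottom>\<^bsub>L\<^esub>\<rbrakk> \<Longrightarrow> p \<in> D"
    and "\<lbrakk>p \<in> pairs L; \<And>q. \<lbrakk>q \<in> pairs L; \<And>i. below i L (component i q) (component i p)\<rbrakk> \<Longrightarrow> q \<in> D\<rbrakk> \<Longrightarrow> p \<in> D"
    and "\<lbrakk>p \<in> pairs L; U \<in> quni L; \<And>u. u \<in> U \<Longrightarrow> pair_meet L p u \<in> D\<rbrakk> \<Longrightarrow> p \<in> D"
  using assms unfolding uclosed_def by (blast, blast, blast, blast, blast)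

lemma uclosedI:
  assumes "D \<subseteq> pairs L"
    and "\<And>p q. \<lbrakk>p \<in> pairs L; q \<in> D; \<And>i. component i p \<sqsubseteq>\<^bsub>L\<^esub> component i q\<rbrakk> \<Longrightarrow> p \<in> D"
    and "\<And>p. \<lbrakk>p \<in> pairs L; wedge L p = \<bottom>\<^bsub>L\<^esub>\<rbrakk> \<Longrightarrow> p \<in> D"
    and "\<And>p. \<lbrakk>p \<in> pairs L; \<And>q. \<lbrakk>q \<in> pairs L; \<And>i. below i L (component i q) (component i p)\<rbrakk> \<Longrightarrow> q \<in> D\<rbrakk> \<Longrightarrow> p \<in> D"
    and "\<And>p U. \<lbrakk>p \<in> pairs L; U \<in> quni L; \<And>u. u \<in> U \<Longrightarrow> pair_meet L p u \<in> D\<rbrakk> \<Longrightarrow> p \<in> D"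
  shows "uclosed L D"
  unfolding uclosed_def using assms by blast

section \<open>Dense surjections\<close>

locale dense_surjection = M: biframe M + L: biframe L
  for M :: "('m, 'r) biframe_scheme" and L :: "('a, 's) biframe_scheme" and h +
  assumes hom: "biframe_hom M L h" and surj: "surjective_hom M L h" and dense: "dense_hom M L h"
begin

definition adj :: "bool \<Rightarrow> 'a \<Rightarrow> 'm" where
  "adj i = right_adjoint M (part i M) L h"

definition adj_pair :: "'a \<times> 'a \<Rightarrow> 'm \<times> 'm" where
  "adj_pair p = (adj True (fst p), adj False (snd p))"

text \<open>For a downset U of pairs of L this is the full preimage of U under h \<times> h; along
  the Samuel compactification it is the downset K_U.\<close>

definition lift_cover :: "('a \<times> 'a) set \<Rightarrow> ('m \<times> 'm) set" where
  "lift_cover U = down M (adj_pair ` U)"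

lemma component_adj_pair [simp]: "component i (adj_pair p) = adj i (component i p)"
  by (simp add: component_def adj_pair_def)

lemma frame_hom: "frame_hom M L h"
  using hom by (simp add: biframe_hom_def)

lemma h_closed [simp]: "x \<in> carrier M \<Longrightarrow> h x \<in> carrier L"
  using frame_hom by (auto simp: frame_hom_def)

lemma h_top [simp]: "h \<top>\<^bsub>M\<^esub> = \<top>\<^bsub>L\<^esub>"
  using frame_hom by (simp add: frame_hom_def)

lemma h_meet [simp]: "\<lbrakk>x \<in> carrier M; y \<in> carrier M\<rbrakk> \<Longrightarrow> h (x \<sqinter>\<^bsub>M\<^esub> y) = h x \<sqinter>\<^bsub>L\<^esub> h y"
  using frame_hom by (simp add: frame_hom_def)

lemma h_sup: "A \<subseteq> carrier M \<Longrightarrow> h (\<Squnion>\<^bsub>M\<^esub>A) = \<Squnion>\<^bsub>L\<^esub>(h ` A)"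
  using frame_hom by (simp add: frame_hom_def)

lemma h_bottom [simp]: "h \<bottom>\<^bsub>M\<^esub> = \<bottom>\<^bsub>L\<^esub>"
  using h_sup[of "{}"] by (simp add: M.sup_empty L.sup_empty)

lemma h_mono: "\<lbrakk>x \<sqsubseteq>\<^bsub>M\<^esub> y; x \<in> carrier M; y \<in> carrier M\<rbrakk> \<Longrightarrow> h x \<sqsubseteq>\<^bsub>L\<^esub> h y"
  by (metis L.meet_right M.meet_absorb h_closed h_meet)

lemma h_part: "h ` part i M = part i L"
  using surj by (simp add: surjective_hom_def part_def)

lemma h_part_closed [simp]: "x \<in> part i M \<Longrightarrow> h x \<in> part i L"
  using h_part by blast

lemma h_eq_bottom_iff: "x \<in> carrier M \<Longrightarrow> h x = \<bottom>\<^bsub>L\<^esub> \<longleftrightarrow> x = \<bottom>\<^bsub>M\<^esub>"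
  using dense h_bottom by (auto simp: dense_hom_def)

lemma h_wedge: "p \<in> pairs M \<Longrightarrow> h (wedge M p) = wedge L (map_prod h h p)"
  by (simp add: wedge_component)

lemma map_prod_pairs [simp]: "p \<in> pairs M \<Longrightarrow> map_prod h h p \<in> pairs L"
  by (simp add: mem_pairs_iff)

lemma h_pairs_join:
  assumes "U \<subseteq> pairs M"
  shows "h (pairs_join M U) = pairs_join L (map_prod h h ` U)"
proof -
  have "h ` wedge M ` U = wedge L ` map_prod h h ` U"
    using assms h_wedge unfolding image_image by (intro image_cong) blast+
  then show ?thesis
    using assms by (simp add: pairs_join_wedge h_sup M.wedge_image_carrier)
qed

lemma adj_part [simp]: "b \<in> carrier L \<Longrightarrow> adj i b \<in> part i M"
  unfolding adj_def
  by (rule right_adjoint_galois(1)[OF M.frame_axioms M.subframe_part L.complete_lattice_axioms frame_hom])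

lemma le_adj_iff: "\<lbrakk>b \<in> carrier L; x \<in> part i M\<rbrakk> \<Longrightarrow> x \<sqsubseteq>\<^bsub>M\<^esub> adj i b \<longleftrightarrow> h x \<sqsubseteq>\<^bsub>L\<^esub> b"
  unfolding adj_def
  by (rule right_adjoint_galois(2)[OF M.frame_axioms M.subframe_part L.complete_lattice_axioms frame_hom,
        symmetric])

lemma adj_carrier [simp]: "b \<in> carrier L \<Longrightarrow> adj i b \<in> carrier M"
  by (meson M.part_carrier adj_part)

lemma le_adj_h: "x \<in> part i M \<Longrightarrow> x \<sqsubseteq>\<^bsub>M\<^esub> adj i (h x)"
  by (simp add: le_adj_iff)

lemma h_adj [simp]:
  assumes "b \<in> part i L"
  shows "h (adj i b) = b"
proof -
  obtain x where x: "x \<in> part i M" "b = h x" using assms h_part by blast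
  show ?thesis
  proof (rule L.le_antisym)
    show "h (adj i b) \<sqsubseteq>\<^bsub>L\<^esub> b" using x le_adj_iff[of b "adj i b" i] by simp
    show "b \<sqsubseteq>\<^bsub>L\<^esub> h (adj i b)" using x le_adj_h[of x i] by (simp add: h_mono)
  qed (use assms in simp_all)
qed

lemma adj_mono: "\<lbrakk>a \<sqsubseteq>\<^bsub>L\<^esub> b; a \<in> part i L; b \<in> part i L\<rbrakk> \<Longrightarrow> adj i a \<sqsubseteq>\<^bsub>M\<^esub> adj i b"
  by (simp add: le_adj_iff)

lemma adj_meet:
  assumes "a \<in> part i L" "b \<in> part i L"
  shows "adj i (a \<sqinter>\<^bsub>L\<^esub> b) = adj i a \<sqinter>\<^bsub>M\<^esub> adj i b"
proof (rule M.le_antisym)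
  show "adj i (a \<sqinter>\<^bsub>L\<^esub> b) \<sqsubseteq>\<^bsub>M\<^esub> adj i a \<sqinter>\<^bsub>M\<^esub> adj i b"
    using assms by (intro M.meet_le adj_mono) (simp_all add: L.meet_left L.meet_right)
  show "adj i a \<sqinter>\<^bsub>M\<^esub> adj i b \<sqsubseteq>\<^bsub>M\<^esub> adj i (a \<sqinter>\<^bsub>L\<^esub> b)"
    using assms by (simp add: le_adj_iff)
qed (use assms in simp_all)

lemma adj_pair_pairs [simp]: "p \<in> pairs L \<Longrightarrow> adj_pair p \<in> pairs M"
  by (simp add: mem_pairs_iff)

lemma map_prod_adj_pair [simp]: "p \<in> pairs L \<Longrightarrow> map_prod h h (adj_pair p) = p"
  by (cases p) (simp add: adj_pair_def pairs_def part_def h_adj[of _ True] h_adj[of _ False])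

lemma h_wedge_adj: "p \<in> pairs L \<Longrightarrow> h (wedge M (adj_pair p)) = wedge L p"
  by (simp add: h_wedge)

lemma wedge_adj_pair_meet:
  assumes "p \<in> pairs L" "q \<in> pairs L"
  shows "wedge M (adj_pair (pair_meet L p q)) = wedge M (adj_pair p) \<sqinter>\<^bsub>M\<^esub> wedge M (adj_pair q)"
proof -
  have "adj_pair (pair_meet L p q) = pair_meet M (adj_pair p) (adj_pair q)"
    using assms by (simp add: adj_pair_def pair_meet_def pairs_def mem_Times_iff part_def
        adj_meet[of _ True, simplified part_def] adj_meet[of _ False, simplified part_def])
  then show ?thesis using assms by (simp add: M.wedge_pair_meet)
qed

lemma mem_lift_cover_iff:
  "p \<in> lift_cover U \<longleftrightarrow> p \<in> pairs M \<and> (\<exists>u\<in>U. \<forall>i. component i p \<sqsubseteq>\<^bsub>M\<^esub> adj i (component i u))"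
  by (simp add: lift_cover_def mem_down_iff)

lemma le_adj_pair: "p \<in> pairs M \<Longrightarrow> component i p \<sqsubseteq>\<^bsub>M\<^esub> adj i (h (component i p))"
  by (simp add: le_adj_h pairsD)

lemma pairs_join_lift_cover:
  assumes "U \<subseteq> pairs L"
  shows "pairs_join M (lift_cover U) = pairs_join M (adj_pair ` U)"
proof -
  have s: "lift_cover U \<subseteq> pairs M" by (simp add: lift_cover_def M.down_subset)
  have a: "adj_pair ` U \<subseteq> pairs M" using assms adj_pair_pairs by blast
  show ?thesis
  proof (rule M.le_antisym)
    have "wedge M p \<sqsubseteq>\<^bsub>M\<^esub> pairs_join M (adj_pair ` U)" if "p \<in> lift_cover U" for p
    proof -
      obtain u where u: "u \<in> U" "\<And>i. component i p \<sqsubseteq>\<^bsub>M\<^esub> adj i (component i u)" and p: "p \<in> pairs M"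
        using \<open>p \<in> lift_cover U\<close> mem_lift_cover_iff by blast
      have up: "adj_pair u \<in> pairs M" using u(1) a by blast
      have "wedge M p \<sqsubseteq>\<^bsub>M\<^esub> wedge M (adj_pair u)" using p up u(2) by (intro M.wedge_mono) simp_all
      moreover have "wedge M (adj_pair u) \<sqsubseteq>\<^bsub>M\<^esub> pairs_join M (adj_pair ` U)"
        unfolding pairs_join_wedge using u(1) a by (intro M.sup_upper) auto
      ultimately show ?thesis
        using p up a by (meson M.le_trans M.pairs_join_closed M.wedge_closed)
    qed
    then show "pairs_join M (lift_cover U) \<sqsubseteq>\<^bsub>M\<^esub> pairs_join M (adj_pair ` U)"
      using s a by (simp add: M.pairs_join_le_iff)
    have "adj_pair ` U \<subseteq> lift_cover U" unfolding lift_cover_def by (rule M.subset_down[OF a])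
    then show "pairs_join M (adj_pair ` U) \<sqsubseteq>\<^bsub>M\<^esub> pairs_join M (lift_cover U)"
      unfolding pairs_join_wedge using s a by (intro M.sup_least M.sup_upper M.sup_closed) auto
  qed (use s a in simp_all)
qed

end

text \<open>L enters as a bare biframe, so that the results also serve the Samuel compactification,
  whose covers correspond to those of the totally bounded coreflection and not to all covers of
  L.\<close>

locale qu_dense_surjection = dense_surjection M L h + M: qu_biframe M
  for M :: "('m, 'r) qubiframe_scheme" and L :: "('a, 's) biframe_scheme" and h
begin

text \<open>The elements \<open>y\<close> and \<open>adj i (h y)\<close> have the same image, so by
  density they miss the same components of pairs of V. Splitting \<open>adj i (h y)\<close> along V,
  the pieces that are not forced to be zero lie under components collected in the star of
  \<open>y\<close>.\<close>

lemma adj_h_le_star: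
  assumes y: "y \<in> part i M" and V: "V \<in> quni M"
  shows "adj i (h y) \<sqsubseteq>\<^bsub>M\<^esub> star i M y V"
proof (rule M.le_by_cover[OF V])
  let ?z = "adj i (h y)"
  have yc: "y \<in> carrier M" using y M.part_carrier by blast
  fix v assume v: "v \<in> V"
  then have vp: "v \<in> pairs M" using V M.quni_pairs by blast
  show "?z \<sqinter>\<^bsub>M\<^esub> wedge M v \<sqsubseteq>\<^bsub>M\<^esub> star i M y V"
  proof (cases "y \<sqinter>\<^bsub>M\<^esub> component (\<not> i) v = \<bottom>\<^bsub>M\<^esub>")
    case True
    then have "h y \<sqinter>\<^bsub>L\<^esub> h (component (\<not> i) v) = \<bottom>\<^bsub>L\<^esub>" using yc vp by (simp flip: h_meet)
    then have "h (?z \<sqinter>\<^bsub>M\<^esub> component (\<not> i) v) = \<bottom>\<^bsub>L\<^esub>" using y yc vp by simp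
    then have b: "?z \<sqinter>\<^bsub>M\<^esub> component (\<not> i) v = \<bottom>\<^bsub>M\<^esub>" using yc vp by (simp only: h_eq_bottom_iff M.meet_closed adj_carrier h_closed M.pairs_carrier)
    have "?z \<sqinter>\<^bsub>M\<^esub> wedge M v \<sqsubseteq>\<^bsub>M\<^esub> ?z \<sqinter>\<^bsub>M\<^esub> component (\<not> i) v"
      using yc vp by (intro M.meet_mono M.wedge_le) simp_all
    then have "?z \<sqinter>\<^bsub>M\<^esub> wedge M v = \<bottom>\<^bsub>M\<^esub>" using b yc vp by (simp add: M.le_bottom_iff)
    then show ?thesis using V by (simp add: M.quni_subset)
  next
    case False
    then have "component i v \<sqsubseteq>\<^bsub>M\<^esub> star i M y V" using V v by (intro M.star_upper M.quni_subset)
    moreover have "?z \<sqinter>\<^bsub>M\<^esub> wedge M v \<sqsubseteq>\<^bsub>M\<^esub> component i v"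
      using vp yc M.wedge_le[OF vp, of i] M.meet_right[of ?z "wedge M v"]
      by (meson M.le_trans M.meet_closed M.pairs_carrier M.wedge_closed adj_carrier h_closed)
    ultimately show ?thesis
      using vp V yc by (meson M.le_trans M.meet_closed M.pairs_carrier M.quni_subset M.star_carrier
          M.wedge_closed adj_carrier h_closed)
  qed
qed (use assms in \<open>simp_all add: M.quni_subset\<close>)

lemma adj_h_le: "below i M y x \<Longrightarrow> x \<in> carrier M \<Longrightarrow> adj i (h y) \<sqsubseteq>\<^bsub>M\<^esub> x"
  unfolding below_def using adj_h_le_star
  by (meson M.le_trans M.part_carrier M.star_quni_part adj_carrier h_closed)

text \<open>The lifted wedges are join-dense in M. A pair \<open>q\<close> uniformly below
  \<open>p\<close> satisfies q \<le> adj (h q) \<le> p in each component by \<open>adj_h_le\<close>,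
  so a lifted wedge fits between the wedges of \<open>q\<close> and \<open>p\<close>, and the wedges
  of such \<open>q\<close> join to that of \<open>p\<close>.\<close>

lemma le_iff_adj:
  assumes "x \<in> carrier M" "z \<in> carrier M"
  shows "x \<sqsubseteq>\<^bsub>M\<^esub> z \<longleftrightarrow>
    (\<forall>p\<in>pairs L. wedge M (adj_pair p) \<sqsubseteq>\<^bsub>M\<^esub> x \<longrightarrow> wedge M (adj_pair p) \<sqsubseteq>\<^bsub>M\<^esub> z)"
proof
  assume "x \<sqsubseteq>\<^bsub>M\<^esub> z"
  then show "\<forall>p\<in>pairs L. wedge M (adj_pair p) \<sqsubseteq>\<^bsub>M\<^esub> x \<longrightarrow> wedge M (adj_pair p) \<sqsubseteq>\<^bsub>M\<^esub> z"
    using assms by (meson M.le_trans M.wedge_closed adj_pair_pairs)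
next
  assume *: "\<forall>p\<in>pairs L. wedge M (adj_pair p) \<sqsubseteq>\<^bsub>M\<^esub> x \<longrightarrow> wedge M (adj_pair p) \<sqsubseteq>\<^bsub>M\<^esub> z"
  have "wedge M p \<sqsubseteq>\<^bsub>M\<^esub> z" if p: "p \<in> pairs M" and le: "wedge M p \<sqsubseteq>\<^bsub>M\<^esub> x" for p
  proof -
    have "wedge M q \<sqsubseteq>\<^bsub>M\<^esub> z"
      if q: "q \<in> pairs M" and b: "\<And>i. below i M (component i q) (component i p)" for q
    proof -
      let ?r = "adj_pair (map_prod h h q)"
      have r: "?r \<in> pairs M" using q by simp
      have "wedge M ?r \<sqsubseteq>\<^bsub>M\<^esub> wedge M p"
        using p r b adj_h_le by (intro M.wedge_mono) simp_all
      then have "wedge M ?r \<sqsubseteq>\<^bsub>M\<^esub> x" using le assms p r by (meson M.le_trans M.wedge_closed)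
      then have "wedge M ?r \<sqsubseteq>\<^bsub>M\<^esub> z" using * q by simp
      moreover have "wedge M q \<sqsubseteq>\<^bsub>M\<^esub> wedge M ?r"
        using q r by (intro M.wedge_mono) (simp_all add: le_adj_pair)
      ultimately show ?thesis using assms q r by (meson M.le_trans M.wedge_closed)
    qed
    then show ?thesis using M.wedge_le_iff_below[OF p assms(2)] by blast
  qed
  then show "x \<sqsubseteq>\<^bsub>M\<^esub> z" using M.le_iff_wedges[OF assms] by blast
qed

end

lemma strong_iff:
  "strong L U \<longleftrightarrow> (\<exists>S\<subseteq>pairs L. (\<forall>p\<in>S. wedge L p \<noteq> \<bottom>\<^bsub>L\<^esub>) \<and> U = down L S)"
  by (simp add: strong_def pairs_def wedge_def case_prod_unfold)

section \<open>Images of subframes, covers and stars under a dense surjection\<close>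

lemma subframe_preimage:
  assumes "frame M" "frame L" "frame_hom M L h" "subframe S L"
  shows "subframe {x \<in> carrier M. h x \<in> S} M"
proof -
  interpret M: frame M by fact
  interpret L: frame L by fact
  have "h ` A \<subseteq> S \<Longrightarrow> A \<subseteq> carrier M \<Longrightarrow> h (\<Squnion>\<^bsub>M\<^esub>A) \<in> S" for A
    using assms(3,4) unfolding frame_hom_def subframe_def by simp
  then have "\<Squnion>\<^bsub>M\<^esub>A \<in> {x \<in> carrier M. h x \<in> S}" if "A \<subseteq> {x \<in> carrier M. h x \<in> S}" for A
    using that M.sup_closed[of A] by blast
  then show ?thesis
    using assms(3) L.subframeD[OF assms(4)] unfolding subframe_def frame_hom_def by simp
qed

lemma subframe_image:
  assumes "frame M" "frame L" "frame_hom M L h" "subframe S M"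
  shows "subframe (h ` S) L"
proof -
  interpret M: frame M by fact
  interpret L: frame L by fact
  note S = M.subframeD[OF assms(4)]
  have h: "h x \<in> carrier L" if "x \<in> carrier M" for x
    using assms(3) that unfolding frame_hom_def by blast
  show ?thesis
    unfolding subframe_def
  proof (intro conjI ballI allI impI)
    show "h ` S \<subseteq> carrier L" using S(1) h by blast
    show "\<top>\<^bsub>L\<^esub> \<in> h ` S" using assms(3) S(2) unfolding frame_hom_def by (metis imageI)
    show "x \<sqinter>\<^bsub>L\<^esub> y \<in> h ` S" if xy: "x \<in> h ` S" "y \<in> h ` S" for x y
    proof -
      obtain a b where ab: "a \<in> S" "b \<in> S" "x = h a" "y = h b" using xy by blast
      then have "x \<sqinter>\<^bsub>L\<^esub> y = h (a \<sqinter>\<^bsub>M\<^esub> b)"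
        using subsetD[OF S(1)] assms(3) unfolding frame_hom_def by simp
      then show ?thesis using S(3) ab by simp
    qed
    show "\<Squnion>\<^bsub>L\<^esub>A \<in> h ` S" if A: "A \<subseteq> h ` S" for A
    proof -
      obtain B where B: "B \<subseteq> S" "A = h ` B" using A by (rule subset_imageE)
      then have "\<Squnion>\<^bsub>L\<^esub>A = h (\<Squnion>\<^bsub>M\<^esub>B)"
        using S(1) assms(3) unfolding frame_hom_def by (metis order_trans)
      then show ?thesis using S(4) B by simp
    qed
  qed
qed

context dense_surjection
begin

text \<open>Surjectivity is assumed on the two parts only; it passes to the total part because the
  image is a subframe containing both generating parts.\<close>

lemma h_carrier: "h ` carrier M = carrier L"
proof (rule L.generated)
  show "subframe (h ` carrier M) L"
    by (rule subframe_image[OF M.frame_axioms L.frame_axioms frame_hom M.subframe_carrier])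
  have "part i L \<subseteq> h ` carrier M" for i
    using h_part[of i] M.part_subset[of i] by blast
  from this[of True] this[of False] show "part1 L \<union> part2 L \<subseteq> h ` carrier M"
    by (simp add: part_def)
qed

lemma paircover_image:
  assumes "paircover M V"
  shows "paircover L (image_cover L h V)"
proof -
  have V: "V \<subseteq> pairs M" "pairs_join M V = \<top>\<^bsub>M\<^esub>" using assms by (auto simp: M.paircover_iff)
  have hV: "map_prod h h ` V \<subseteq> pairs L" by (intro image_subsetI map_prod_pairs subsetD[OF V(1)])
  have sub: "image_cover L h V \<subseteq> pairs L" unfolding image_cover_def by (rule L.down_subset)
  have "pairs_join L (map_prod h h ` V) \<sqsubseteq>\<^bsub>L\<^esub> pairs_join L (image_cover L h V)"
    unfolding pairs_join_wedge using hV sub L.subset_down[OF hV]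
    by (intro L.sup_least L.sup_upper L.sup_closed) (auto simp: image_cover_def)
  then have "pairs_join L (image_cover L h V) = \<top>\<^bsub>L\<^esub>"
    using V sub by (simp add: L.top_le_iff flip: h_pairs_join)
  moreover have "down L (image_cover L h V) \<subseteq> image_cover L h V"
    unfolding image_cover_def by (rule L.down_down[OF hV])
  ultimately show ?thesis using sub by (simp add: L.paircover_iff)
qed

lemma star_image_le:
  assumes "V \<subseteq> pairs M" "y \<in> carrier M"
  shows "star i L (h y) (image_cover L h V) \<sqsubseteq>\<^bsub>L\<^esub> h (star i M y V)"
proof -
  have "component i q \<sqsubseteq>\<^bsub>L\<^esub> h (star i M y V)"
    if q: "q \<in> image_cover L h V" "h y \<sqinter>\<^bsub>L\<^esub> component (\<not> i) q \<noteq> \<bottom>\<^bsub>L\<^esub>" for q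
  proof -
    obtain v where v: "v \<in> V" "\<And>i. component i q \<sqsubseteq>\<^bsub>L\<^esub> h (component i v)" and qp: "q \<in> pairs L"
      using q(1) unfolding mem_image_cover_iff by blast
    have vp: "v \<in> pairs M" using v(1) assms(1) by blast
    have "h y \<sqinter>\<^bsub>L\<^esub> component (\<not> i) q \<sqsubseteq>\<^bsub>L\<^esub> h y \<sqinter>\<^bsub>L\<^esub> h (component (\<not> i) v)"
      using qp vp assms v(2) by (intro L.meet_mono) simp_all
    then have "h (y \<sqinter>\<^bsub>M\<^esub> component (\<not> i) v) \<noteq> \<bottom>\<^bsub>L\<^esub>"
      using q(2) qp vp assms by (auto simp: L.le_bottom_iff)
    then have "y \<sqinter>\<^bsub>M\<^esub> component (\<not> i) v \<noteq> \<bottom>\<^bsub>M\<^esub>" by auto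
    then have "component i v \<sqsubseteq>\<^bsub>M\<^esub> star i M y V" using assms v by (intro M.star_upper)
    then have "h (component i v) \<sqsubseteq>\<^bsub>L\<^esub> h (star i M y V)" using vp assms by (intro h_mono) simp_all
    then show ?thesis
      using v(2)[of i] qp vp assms by (meson L.le_trans L.pairs_carrier M.pairs_carrier M.star_carrier h_closed)
  qed
  then show ?thesis
    using assms by (subst L.star_le_iff) (simp_all add: image_cover_def L.down_subset)
qed

text \<open>Density is used here: a pair of the lifted cover that meets \<open>y\<close> in M has an
  image that meets \<open>h y\<close>, so the pair of V above this image contributes to the star of
  \<open>h y\<close>.\<close>

lemma star_lift_le:
  assumes "V \<subseteq> pairs L" "y \<in> carrier M"
  shows "star i M y (lift_cover V) \<sqsubseteq>\<^bsub>M\<^esub> adj i (star i L (h y) V)"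
proof -
  have "component i q \<sqsubseteq>\<^bsub>M\<^esub> adj i (star i L (h y) V)"
    if q: "q \<in> lift_cover V" "y \<sqinter>\<^bsub>M\<^esub> component (\<not> i) q \<noteq> \<bottom>\<^bsub>M\<^esub>" for q
  proof -
    obtain v where v: "v \<in> V" "\<And>i. component i q \<sqsubseteq>\<^bsub>M\<^esub> adj i (component i v)" and qp: "q \<in> pairs M"
      using q(1) unfolding mem_lift_cover_iff by blast
    have vp: "v \<in> pairs L" using v(1) assms(1) by blast
    have le: "h (component j q) \<sqsubseteq>\<^bsub>L\<^esub> component j v" for j
      using v(2)[of j] qp vp by (simp add: le_adj_iff pairsD)
    have "h y \<sqinter>\<^bsub>L\<^esub> h (component (\<not> i) q) \<sqsubseteq>\<^bsub>L\<^esub> h y \<sqinter>\<^bsub>L\<^esub> component (\<not> i) v"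
      using qp vp assms le by (intro L.meet_mono) simp_all
    moreover have "h (y \<sqinter>\<^bsub>M\<^esub> component (\<not> i) q) \<noteq> \<bottom>\<^bsub>L\<^esub>"
      using q(2) qp assms h_eq_bottom_iff[of "y \<sqinter>\<^bsub>M\<^esub> component (\<not> i) q"] by simp
    ultimately have "h y \<sqinter>\<^bsub>L\<^esub> component (\<not> i) v \<noteq> \<bottom>\<^bsub>L\<^esub>"
      using qp vp assms by (auto simp: L.le_bottom_iff)
    then have "component i v \<sqsubseteq>\<^bsub>L\<^esub> star i L (h y) V" using assms v by (intro L.star_upper)
    then have "h (component i q) \<sqsubseteq>\<^bsub>L\<^esub> star i L (h y) V"
      using le[of i] qp vp assms by (meson L.le_trans L.pairs_carrier M.pairs_carrier L.star_carrier h_closed)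
    then show ?thesis using qp assms by (simp add: le_adj_iff pairsD)
  qed
  then show ?thesis
    using assms by (subst M.star_le_iff) (simp_all add: lift_cover_def M.down_subset)
qed

end

section \<open>Lifting a quasi-uniformity along a dense surjection\<close>

text \<open>Lifted covers inherit strongness and star refinements along any dense surjection. The
  assumptions \<open>lift_join\<close> and \<open>lift_admissible\<close> are the two properties
  that have to be checked in each case: lifted covers need not cover, since right adjoints need not
  preserve joins, and the lifted stars have to be small enough to approximate elements of M.\<close>

locale lifted_quniformity = dense_surjection M L h + L: qu_biframe L
  for M :: "('m, 'r) qubiframe_scheme" and L :: "('a, 's) qubiframe_scheme" and h +
  assumes quni_M: "quni M = {V. paircover M V \<and> (\<exists>U\<in>quni L. lift_cover U \<subseteq> V)}"
    and lift_join: "\<And>U. U \<in> quni L \<Longrightarrow> pairs_join M (lift_cover U) = \<top>\<^bsub>M\<^esub>"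
    and lift_admissible: "\<And>i x. x \<in> part i M \<Longrightarrow>
      x \<sqsubseteq>\<^bsub>M\<^esub> \<Squnion>\<^bsub>M\<^esub>{y \<in> part i M. \<exists>U\<in>quni L. star i M y (lift_cover U) \<sqsubseteq>\<^bsub>M\<^esub> x}"
begin

lemma lift_cover_subset: "lift_cover U \<subseteq> pairs M"
  unfolding lift_cover_def by (rule M.down_subset)

lemma lift_cover_mono: "U \<subseteq> V \<Longrightarrow> lift_cover U \<subseteq> lift_cover V"
  unfolding subset_iff mem_lift_cover_iff by blast

lemma paircover_lift:
  assumes "U \<in> quni L"
  shows "paircover M (lift_cover U)"
proof -
  have "adj_pair ` U \<subseteq> pairs M" using assms adj_pair_pairs L.quni_pairs by blast
  then have "down M (lift_cover U) \<subseteq> lift_cover U" unfolding lift_cover_def by (rule M.down_down)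
  then show ?thesis using assms lift_cover_subset lift_join by (simp add: M.paircover_iff)
qed

lemma lift_cover_quni: "U \<in> quni L \<Longrightarrow> lift_cover U \<in> quni M"
  using paircover_lift by (auto simp: quni_M)

lemma paircover_filter_M: "paircover_filter M (quni M)"
  unfolding paircover_filter_def
proof (intro conjI ballI allI impI)
  show "quni M \<noteq> {}" using L.quni_nonempty lift_cover_quni by blast
  fix U assume U: "U \<in> quni M"
  show "paircover M U" using U quni_M by blast
  show "V \<in> quni M" if "paircover M V \<and> U \<subseteq> V" for V
    using U that unfolding quni_M by blast
  fix V assume V: "V \<in> quni M"
  obtain U' V' where UV: "U' \<in> quni L" "lift_cover U' \<subseteq> U" "V' \<in> quni L" "lift_cover V' \<subseteq> V"
    using U V unfolding quni_M by blast
  have I: "U' \<inter> V' \<in> quni L" using UV L.quni_Int by blast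
  have sub: "lift_cover (U' \<inter> V') \<subseteq> U \<inter> V"
    using UV lift_cover_mono[of "U' \<inter> V'"] by blast
  have p: "U \<subseteq> pairs M" "down M U \<subseteq> U" "V \<subseteq> pairs M" "down M V \<subseteq> V"
    using U V by (simp_all add: quni_M M.paircover_iff)
  have "\<top>\<^bsub>M\<^esub> \<sqsubseteq>\<^bsub>M\<^esub> pairs_join M (U \<inter> V)"
    unfolding lift_join[OF I, symmetric] pairs_join_wedge
    using sub p by (intro M.sup_least M.sup_upper M.sup_closed) auto
  then have "pairs_join M (U \<inter> V) = \<top>\<^bsub>M\<^esub>" using p by (simp add: M.top_le_iff le_infI1)
  moreover have "down M (U \<inter> V) \<subseteq> U \<inter> V"
    using p unfolding subset_iff mem_down_iff by blast
  ultimately have "paircover M (U \<inter> V)" using p by (simp add: M.paircover_iff le_infI1)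
  then show "U \<inter> V \<in> quni M" using I sub unfolding quni_M by blast
qed

text \<open>\<open>h\<close> maps the wedge of a lifted generator back to the wedge of that
  generator, which is nonzero; so the lifts of a strong generating set are a strong generating set
  of the lifted cover.\<close>

lemma strong_lift:
  assumes "U \<in> quni L" "strong L U"
  shows "strong M (lift_cover U)"
proof -
  obtain S where S: "S \<subseteq> pairs L" "\<And>p. p \<in> S \<Longrightarrow> wedge L p \<noteq> \<bottom>\<^bsub>L\<^esub>" "U = down L S"
    using assms(2) unfolding strong_iff by blast
  have "wedge M (adj_pair p) \<noteq> \<bottom>\<^bsub>M\<^esub>" if "p \<in> S" for p
  proof
    assume "wedge M (adj_pair p) = \<bottom>\<^bsub>M\<^esub>"
    moreover have "h (wedge M (adj_pair p)) = wedge L p" using S(1) that by (intro h_wedge_adj) blast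
    ultimately show False using S(2)[OF that] by simp
  qed
  moreover have "lift_cover U = down M (adj_pair ` S)"
  proof (rule Set.set_eqI)
    fix p
    have "p \<in> lift_cover U \<longleftrightarrow> p \<in> down M (adj_pair ` S)" if p: "p \<in> pairs M"
    proof
      assume "p \<in> lift_cover U"
      then obtain u where u: "u \<in> down L S" "\<And>i. component i p \<sqsubseteq>\<^bsub>M\<^esub> adj i (component i u)"
        unfolding mem_lift_cover_iff S(3) by blast
      obtain s where s: "s \<in> S" "\<And>i. component i u \<sqsubseteq>\<^bsub>L\<^esub> component i s" and up: "u \<in> pairs L"
        using u(1) unfolding mem_down_iff by blast
      have sp: "s \<in> pairs L" using s(1) S(1) by blast
      have "component i p \<sqsubseteq>\<^bsub>M\<^esub> component i (adj_pair s)" for i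
        using u(2)[of i] adj_mono[OF s(2)[of i] pairsD[OF up] pairsD[OF sp]] p up sp
        by (simp, meson L.pairs_carrier M.le_trans M.pairs_carrier adj_carrier)
      then show "p \<in> down M (adj_pair ` S)" unfolding mem_down_iff using p s(1) by blast
    next
      assume "p \<in> down M (adj_pair ` S)"
      then obtain s where "s \<in> S" "\<And>i. component i p \<sqsubseteq>\<^bsub>M\<^esub> component i (adj_pair s)"
        unfolding mem_down_iff by blast
      moreover have "S \<subseteq> U" unfolding S(3) by (rule L.subset_down[OF S(1)])
      ultimately show "p \<in> lift_cover U" unfolding mem_lift_cover_iff using p by auto
    qed
    then show "p \<in> lift_cover U \<longleftrightarrow> p \<in> down M (adj_pair ` S)"
      using lift_cover_subset M.down_subset by blast
  qed
  moreover have "adj_pair ` S \<subseteq> pairs M" using S(1) adj_pair_pairs by blast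
  ultimately show ?thesis unfolding strong_iff by blast
qed

text \<open>A pair of the lifted cover lies under the lift of some \<open>v\<close> in V. By
  \<open>star_lift_le\<close> its stars lie under the lifts of the stars of \<open>v\<close>, and
  the pair of those stars belongs to \<open>star_cover L V\<close>, hence to U.\<close>

lemma star_cover_lift:
  assumes "V \<in> quni L" "star_cover L V \<subseteq> U"
  shows "star_cover M (lift_cover V) \<subseteq> lift_cover U"
proof
  have V: "V \<subseteq> pairs L" using assms L.quni_subset by blast
  fix p assume "p \<in> star_cover M (lift_cover V)"
  then obtain w where w: "w \<in> lift_cover V"
    "\<And>i. component i p \<sqsubseteq>\<^bsub>M\<^esub> star i M (component i w) (lift_cover V)" and p: "p \<in> pairs M"
    unfolding mem_star_cover_iff by blast
  obtain v where v: "v \<in> V" "\<And>i. component i w \<sqsubseteq>\<^bsub>M\<^esub> adj i (component i v)" and wp: "w \<in> pairs M"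
    using w(1) unfolding mem_lift_cover_iff by blast
  have vp: "v \<in> pairs L" using v(1) V by blast
  define q where "q = (star True L (fst v) V, star False L (snd v) V)"
  have q: "component j q = star j L (component j v) V" for j
    by (cases j) (simp_all add: q_def component_def)
  have qp: "q \<in> pairs L" using V by (simp add: mem_pairs_iff q L.star_closed)
  then have "q \<in> star_cover L V"
    unfolding mem_star_cover_iff using v(1) q by (metis L.le_refl L.pairs_carrier)
  then have "q \<in> U" using assms by blast
  moreover have "component i p \<sqsubseteq>\<^bsub>M\<^esub> adj i (component i q)" for i
  proof -
    have c: "star i M (component i w) (lift_cover V) \<in> carrier M"
      "star i L (h (component i w)) V \<in> part i L" "star i L (component i v) V \<in> part i L"
      using V lift_cover_subset by (simp_all add: L.star_closed)
    have "h (component i w) \<sqsubseteq>\<^bsub>L\<^esub> component i v"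
      using v(2)[of i] wp vp by (simp add: le_adj_iff pairsD)
    then have "star i L (h (component i w)) V \<sqsubseteq>\<^bsub>L\<^esub> star i L (component i v) V"
      using V wp vp by (intro L.star_mono) simp_all
    then have "adj i (star i L (h (component i w)) V) \<sqsubseteq>\<^bsub>M\<^esub> adj i (component i q)"
      unfolding q using c by (intro adj_mono)
    moreover have "star i M (component i w) (lift_cover V) \<sqsubseteq>\<^bsub>M\<^esub> adj i (star i L (h (component i w)) V)"
      using V wp by (intro star_lift_le) simp_all
    ultimately show ?thesis
      using w(2)[of i] c p qp by (meson L.pairs_carrier L.part_carrier M.le_trans M.pairs_carrier adj_carrier)
  qed
  ultimately show "p \<in> lift_cover U" unfolding mem_lift_cover_iff using p by blast
qed

lemma admissible_M:
  assumes "x \<in> part i M"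
  shows "x = \<Squnion>\<^bsub>M\<^esub>{y. below i M y x}"
proof (rule M.le_antisym)
  let ?A = "{y \<in> part i M. \<exists>U\<in>quni L. star i M y (lift_cover U) \<sqsubseteq>\<^bsub>M\<^esub> x}"
  have B: "{y. below i M y x} \<subseteq> carrier M" by (auto dest: below_part)
  have "?A \<subseteq> {y. below i M y x}" unfolding below_def using lift_cover_quni by blast
  then have "\<Squnion>\<^bsub>M\<^esub>?A \<sqsubseteq>\<^bsub>M\<^esub> \<Squnion>\<^bsub>M\<^esub>{y. below i M y x}"
    using B by (intro M.sup_least M.sup_upper M.sup_closed) auto
  moreover have "\<Squnion>\<^bsub>M\<^esub>?A \<in> carrier M" by (intro M.sup_closed) auto
  ultimately show "x \<sqsubseteq>\<^bsub>M\<^esub> \<Squnion>\<^bsub>M\<^esub>{y. below i M y x}"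
    using lift_admissible[OF assms] assms B by (meson M.le_trans M.part_carrier M.sup_closed)
  have "y \<sqsubseteq>\<^bsub>M\<^esub> x" if y: "below i M y x" for y
  proof -
    obtain U where U: "U \<in> quni M" "star i M y U \<sqsubseteq>\<^bsub>M\<^esub> x" and "y \<in> part i M"
      using y unfolding below_def by blast
    moreover have "U \<subseteq> pairs M" "pairs_join M U = \<top>\<^bsub>M\<^esub>"
      using U by (simp_all add: quni_M M.paircover_iff)
    ultimately show ?thesis
      using M.le_starI[of U y i] assms by (meson M.le_trans M.part_carrier M.star_carrier)
  qed
  then show "\<Squnion>\<^bsub>M\<^esub>{y. below i M y x} \<sqsubseteq>\<^bsub>M\<^esub> x" using B assms by (intro M.sup_least) auto
  show "\<Squnion>\<^bsub>M\<^esub>{y. below i M y x} \<in> carrier M"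
    by (intro M.sup_closed) (auto dest: below_part)
qed (use assms in simp)

lemma qu_biframe_M: "qu_biframe M"
proof unfold_locales
  show "paircover_filter M (quni M)" by (rule paircover_filter_M)
  fix U assume "U \<in> quni M"
  then obtain V where V: "V \<in> quni L" "lift_cover V \<subseteq> U" unfolding quni_M by blast
  obtain W where "W \<in> quni L" "strong L W" "W \<subseteq> V" using L.strong_refinement V by blast
  then show "\<exists>V\<in>quni M. strong M V \<and> V \<subseteq> U"
    using V strong_lift lift_cover_quni lift_cover_mono by (meson order_trans)
  obtain W where "W \<in> quni L" "star_cover L W \<subseteq> V" using L.star_refinement V by blast
  then show "\<exists>V\<in>quni M. star_cover M V \<subseteq> U"
    using V star_cover_lift lift_cover_quni by (meson order_trans)
next
  fix x
  show "x = \<Squnion>\<^bsub>M\<^esub>{y \<in> part1 M. \<exists>U\<in>quni M. st1 M y U \<sqsubseteq>\<^bsub>M\<^esub> x}" if "x \<in> part1 M"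
    using admissible_M[of x True] that by (simp add: part_def below_def st1_eq_star)
  show "x = \<Squnion>\<^bsub>M\<^esub>{y \<in> part2 M. \<exists>U\<in>quni M. st2 M y U \<sqsubseteq>\<^bsub>M\<^esub> x}" if "x \<in> part2 M"
    using admissible_M[of x False] that by (simp add: part_def below_def st2_eq_star)
qed

lemma image_lift_cover:
  assumes "U \<in> quni L"
  shows "image_cover L h (lift_cover U) = U"
proof (intro equalityI subsetI)
  fix p assume "p \<in> image_cover L h (lift_cover U)"
  then obtain w where w: "w \<in> lift_cover U" "\<And>i. component i p \<sqsubseteq>\<^bsub>L\<^esub> h (component i w)" and p: "p \<in> pairs L"
    unfolding mem_image_cover_iff by blast
  obtain u where u: "u \<in> U" "\<And>i. component i w \<sqsubseteq>\<^bsub>M\<^esub> adj i (component i u)" and wp: "w \<in> pairs M"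
    using w(1) unfolding mem_lift_cover_iff by blast
  have up: "u \<in> pairs L" using u assms L.quni_pairs by blast
  have "component i p \<sqsubseteq>\<^bsub>L\<^esub> component i u" for i
  proof -
    have "h (component i w) \<sqsubseteq>\<^bsub>L\<^esub> component i u"
      using u(2)[of i] wp up by (simp add: le_adj_iff pairsD)
    then show ?thesis
      using w(2)[of i] p up wp by (meson L.le_trans L.pairs_carrier M.pairs_carrier h_closed)
  qed
  then show "p \<in> U" using L.quni_down assms u(1) p by blast
next
  fix p assume p: "p \<in> U"
  then have pp: "p \<in> pairs L" using assms L.quni_pairs by blast
  have "adj_pair p \<in> lift_cover U"
    unfolding mem_lift_cover_iff using p pp by (auto intro!: bexI[of _ p])
  moreover have "component i p \<sqsubseteq>\<^bsub>L\<^esub> h (component i (adj_pair p))" for i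
    using pp by (simp add: pairsD)
  ultimately show "p \<in> image_cover L h (lift_cover U)" unfolding mem_image_cover_iff using pp by blast
qed

lemma image_cover_mono: "U \<subseteq> V \<Longrightarrow> image_cover L h U \<subseteq> image_cover L h V"
  unfolding subset_iff mem_image_cover_iff by blast

lemma qu_surjection_h: "qu_surjection M L h"
  unfolding qu_surjection_def qu_hom_def base_of_def
proof (intro conjI ballI hom surj image_subsetI)
  show image: "image_cover L h V \<in> quni L" if V: "V \<in> quni M" for V
  proof -
    obtain U where U: "U \<in> quni L" "lift_cover U \<subseteq> V" and "paircover M V"
      using V unfolding quni_M by blast
    then show ?thesis
      using L.quni_upward[OF U(1)] paircover_image image_lift_cover[OF U(1)] image_cover_mono[OF U(2)] by simp
  qed
  then show "image_cover L h V \<in> quni L" if "V \<in> quni M" for V using that .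
  show "\<exists>B\<in>image_cover L h ` quni M. B \<subseteq> V" if "V \<in> quni L" for V
    using that image_lift_cover lift_cover_quni by blast
qed

lemma base_of_lift: "base_of (lift_cover ` quni L) (quni M)"
  unfolding base_of_def quni_M using paircover_lift by blast

end

section \<open>Dense quasi-uniform surjections\<close>

locale qu_completion = qu_dense_surjection M L h
  for M :: "('m, 'r) qubiframe_scheme" and L :: "('a, 's) qubiframe_scheme" and h +
  assumes image_quni: "\<And>U. U \<in> quni M \<Longrightarrow> image_cover L h U \<in> quni L"
    and image_base: "\<And>V. V \<in> quni L \<Longrightarrow> \<exists>U\<in>quni M. image_cover L h U \<subseteq> V"
begin

definition below_pairs :: "'m \<Rightarrow> ('a \<times> 'a) set" where
  "below_pairs m = {p \<in> pairs L. wedge M (adj_pair p) \<sqsubseteq>\<^bsub>M\<^esub> m}"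

text \<open>The image of a cover witnessing the relation in M witnesses it in L:
  \<open>star_image_le\<close> compares the stars, and the adjunction turns the bound
  \<open>adj i a\<close> into \<open>a\<close>.\<close>

lemma below_h:
  assumes "below i M y (adj i a)" "a \<in> part i L"
  shows "below i L (h y) a"
proof -
  obtain V where V: "V \<in> quni M" "star i M y V \<sqsubseteq>\<^bsub>M\<^esub> adj i a" and y: "y \<in> part i M"
    using assms unfolding below_def by blast
  have Vp: "V \<subseteq> pairs M" using V M.quni_subset by blast
  have "h (star i M y V) \<sqsubseteq>\<^bsub>L\<^esub> a" using V(2) assms(2) Vp by (simp add: le_adj_iff M.star_closed)
  moreover have "star i L (h y) (image_cover L h V) \<sqsubseteq>\<^bsub>L\<^esub> h (star i M y V)"
    using Vp y by (intro star_image_le) simp_all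
  ultimately have "star i L (h y) (image_cover L h V) \<sqsubseteq>\<^bsub>L\<^esub> a"
    using Vp assms(2)
    by (meson L.down_subset L.le_trans L.part_carrier L.star_carrier M.star_carrier h_closed image_cover_def[THEN eq_refl, THEN order_trans])
  then show ?thesis using y V(1) image_quni unfolding below_def by auto
qed

text \<open>Each clause reflects one property of the surjection: monotonicity of the right adjoints,
  density, admissibility of M carried to L by \<open>below_h\<close>, and the existence of a cover
  of M whose image refines the given cover of L.\<close>

lemma uclosed_below_pairs:
  assumes m: "m \<in> carrier M"
  shows "uclosed L (below_pairs m)"
proof (rule uclosedI)
  show "below_pairs m \<subseteq> pairs L" by (auto simp only: below_pairs_def)
next
  fix p q assume p: "p \<in> pairs L" and q: "q \<in> below_pairs m" and le: "\<And>i. component i p \<sqsubseteq>\<^bsub>L\<^esub> component i q"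
  have qp: "q \<in> pairs L" "wedge M (adj_pair q) \<sqsubseteq>\<^bsub>M\<^esub> m" using q by (simp_all add: below_pairs_def)
  have "wedge M (adj_pair p) \<sqsubseteq>\<^bsub>M\<^esub> wedge M (adj_pair q)"
    using p qp le by (intro M.wedge_mono) (simp_all add: adj_mono pairsD)
  then show "p \<in> below_pairs m"
    unfolding below_pairs_def using p qp m by (simp, meson M.le_trans M.wedge_closed adj_pair_pairs)
next
  fix p assume p: "p \<in> pairs L" "wedge L p = \<bottom>\<^bsub>L\<^esub>"
  then have "h (wedge M (adj_pair p)) = \<bottom>\<^bsub>L\<^esub>" by (simp add: h_wedge_adj)
  then have "wedge M (adj_pair p) = \<bottom>\<^bsub>M\<^esub>" using p by (simp only: h_eq_bottom_iff M.wedge_closed adj_pair_pairs)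
  then show "p \<in> below_pairs m" unfolding below_pairs_def using p m by simp
next
  fix p assume p: "p \<in> pairs L"
    and *: "\<And>q. \<lbrakk>q \<in> pairs L; \<And>i. below i L (component i q) (component i p)\<rbrakk> \<Longrightarrow> q \<in> below_pairs m"
  \<comment> \<open>Such an \<open>r\<close> lies under the lift of its own image, and that image is
    uniformly below \<open>p\<close>, so the hypothesis on \<open>p\<close> applies to it.\<close>
  have "wedge M r \<sqsubseteq>\<^bsub>M\<^esub> m"
    if r: "r \<in> pairs M" and b: "\<And>i. below i M (component i r) (component i (adj_pair p))" for r
  proof -
    have "map_prod h h r \<in> below_pairs m"
      using r p b by (intro *) (simp_all add: below_h pairsD)
    then have "wedge M (adj_pair (map_prod h h r)) \<sqsubseteq>\<^bsub>M\<^esub> m" by (simp add: below_pairs_def)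
    moreover have "wedge M r \<sqsubseteq>\<^bsub>M\<^esub> wedge M (adj_pair (map_prod h h r))"
      using r by (intro M.wedge_mono) (simp_all add: le_adj_pair)
    ultimately show ?thesis
      using r m by (meson M.le_trans M.wedge_closed adj_pair_pairs map_prod_pairs)
  qed
  then have "wedge M (adj_pair p) \<sqsubseteq>\<^bsub>M\<^esub> m"
    using M.wedge_le_iff_below[OF adj_pair_pairs[OF p] m] by blast
  then show "p \<in> below_pairs m" using p by (simp add: below_pairs_def)
next
  fix p U assume p: "p \<in> pairs L" and U: "U \<in> quni L" and *: "\<And>u. u \<in> U \<Longrightarrow> pair_meet L p u \<in> below_pairs m"
  obtain V where V: "V \<in> quni M" "image_cover L h V \<subseteq> U" using image_base U by blast
  have "wedge M (adj_pair p) \<sqsubseteq>\<^bsub>M\<^esub> m"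
  proof (rule M.le_by_cover[OF V(1)])
    fix v assume v: "v \<in> V"
    have vp: "v \<in> pairs M" using v V M.quni_pairs by blast
    \<comment> \<open>The image of \<open>v\<close> belongs to U and its lift lies above
      \<open>v\<close>, so the hypothesis for the pairs of U bounds the piece of the lifted wedge
      cut out by \<open>v\<close>.\<close>
    have "map_prod h h v \<in> image_cover L h V"
      unfolding mem_image_cover_iff using v vp by (auto intro!: bexI[of _ v])
    then have "pair_meet L p (map_prod h h v) \<in> below_pairs m" using V(2) * by blast
    then have "wedge M (adj_pair p) \<sqinter>\<^bsub>M\<^esub> wedge M (adj_pair (map_prod h h v)) \<sqsubseteq>\<^bsub>M\<^esub> m"
      using p vp by (simp add: below_pairs_def wedge_adj_pair_meet)
    moreover have "wedge M v \<sqsubseteq>\<^bsub>M\<^esub> wedge M (adj_pair (map_prod h h v))"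
      using vp by (intro M.wedge_mono) (simp_all add: le_adj_pair)
    then have "wedge M (adj_pair p) \<sqinter>\<^bsub>M\<^esub> wedge M v
        \<sqsubseteq>\<^bsub>M\<^esub> wedge M (adj_pair p) \<sqinter>\<^bsub>M\<^esub> wedge M (adj_pair (map_prod h h v))"
      using p vp by (intro M.meet_mono) simp_all
    ultimately show "wedge M (adj_pair p) \<sqinter>\<^bsub>M\<^esub> wedge M v \<sqsubseteq>\<^bsub>M\<^esub> m"
      using p vp m by (meson M.le_trans M.meet_closed M.wedge_closed adj_pair_pairs map_prod_pairs)
  qed (use p m in simp_all)
  then show "p \<in> below_pairs m" using p by (simp add: below_pairs_def)
qed

lemma below_pairs_inject:
  assumes "m \<in> carrier M" "m' \<in> carrier M" "below_pairs m = below_pairs m'"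
  shows "m = m'"
proof (rule M.le_antisym)
  have *: "wedge M (adj_pair p) \<sqsubseteq>\<^bsub>M\<^esub> m \<longleftrightarrow> wedge M (adj_pair p) \<sqsubseteq>\<^bsub>M\<^esub> m'" if "p \<in> pairs L" for p
    using assms(3) that unfolding below_pairs_def by blast
  show "m \<sqsubseteq>\<^bsub>M\<^esub> m'" using le_iff_adj[OF assms(1,2)] * by blast
  show "m' \<sqsubseteq>\<^bsub>M\<^esub> m" using le_iff_adj[OF assms(2,1)] * by blast
qed (use assms in simp_all)

text \<open>An injective \<open>h\<close> is bijective by \<open>h_carrier\<close>, and its inverse
  respects the frame operations and the parts. The inverse is also uniform: if the image of a cover
  V of M refines U, then the image of U under the inverse contains V.\<close>

lemma qu_iso_if_inj:
  assumes "inj_on h (carrier M)" and quni_L: "\<And>U. U \<in> quni L \<Longrightarrow> paircover L U"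
  shows "qu_iso M L h"
proof -
  define g where "g = inv_into (carrier M) h"
  have gh [simp]: "g (h x) = x" if "x \<in> carrier M" for x
    unfolding g_def using assms(1) that by (rule inv_into_f_f)
  have g_closed [simp]: "g y \<in> carrier M" and hg [simp]: "h (g y) = y" if "y \<in> carrier L" for y
    using that h_carrier unfolding g_def by (auto simp: inv_into_into f_inv_into_f)
  have g_part: "g ` part i L = part i M" for i
    unfolding h_part[symmetric] image_image using M.part_subset[of i] by (force simp: image_def)
  have "frame_hom L M g"
    unfolding frame_hom_def
  proof (intro conjI ballI allI impI)
    show "g \<in> carrier L \<rightarrow> carrier M" by simp
    show "g \<top>\<^bsub>L\<^esub> = \<top>\<^bsub>M\<^esub>" using gh[of "\<top>\<^bsub>M\<^esub>"] by simp
    show "g (x \<sqinter>\<^bsub>L\<^esub> y) = g x \<sqinter>\<^bsub>M\<^esub> g y" if "x \<in> carrier L" "y \<in> carrier L" for x y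
      using gh[of "g x \<sqinter>\<^bsub>M\<^esub> g y"] that by simp
    show "g (\<Squnion>\<^bsub>L\<^esub>A) = \<Squnion>\<^bsub>M\<^esub>(g ` A)" if A: "A \<subseteq> carrier L" for A
    proof -
      have gA: "g ` A \<subseteq> carrier M" using A by auto
      have "h ` g ` A = A" by (simp add: image_image subsetD[OF A] cong: image_cong_simp)
      then show ?thesis using gh[OF M.sup_closed[OF gA]] gA by (simp add: h_sup)
    qed
  qed
  then have g_hom: "biframe_hom L M g" using g_part by (simp add: biframe_hom_def image_part_iff)
  moreover have "surjective_hom L M g"
    using g_part[of True] g_part[of False] by (simp add: surjective_hom_def part_def)
  moreover have "dense_hom L M g" unfolding dense_hom_def using hg h_bottom by metis
  \<comment> \<open>The inverse is itself a dense surjection, which makes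
    \<open>paircover_image\<close> available for images of covers of L in M.\<close>
  ultimately interpret g: dense_surjection L M g by unfold_locales
  have "image_cover M g U \<in> quni M" if U: "U \<in> quni L" for U
  proof -
    obtain V where V: "V \<in> quni M" "image_cover L h V \<subseteq> U" using image_base U by blast
    have "V \<subseteq> image_cover M g U"
    proof
      fix v assume v: "v \<in> V"
      have vp: "v \<in> pairs M" using v V M.quni_pairs by blast
      have "map_prod h h v \<in> image_cover L h V"
        unfolding mem_image_cover_iff using v vp by (auto intro!: bexI[of _ v])
      then have "map_prod h h v \<in> U" using V by blast
      then show "v \<in> image_cover M g U"
        unfolding mem_image_cover_iff using vp by (auto intro!: bexI[of _ "map_prod h h v"])
    qed
    then show ?thesis using M.quni_upward[OF V(1)] g.paircover_image quni_L[OF U] by blast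
  qed
  then show ?thesis
    unfolding qu_iso_def qu_hom_def using hom image_quni g_hom gh hg by metis
qed

end

lemma qu_completionI:
  assumes "qu_biframe M" "biframe L" "qu_surjection M L h" "dense_hom M L h"
  shows "qu_completion M L h"
proof -
  interpret M: qu_biframe M by fact
  interpret L: biframe L by fact
  show ?thesis
    using assms(3,4) unfolding qu_surjection_def qu_hom_def base_of_def by unfold_locales blast+
qed

lemma biframe_hom_comp:
  assumes "biframe_hom M C h" "biframe_hom C L f"
  shows "biframe_hom M L (f \<circ> h)"
proof -
  note homs = assms[unfolded biframe_hom_def frame_hom_def]
  have h: "h x \<in> carrier C" if "x \<in> carrier M" for x
    using that conjunct1[OF conjunct1[OF homs(1)]] by (rule funcset_mem[rotated])
  have f: "f y \<in> carrier L" if "y \<in> carrier C" for y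
    using that conjunct1[OF conjunct1[OF homs(2)]] by (rule funcset_mem[rotated])
  have "frame_hom M L (f \<circ> h)"
    unfolding frame_hom_def
  proof (intro conjI ballI allI impI)
    show "f \<circ> h \<in> carrier M \<rightarrow> carrier L" by (simp add: h f)
    show "(f \<circ> h) \<top>\<^bsub>M\<^esub> = \<top>\<^bsub>L\<^esub>"
      using homs by simp
    show "(f \<circ> h) (x \<sqinter>\<^bsub>M\<^esub> y) = (f \<circ> h) x \<sqinter>\<^bsub>L\<^esub> (f \<circ> h) y"
      if "x \<in> carrier M" "y \<in> carrier M" for x y
      using homs h[OF that(1)] h[OF that(2)] that by simp
    show "(f \<circ> h) (\<Squnion>\<^bsub>M\<^esub>A) = \<Squnion>\<^bsub>L\<^esub>((f \<circ> h) ` A)" if A: "A \<subseteq> carrier M" for A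
    proof -
      have "h ` A \<subseteq> carrier C" using A h by blast
      then have "f (\<Squnion>\<^bsub>C\<^esub>(h ` A)) = \<Squnion>\<^bsub>L\<^esub>(f ` h ` A)"
        using homs(2) by simp
      moreover have "h (\<Squnion>\<^bsub>M\<^esub>A) = \<Squnion>\<^bsub>C\<^esub>(h ` A)"
        using homs(1) A by simp
      ultimately show ?thesis by (simp add: image_comp)
    qed
  qed
  moreover have "(f \<circ> h) ` part1 M \<subseteq> part1 L" "(f \<circ> h) ` part2 M \<subseteq> part2 L"
    using assms by (force simp: biframe_hom_def)+
  ultimately show ?thesis by (simp only: biframe_hom_def)
qed

lemma qu_completion_comp:
  assumes "qu_completion M C h" "qu_completion C L f"
  shows "qu_completion M L (f \<circ> h)"
proof -
  interpret h: qu_completion M C h by fact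
  interpret f: qu_completion C L f by fact
  have image: "image_cover L (f \<circ> h) U = image_cover L f (image_cover C h U)" if U: "U \<in> quni M" for U
  proof (intro equalityI subsetI)
    fix p assume "p \<in> image_cover L (f \<circ> h) U"
    then obtain u where u: "u \<in> U" "\<And>i. component i p \<sqsubseteq>\<^bsub>L\<^esub> f (h (component i u))" and p: "p \<in> pairs L"
      unfolding mem_image_cover_iff by auto
    have up: "u \<in> pairs M" using u U h.M.quni_pairs by blast
    then have "map_prod h h u \<in> image_cover C h U"
      unfolding mem_image_cover_iff using u by (auto intro!: bexI[of _ u])
    then show "p \<in> image_cover L f (image_cover C h U)"
      unfolding mem_image_cover_iff[of p] using u p by (auto intro!: bexI[of _ "map_prod h h u"])
  next
    fix p assume "p \<in> image_cover L f (image_cover C h U)"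
    then obtain v where v: "v \<in> image_cover C h U" "\<And>i. component i p \<sqsubseteq>\<^bsub>L\<^esub> f (component i v)" and p: "p \<in> pairs L"
      unfolding mem_image_cover_iff[of p] by auto
    then obtain u where u: "u \<in> U" "\<And>i. component i v \<sqsubseteq>\<^bsub>C\<^esub> h (component i u)" and vp: "v \<in> pairs C"
      unfolding mem_image_cover_iff[of v] by auto
    have up: "u \<in> pairs M" using u U h.M.quni_pairs by blast
    have "component i p \<sqsubseteq>\<^bsub>L\<^esub> (f \<circ> h) (component i u)" for i
      using v(2)[of i] f.h_mono[OF u(2)[of i]] p vp up
      by (simp, meson f.L.le_trans f.L.pairs_carrier h.L.pairs_carrier f.h_closed h.M.pairs_carrier h.h_closed)
    then show "p \<in> image_cover L (f \<circ> h) U" unfolding mem_image_cover_iff using u p by blast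
  qed
  show ?thesis
  proof unfold_locales
    show "biframe_hom M L (f \<circ> h)" by (rule biframe_hom_comp[OF h.hom f.hom])
    show "surjective_hom M L (f \<circ> h)"
      using h.surj f.surj unfolding surjective_hom_def image_comp[symmetric] by simp
    show "dense_hom M L (f \<circ> h)"
      unfolding dense_hom_def using h.h_eq_bottom_iff f.h_eq_bottom_iff h.h_closed by simp
    show "image_cover L (f \<circ> h) U \<in> quni L" if "U \<in> quni M" for U
      using that image h.image_quni f.image_quni by simp
    show "\<exists>U\<in>quni M. image_cover L (f \<circ> h) U \<subseteq> V" if V: "V \<in> quni L" for V
    proof -
      obtain W where W: "W \<in> quni C" "image_cover L f W \<subseteq> V" using f.image_base V by blast
      obtain U where U: "U \<in> quni M" "image_cover C h U \<subseteq> W" using h.image_base W(1) by blast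
      have "image_cover L f (image_cover C h U) \<subseteq> image_cover L f W"
        using U(2) unfolding subset_iff mem_image_cover_iff[of _ L] by blast
      then show ?thesis using W U image by (metis order_trans)
    qed
  qed
qed

context qu_completion
begin

lemma mem_below_pairs_iff: "p \<in> below_pairs m \<longleftrightarrow> p \<in> pairs L \<and> wedge M (adj_pair p) \<sqsubseteq>\<^bsub>M\<^esub> m"
  by (simp add: below_pairs_def)

text \<open>A dense surjection \<open>k\<close> onto \<open>M\<close> is injective: an element \<open>n\<close> is determined by its trace on
  the pairs of \<open>L\<close>, which is closed, hence the trace of an element of \<open>M\<close>, necessarily of \<open>k n\<close>.\<close>

lemma bicompleteI:
  assumes closed: "\<And>D. uclosed L D \<Longrightarrow> \<exists>m\<in>carrier M. D = below_pairs m"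
  shows "bicomplete TYPE('n) M"
  unfolding bicomplete_def
proof (intro allI impI)
  fix N :: "'n qubiframe" and k
  assume N: "qu_biframe N \<and> qu_surjection N M k \<and> dense_hom N M k"
  interpret k: qu_completion N M k
    using N by (intro qu_completionI M.biframe_axioms) simp_all
  interpret c: qu_completion N L "h \<circ> k"
    by (rule qu_completion_comp[OF k.qu_completion_axioms qu_completion_axioms])
  \<comment> \<open>Lifting to N and applying \<open>k\<close> gives the lift to M: one inequality
    is the adjunction for \<open>h\<close>, and for the other the lift of \<open>adj i a\<close>
    along \<open>k\<close> maps to \<open>a\<close> in L and so lies below
    \<open>c.adj i a\<close>.\<close>
  have k_adj: "k (c.adj i a) = adj i a" if a: "a \<in> part i L" for i a
  proof (rule M.le_antisym)
    have ca: "c.adj i a \<in> part i N" using a by simp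
    have "h (k (c.adj i a)) = a" using c.h_adj[OF a] by simp
    then show "k (c.adj i a) \<sqsubseteq>\<^bsub>M\<^esub> adj i a" using a ca by (simp add: le_adj_iff)
    let ?t = "k.adj i (adj i a)"
    have t: "?t \<in> part i N" "k ?t = adj i a" using a by simp_all
    then have "?t \<sqsubseteq>\<^bsub>N\<^esub> c.adj i a" using a by (simp add: c.le_adj_iff)
    then show "adj i a \<sqsubseteq>\<^bsub>M\<^esub> k (c.adj i a)" using k.h_mono[of ?t "c.adj i a"] t ca by simp
  qed (use a in simp_all)
  have k_wedge: "k (wedge N (c.adj_pair p)) = wedge M (adj_pair p)" if "p \<in> pairs L" for p
    using that by (simp add: k.h_wedge wedge_component k_adj pairsD)
  have trace: "c.below_pairs n = below_pairs (k n)" if n: "n \<in> carrier N" for n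
  proof -
    obtain m where m: "m \<in> carrier M" "c.below_pairs n = below_pairs m"
      using closed c.uclosed_below_pairs[OF n] by blast
    \<comment> \<open>The right adjoint of \<open>k\<close> on the total part. All lifted wedges
      below \<open>n\<close> lie below its value at \<open>m\<close>, so join-density gives
      \<open>n\<close> \<le> \<open>?t\<close>, that is \<open>k n\<close> \<le> \<open>m\<close>.
      With this inequality the trace of \<open>k n\<close> cannot exceed that of
      \<open>n\<close>.\<close>
    let ?t = "right_adjoint N (carrier N) M k m"
    note galois = right_adjoint_galois[OF k.M.frame_axioms k.M.subframe_carrier M.complete_lattice_axioms k.frame_hom m(1)]
    have "wedge N (c.adj_pair p) \<sqsubseteq>\<^bsub>N\<^esub> ?t" if p: "p \<in> pairs L" "wedge N (c.adj_pair p) \<sqsubseteq>\<^bsub>N\<^esub> n" for p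
    proof -
      have "p \<in> below_pairs m" using p m(2) c.mem_below_pairs_iff by blast
      then show ?thesis using p galois(2)[of "wedge N (c.adj_pair p)"] by (simp add: k_wedge mem_below_pairs_iff)
    qed
    then have "n \<sqsubseteq>\<^bsub>N\<^esub> ?t" using c.le_iff_adj[OF n galois(1)] by blast
    then have kn: "k n \<sqsubseteq>\<^bsub>M\<^esub> m" using galois(2)[OF n] by blast
    show ?thesis
    proof (intro equalityI subsetI)
      fix p assume "p \<in> c.below_pairs n"
      then have p: "p \<in> pairs L" "wedge N (c.adj_pair p) \<sqsubseteq>\<^bsub>N\<^esub> n" using c.mem_below_pairs_iff by blast+
      then show "p \<in> below_pairs (k n)"
        using k.h_mono[OF p(2)] n by (simp add: mem_below_pairs_iff k_wedge)
    next
      fix p assume "p \<in> below_pairs (k n)"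
      then have p: "p \<in> pairs L" "wedge M (adj_pair p) \<sqsubseteq>\<^bsub>M\<^esub> k n" using mem_below_pairs_iff by blast+
      then have "wedge M (adj_pair p) \<sqsubseteq>\<^bsub>M\<^esub> m"
        using kn m n by (meson M.le_trans M.wedge_closed adj_pair_pairs k.h_closed)
      then show "p \<in> c.below_pairs n" unfolding m(2) using p by (simp add: mem_below_pairs_iff)
    qed
  qed
  have "inj_on k (carrier N)"
    using trace c.below_pairs_inject by (intro inj_onI) metis
  then show "qu_iso N M k" using M.quni_paircover by (rule k.qu_iso_if_inj)
qed

end

section \<open>Transport between records with the same underlying biframe\<close>

text \<open>A biframe and its extension by a quasi-uniformity are records of different types, so
  they cannot be equated; this relation compares the fields on which the biframe notions
  depend.\<close>

definition same_biframe :: "('a, 'r) biframe_scheme \<Rightarrow> ('a, 's) biframe_scheme \<Rightarrow> bool" where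
  "same_biframe M N \<longleftrightarrow> carrier M = carrier N \<and> eq M = eq N \<and> le M = le N
    \<and> part1 M = part1 N \<and> part2 M = part2 N"

lemma same_biframe_operations:
  assumes "same_biframe M N"
  shows "Lattice.sup M = Lattice.sup N" "meet M = meet N" "Order.top M = Order.top N" "bottom M = bottom N"
    "part i M = part i N" "pairs M = pairs N" "subframe S M \<longleftrightarrow> subframe S N"
    "down M = down N" "paircover M = paircover N" "star i M = star i N"
proof -
  note f = assms[unfolded same_biframe_def]
  show sup: "Lattice.sup M = Lattice.sup N" and top: "Order.top M = Order.top N" and bottom: "bottom M = bottom N"
    using f by (simp_all add: fun_eq_iff Lattice.sup_def Order.top_def bottom_def least_def greatest_def Upper_def)
  show meet: "meet M = meet N"
    using f by (simp add: fun_eq_iff meet_def Lattice.inf_def greatest_def Lower_def)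
  show "part i M = part i N" "pairs M = pairs N" and down: "down M = down N"
    using f by (simp_all add: fun_eq_iff part_def pairs_def down_def)
  show "subframe S M \<longleftrightarrow> subframe S N" using f by (simp add: subframe_def sup meet top)
  show "paircover M = paircover N"
    using f by (simp add: fun_eq_iff paircover_def pairs_join_def down sup meet top)
  show "star i M = star i N"
    by (simp add: fun_eq_iff star_def sup meet bottom)
qed

lemma biframe_cong:
  assumes "same_biframe M N" "biframe M"
  shows "biframe N"
proof -
  note f = assms(1)[unfolded same_biframe_def]
  have ops: "least M = least N" "Upper M = Upper N" "greatest M = greatest N" "Lower M = Lower N"
    using f by (simp_all add: fun_eq_iff least_def greatest_def Upper_def Lower_def)
  note ops = ops same_biframe_operations[OF assms(1)]
  have "biframe M \<longleftrightarrow> biframe N"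
    unfolding biframe_def biframe_axioms_def frame_def frame_axioms_def complete_lattice_def
      complete_lattice_axioms_def partial_order_def partial_order_axioms_def weak_partial_order_def
      weak_partial_order_axioms_def equivalence_def
    by (simp only: f ops)
  then show ?thesis using assms(2) by blast
qed

lemma biframe_hom_cong:
  assumes "same_biframe M M'" "same_biframe L L'"
  shows "biframe_hom M L h \<longleftrightarrow> biframe_hom M' L' h" "surjective_hom M L h \<longleftrightarrow> surjective_hom M' L' h"
    "dense_hom M L h \<longleftrightarrow> dense_hom M' L' h"
proof -
  note f = assms[unfolded same_biframe_def]
  note ops = same_biframe_operations[OF assms(1)] same_biframe_operations[OF assms(2)]
  show "biframe_hom M L h \<longleftrightarrow> biframe_hom M' L' h"
    using f by (simp add: biframe_hom_def frame_hom_def ops)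
  show "surjective_hom M L h \<longleftrightarrow> surjective_hom M' L' h" "dense_hom M L h \<longleftrightarrow> dense_hom M' L' h"
    using f by (simp_all add: surjective_hom_def dense_hom_def ops)
qed

lemma dense_surjection_cong:
  assumes "same_biframe M M'" "same_biframe L L'" "dense_surjection M L h"
  shows "dense_surjection M' L' h"
proof -
  interpret dense_surjection M L h by fact
  show ?thesis
    using biframe_cong[OF assms(1) M.biframe_axioms] biframe_cong[OF assms(2) L.biframe_axioms]
      hom surj dense biframe_hom_cong[OF assms(1,2), of h]
    by (simp add: dense_surjection_def dense_surjection_axioms_def)
qed

text \<open>The candidate quasi-uniformity whose base consists of the lifted covers. Starting from a
  plain biframe makes truncation return exactly that biframe, which is how part (a) of the theorem
  is stated.\<close>

definition lift_quni :: "'m biframe \<Rightarrow> ('a, 's) qubiframe_scheme \<Rightarrow> ('m \<Rightarrow> 'a) \<Rightarrow> 'm qubiframe" where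
  "lift_quni B L h = \<lparr>carrier = carrier B, eq = eq B, le = le B, part1 = part1 B, part2 = part2 B,
     quni = {V. paircover B V \<and> (\<exists>U\<in>quni L. dense_surjection.lift_cover B L h U \<subseteq> V)}\<rparr>"

lemma same_biframe_lift_quni: "same_biframe B (lift_quni B L h)"
  by (simp add: same_biframe_def lift_quni_def)

lemma truncate_lift_quni: "biframe.truncate (lift_quni B L h) = B"
  by (cases B) (simp add: lift_quni_def biframe.truncate_def)

lemma lift_cover_cong:
  assumes "same_biframe M M'" "dense_surjection M L h"
  shows "dense_surjection.adj M' L h = dense_surjection.adj M L h"
    and "dense_surjection.lift_cover M' L h = dense_surjection.lift_cover M L h"
proof -
  interpret M: dense_surjection M L h by fact
  interpret M': dense_surjection M' L h
    by (rule dense_surjection_cong[OF assms(1) _ assms(2)]) (simp add: same_biframe_def)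
  note ops = same_biframe_operations[OF assms(1)]
  show adj: "M'.adj = M.adj"
    by (simp add: fun_eq_iff M'.adj_def M.adj_def right_adjoint_def ops)
  show "M'.lift_cover = M.lift_cover"
    by (simp add: fun_eq_iff M'.lift_cover_def M.lift_cover_def M'.adj_pair_def M.adj_pair_def ops adj)
qed

lemma lifted_quniformityI:
  assumes "dense_surjection B L h" "qu_biframe L"
    and join: "\<And>U. U \<in> quni L \<Longrightarrow> pairs_join B (dense_surjection.lift_cover B L h U) = \<top>\<^bsub>B\<^esub>"
    and adm: "\<And>i x. x \<in> part i B \<Longrightarrow>
      x \<sqsubseteq>\<^bsub>B\<^esub> \<Squnion>\<^bsub>B\<^esub>{y \<in> part i B. \<exists>U\<in>quni L. star i B y (dense_surjection.lift_cover B L h U) \<sqsubseteq>\<^bsub>B\<^esub> x}"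
  shows "lifted_quniformity (lift_quni B L h) L h"
proof -
  let ?M = "lift_quni B L h"
  note same = same_biframe_lift_quni[of B L h]
  note ops = same_biframe_operations[OF same]
  note lift = lift_cover_cong(2)[OF same assms(1)]
  have le: "le ?M = le B" by (simp add: lift_quni_def)
  interpret L: qu_biframe L by fact
  have "dense_surjection ?M L h"
    by (rule dense_surjection_cong[OF same _ assms(1)]) (simp add: same_biframe_def)
  then show ?thesis
  proof (intro lifted_quniformity.intro lifted_quniformity_axioms.intro L.qu_biframe_axioms)
    have "quni ?M = {V. paircover B V \<and> (\<exists>U\<in>quni L. dense_surjection.lift_cover B L h U \<subseteq> V)}"
      by (simp add: lift_quni_def)
    then show "quni ?M = {V. paircover ?M V \<and> (\<exists>U\<in>quni L. dense_surjection.lift_cover ?M L h U \<subseteq> V)}"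
      by (simp only: ops lift)
    show "pairs_join ?M (dense_surjection.lift_cover ?M L h U) = \<top>\<^bsub>?M\<^esub>" if "U \<in> quni L" for U
      using join[OF that] by (simp only: pairs_join_def ops lift)
    show "x \<sqsubseteq>\<^bsub>?M\<^esub> \<Squnion>\<^bsub>?M\<^esub>{y \<in> part i ?M. \<exists>U\<in>quni L. star i ?M y (dense_surjection.lift_cover ?M L h U) \<sqsubseteq>\<^bsub>?M\<^esub> x}"
      if "x \<in> part i ?M" for i x
      using adm[of x i] that by (simp only: ops lift le)
  qed
qed

section \<open>The completion of a quasi-uniform biframe\<close>

definition generator :: "('a, 'r) biframe_scheme \<Rightarrow> bool \<Rightarrow> 'a \<Rightarrow> 'a \<times> 'a" where
  "generator L i a = (if i then (a, \<top>\<^bsub>L\<^esub>) else (\<top>\<^bsub>L\<^esub>, a))"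

definition uclosure :: "('a, 'r) qubiframe_scheme \<Rightarrow> ('a \<times> 'a) set \<Rightarrow> ('a \<times> 'a) set" where
  "uclosure L X = \<Inter>{D. uclosed L D \<and> X \<subseteq> D}"

text \<open>The closure of a single generator is the lift of an element of the i-th part
  (\<open>adj_uclosed\<close>); admitting arbitrary sets of generators adds the joins of such
  lifts.\<close>

definition uclosed_part :: "('a, 'r) qubiframe_scheme \<Rightarrow> bool \<Rightarrow> ('a \<times> 'a) set set" where
  "uclosed_part L i = {uclosure L (generator L i ` A) |A. A \<subseteq> part i L}"

text \<open>The presented completion of L. Its elements have the type
  \<open>('a \<times> 'a) set\<close>, the type at which \<open>uclosed_is_principal\<close> assumes
  bicompleteness.\<close>

definition uclosed_biframe :: "('a, 'r) qubiframe_scheme \<Rightarrow> ('a \<times> 'a) set biframe" where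
  "uclosed_biframe L = \<lparr>carrier = {D. uclosed L D}, eq = (=), le = (\<subseteq>),
     part1 = uclosed_part L True, part2 = uclosed_part L False\<rparr>"

lemma component_generator [simp]:
  "component i (generator L i a) = a" "component (\<not> i) (generator L i a) = \<top>\<^bsub>L\<^esub>"
  by (simp_all add: component_def generator_def)

lemma uclosure_upper: "X \<subseteq> uclosure L X"
  by (auto simp: uclosure_def)

lemma uclosure_least: "uclosed L D \<Longrightarrow> X \<subseteq> D \<Longrightarrow> uclosure L X \<subseteq> D"
  by (auto simp: uclosure_def)

lemma uclosure_mono: "X \<subseteq> Y \<Longrightarrow> uclosure L X \<subseteq> uclosure L Y"
  by (auto simp: uclosure_def)

context biframe
begin

lemma bool_pair_cases: "(\<forall>j. P j) \<longleftrightarrow> P i \<and> P (\<not> i)"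
  by (cases i) (auto simp: all_bool_eq)

lemma generator_pairs [simp]: "a \<in> part i L \<Longrightarrow> generator L i a \<in> pairs L"
  by (simp add: mem_pairs_iff bool_pair_cases[of _ i])

lemma generator_mono: "a \<sqsubseteq> b \<Longrightarrow> component j (generator L i a) \<sqsubseteq> component j (generator L i b)"
  by (cases "j = i") (simp_all add: component_def generator_def)

lemma wedge_generator: "a \<in> part i L \<Longrightarrow> wedge L (generator L i a) = a"
  by (simp add: wedge_component'[of L _ i] meet_top)

lemma pair_eqI: "component True p = component True q \<Longrightarrow> component False p = component False q \<Longrightarrow> p = q"
  by (simp add: component_def prod_eq_iff)

lemma pair_meet_comm: "pair_meet L p q = pair_meet L q p"
  by (rule pair_eqI) (simp_all add: meet_comm)

lemma pair_meet_idem: "p \<in> pairs L \<Longrightarrow> pair_meet L p p = p"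
  by (rule pair_eqI) (simp_all add: meet_idem)

lemma pair_meet_assoc:
  "\<lbrakk>p \<in> pairs L; q \<in> pairs L; r \<in> pairs L\<rbrakk> \<Longrightarrow>
    pair_meet L (pair_meet L p q) r = pair_meet L p (pair_meet L q r)"
  by (rule pair_eqI) (simp_all add: meet_assoc)

lemma top_pair: "(\<top>, \<top>) \<in> pairs L"
  by (simp add: mem_pairs_iff all_bool_eq)

lemma pair_meet_top: "p \<in> pairs L \<Longrightarrow> pair_meet L (\<top>, \<top>) p = p"
  by (rule pair_eqI) (simp_all add: meet_comm[of L \<top>] meet_top)

end

section \<open>The biframe of closed sets of pairs\<close>

context qu_biframe
begin

lemma uclosed_pairs: "uclosed L (pairs L)"
  by (rule uclosedI) simp_all

lemma uclosed_Inter: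
  assumes "\<D> \<noteq> {}" "\<And>D. D \<in> \<D> \<Longrightarrow> uclosed L D"
  shows "uclosed L (\<Inter>\<D>)"
proof (rule uclosedI)
  show "\<Inter>\<D> \<subseteq> pairs L" using assms uclosedD(1) by blast
  show "p \<in> \<Inter>\<D>" if "p \<in> pairs L" "q \<in> \<Inter>\<D>" "\<And>i. component i p \<sqsubseteq> component i q" for p q
    by (intro InterI uclosedD(2)[OF assms(2) that(1)]) (use that(2,3) in blast)+
  show "p \<in> \<Inter>\<D>" if "p \<in> pairs L" "wedge L p = \<bottom>" for p
    by (intro InterI uclosedD(3)[OF assms(2) that])
  show "p \<in> \<Inter>\<D>" if "p \<in> pairs L"
    "\<And>q. \<lbrakk>q \<in> pairs L; \<And>i. below i L (component i q) (component i p)\<rbrakk> \<Longrightarrow> q \<in> \<Inter>\<D>" for p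
    by (intro InterI uclosedD(4)[OF assms(2) that(1)]) (use that(2) in blast)+
  show "p \<in> \<Inter>\<D>" if "p \<in> pairs L" "U \<in> quni L" "\<And>u. u \<in> U \<Longrightarrow> pair_meet L p u \<in> \<Inter>\<D>" for p U
    by (intro InterI uclosedD(5)[OF assms(2) that(1,2)]) (use that(3) in blast)+
qed

lemma uclosed_uclosure: "X \<subseteq> pairs L \<Longrightarrow> uclosed L (uclosure L X)"
  unfolding uclosure_def using uclosed_pairs by (intro uclosed_Inter) auto

lemma uclosure_subset: "X \<subseteq> pairs L \<Longrightarrow> uclosure L X \<subseteq> pairs L"
  by (rule uclosure_least[OF uclosed_pairs])

text \<open>For a downset E this set is the Heyting implication from E to D in the downsets of
  pairs. That it is closed whenever D is makes the closure operator compatible with binary meets, so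
  it underlies both \<open>uclosure_Int\<close> and the frame law.\<close>

lemma uclosed_residual:
  assumes D: "uclosed L D" and E: "E \<subseteq> pairs L"
  shows "uclosed L {p \<in> pairs L. \<forall>e\<in>E. pair_meet L p e \<in> D}" (is "uclosed L ?R")
proof (rule uclosedI)
  show "?R \<subseteq> pairs L" by (rule Collect_restrict)
next
  fix p q assume p: "p \<in> pairs L" and q: "q \<in> ?R" and le: "\<And>i. component i p \<sqsubseteq> component i q"
  have "pair_meet L p e \<in> D" if e: "e \<in> E" for e
  proof (rule uclosedD(2)[OF D])
    have ep: "e \<in> pairs L" using e E by blast
    show "pair_meet L p e \<in> pairs L" using p ep by simp
    show "pair_meet L q e \<in> D" using q e by blast
    show "component i (pair_meet L p e) \<sqsubseteq> component i (pair_meet L q e)" for i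
      using p q ep le by (simp add: meet_mono)
  qed
  then show "p \<in> ?R" using p by blast
next
  fix p assume p: "p \<in> pairs L" "wedge L p = \<bottom>"
  have "pair_meet L p e \<in> D" if e: "e \<in> E" for e
  proof (rule uclosedD(3)[OF D])
    have ep: "e \<in> pairs L" using e E by blast
    show "pair_meet L p e \<in> pairs L" using p ep by simp
    show "wedge L (pair_meet L p e) = \<bottom>"
      using p ep by (simp add: wedge_pair_meet meet_comm[of L \<bottom>] meet_bottom)
  qed
  then show "p \<in> ?R" using p by blast
next
  fix p assume p: "p \<in> pairs L"
    and *: "\<And>q. \<lbrakk>q \<in> pairs L; \<And>i. below i L (component i q) (component i p)\<rbrakk> \<Longrightarrow> q \<in> ?R"
  have "pair_meet L p e \<in> D" if e: "e \<in> E" for e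
  proof (rule uclosedD(4)[OF D])
    have ep: "e \<in> pairs L" using e E by blast
    show "pair_meet L p e \<in> pairs L" using p ep by simp
    fix q assume q: "q \<in> pairs L" and b: "\<And>i. below i L (component i q) (component i (pair_meet L p e))"
    have "q \<in> ?R"
    proof (rule *[OF q])
      show "below i L (component i q) (component i p)" for i
        using b[of i] p ep below_mono_right[of i "component i q" "component i p \<sqinter> component i e"]
        by (simp add: meet_left)
    qed
    then have qe: "pair_meet L q e \<in> D" using e by blast
    \<comment> \<open>Being uniformly below implies being below, so \<open>q\<close> lies under
      \<open>e\<close> and therefore under its own meet with \<open>e\<close>, which is already
      known to be in D.\<close>
    have "component i q \<sqsubseteq> component i (pair_meet L q e)" for i
    proof -
      have "component i q \<sqsubseteq> component i p \<sqinter> component i e" using b[of i] below_le[of i] p ep by simp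
      then show ?thesis using p q ep by (simp add: le_meet_iff)
    qed
    then show "q \<in> D" using uclosedD(2)[OF D q qe] by blast
  qed
  then show "p \<in> ?R" using p by blast
next
  fix p U assume p: "p \<in> pairs L" and U: "U \<in> quni L" and *: "\<And>u. u \<in> U \<Longrightarrow> pair_meet L p u \<in> ?R"
  have "pair_meet L p e \<in> D" if e: "e \<in> E" for e
  proof (rule uclosedD(5)[OF D _ U])
    have ep: "e \<in> pairs L" using e E by blast
    show "pair_meet L p e \<in> pairs L" using p ep by simp
    fix u assume u: "u \<in> U"
    have up: "u \<in> pairs L" using u U quni_pairs by blast
    have "pair_meet L (pair_meet L p u) e \<in> D" using *[OF u] e by blast
    moreover have "pair_meet L (pair_meet L p u) e = pair_meet L (pair_meet L p e) u"
      using p up ep by (simp add: pair_meet_assoc pair_meet_comm[of u])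
    ultimately show "pair_meet L (pair_meet L p e) u \<in> D" by simp
  qed
  then show "p \<in> ?R" using p by blast
qed

text \<open>The residual is used twice: X is replaced by its closure while Y stays fixed, then Y by
  its closure with all of \<open>uclosure L X\<close> as test set. A common element \<open>p\<close>
  of the two closures is finally tested against itself, where \<open>pair_meet L p p\<close> is
  \<open>p\<close>.\<close>

lemma uclosure_Int:
  assumes X: "X \<subseteq> pairs L" and Y: "Y \<subseteq> pairs L"
  shows "uclosure L X \<inter> uclosure L Y = uclosure L {pair_meet L x y |x y. x \<in> X \<and> y \<in> Y}"
    (is "_ = uclosure L ?Z")
proof
  have Z: "?Z \<subseteq> pairs L" using X Y pair_meet_pairs by blast
  note cZ = uclosed_uclosure[OF Z]
  have "uclosure L X \<subseteq> {p \<in> pairs L. \<forall>y\<in>Y. pair_meet L p y \<in> uclosure L ?Z}"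
    using X uclosure_upper[of ?Z L] by (intro uclosure_least uclosed_residual[OF cZ Y]) blast
  then have X': "pair_meet L y x \<in> uclosure L ?Z" if "x \<in> uclosure L X" "y \<in> Y" for x y
    using that pair_meet_comm[of y x] by auto
  have "uclosure L Y \<subseteq> {p \<in> pairs L. \<forall>x\<in>uclosure L X. pair_meet L p x \<in> uclosure L ?Z}"
    using Y X' by (intro uclosure_least uclosed_residual[OF cZ uclosure_subset[OF X]] subsetI CollectI conjI ballI) blast+
  then have "pair_meet L p p \<in> uclosure L ?Z" "p \<in> pairs L" if "p \<in> uclosure L X" "p \<in> uclosure L Y" for p
    using that by blast+
  then show "uclosure L X \<inter> uclosure L Y \<subseteq> uclosure L ?Z"
    using pair_meet_idem by (intro subsetI) (elim IntE, simp)
  have "?Z \<subseteq> uclosure L X \<inter> uclosure L Y"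
  proof
    fix z assume "z \<in> ?Z"
    then obtain x y where xy: "x \<in> X" "y \<in> Y" "z = pair_meet L x y" by blast
    then have p: "x \<in> pairs L" "y \<in> pairs L" using X Y by blast+
    have "z \<in> uclosure L X"
      by (rule uclosedD(2)[OF uclosed_uclosure[OF X], of _ x])
        (use xy p uclosure_upper in \<open>auto simp: meet_left\<close>)
    moreover have "z \<in> uclosure L Y"
      by (rule uclosedD(2)[OF uclosed_uclosure[OF Y], of _ y])
        (use xy p uclosure_upper in \<open>auto simp: meet_right\<close>)
    ultimately show "z \<in> uclosure L X \<inter> uclosure L Y" by blast
  qed
  then show "uclosure L ?Z \<subseteq> uclosure L X \<inter> uclosure L Y"
    using uclosed_Inter[of "{uclosure L X, uclosure L Y}"] uclosed_uclosure X Y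
    by (intro uclosure_least) auto
qed

text \<open>The clauses hold by monotonicity, by admissibility, and by splitting a wedge along a
  cover. Every element of L thus presents a closed set, and for bicomplete L there are no others
  (\<open>uclosed_is_principal\<close>).\<close>

lemma uclosed_principal:
  assumes k: "k \<in> carrier L"
  shows "uclosed L {p \<in> pairs L. wedge L p \<sqsubseteq> k}" (is "uclosed L ?G")
proof (rule uclosedI)
  show "?G \<subseteq> pairs L" by (rule Collect_restrict)
  show "p \<in> ?G" if "p \<in> pairs L" "q \<in> ?G" "\<And>i. component i p \<sqsubseteq> component i q" for p q
    using that wedge_mono[of p q] k by (simp, meson le_trans wedge_closed)
  show "p \<in> ?G" if "p \<in> pairs L" "wedge L p = \<bottom>" for p using that k by simp
  show "p \<in> ?G" if "p \<in> pairs L"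
    "\<And>q. \<lbrakk>q \<in> pairs L; \<And>i. below i L (component i q) (component i p)\<rbrakk> \<Longrightarrow> q \<in> ?G" for p
    using that wedge_le_iff_below[OF that(1) k] by blast
  show "p \<in> ?G" if "p \<in> pairs L" "U \<in> quni L" "\<And>u. u \<in> U \<Longrightarrow> pair_meet L p u \<in> ?G" for p U
  proof -
    have "wedge L p \<sqinter> wedge L u \<sqsubseteq> k" if u: "u \<in> U" for u
      using \<open>\<And>u. u \<in> U \<Longrightarrow> pair_meet L p u \<in> ?G\<close>[OF u] \<open>p \<in> pairs L\<close> quni_pairs[OF \<open>U \<in> quni L\<close> u]
      by (simp add: wedge_pair_meet)
    then have "wedge L p \<sqsubseteq> k" using le_by_cover[OF \<open>U \<in> quni L\<close> wedge_closed[OF \<open>p \<in> pairs L\<close>] k] by blast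
    then show ?thesis using that by blast
  qed
qed

lemma uclosed_subset: "uclosed L D \<Longrightarrow> D \<subseteq> pairs L"
  by (simp add: uclosed_def)

lemma uclosed_Int: "uclosed L D \<Longrightarrow> uclosed L E \<Longrightarrow> uclosed L (D \<inter> E)"
  using uclosed_Inter[of "{D, E}"] by auto

lemma Union_uclosed_pairs: "A \<subseteq> {D. uclosed L D} \<Longrightarrow> \<Union>A \<subseteq> pairs L"
  using uclosed_subset by blast

lemma uclosure_subset_iff:
  "uclosed L D \<Longrightarrow> uclosure L X \<subseteq> D \<longleftrightarrow> X \<subseteq> D"
  using uclosure_least uclosure_upper by blast

text \<open>Joins are closures of unions and meets are intersections. For distributivity, the union
  of A lies in the residual of the right-hand side by D; this residual is closed, so it also
  contains the closure of the union.\<close>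

lemma uclosed_biframe_frame:
  shows "frame (uclosed_biframe L)"
    and "A \<subseteq> {D. uclosed L D} \<Longrightarrow> \<Squnion>\<^bsub>uclosed_biframe L\<^esub>A = uclosure L (\<Union>A)"
    and "uclosed L D \<Longrightarrow> uclosed L E \<Longrightarrow> D \<sqinter>\<^bsub>uclosed_biframe L\<^esub> E = D \<inter> E"
proof -
  let ?N = "uclosed_biframe L"
  have N: "carrier ?N = {D. uclosed L D}" "le ?N = (\<subseteq>)" "eq ?N = (=)"
    by (simp_all add: uclosed_biframe_def)
  note ops = frame_of_operations[of ?N "\<lambda>A. uclosure L (\<Union>A)" "(\<inter>)", unfolded N]
  have distrib: "D \<inter> uclosure L (\<Union>A) \<subseteq> uclosure L (\<Union>((\<inter>) D ` A))"
    if D: "D \<in> {D. uclosed L D}" and A: "A \<subseteq> {D. uclosed L D}" for D A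
  proof
    let ?Y = "\<Union>((\<inter>) D ` A)"
    have Dp: "uclosed L D" "D \<subseteq> pairs L" using D uclosed_subset by blast+
    have Y: "?Y \<subseteq> pairs L" using Dp by blast
    have "\<Union>A \<subseteq> {p \<in> pairs L. \<forall>e\<in>D. pair_meet L p e \<in> uclosure L ?Y}"
    proof (intro subsetI CollectI conjI ballI)
      fix p e assume p: "p \<in> \<Union>A" and e: "e \<in> D"
      have pp: "p \<in> pairs L" using p Union_uclosed_pairs[OF A] by blast
      obtain E where E: "E \<in> A" "p \<in> E" using p by blast
      then have uE: "uclosed L E" using A by blast
      have ep: "e \<in> pairs L" using e Dp by blast
      have "pair_meet L p e \<in> E"
        by (rule uclosedD(2)[OF uE _ E(2)]) (use pp ep in \<open>simp_all add: meet_left\<close>)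
      moreover have "pair_meet L p e \<in> D"
        by (rule uclosedD(2)[OF Dp(1) _ e]) (use pp ep in \<open>simp_all add: meet_right\<close>)
      ultimately show "pair_meet L p e \<in> uclosure L ?Y" using E(1) uclosure_upper[of ?Y L] by blast
    next
      fix p assume "p \<in> \<Union>A"
      then show "p \<in> pairs L" using Union_uclosed_pairs[OF A] by blast
    qed
    then have le: "uclosure L (\<Union>A) \<subseteq> {p \<in> pairs L. \<forall>e\<in>D. pair_meet L p e \<in> uclosure L ?Y}"
      by (rule uclosure_least[OF uclosed_residual[OF uclosed_uclosure[OF Y] Dp(2)]])
    fix p assume p: "p \<in> D \<inter> uclosure L (\<Union>A)"
    then have "pair_meet L p p \<in> uclosure L ?Y" using le by blast
    moreover have "p \<in> pairs L" using p Dp by blast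
    ultimately show "p \<in> uclosure L ?Y" by (simp add: pair_meet_idem)
  qed
  have closed: "uclosure L (\<Union>A) \<in> {D. uclosed L D}" if "A \<subseteq> {D. uclosed L D}" for A
    using uclosed_uclosure[OF Union_uclosed_pairs[OF that]] by blast
  have lub: "uclosure L (\<Union>A) \<subseteq> z \<longleftrightarrow> (\<forall>a\<in>A. a \<subseteq> z)" if "z \<in> {D. uclosed L D}" for A z
    using that by (simp add: uclosure_subset_iff Sup_le_iff)
  have Int: "D \<inter> E \<in> {D. uclosed L D}" if "D \<in> {D. uclosed L D}" "E \<in> {D. uclosed L D}" for D E
    using that uclosed_Int by blast
  note facts = closed lub Int distrib
  show "frame ?N" by (rule ops(1); (rule facts; assumption)?; blast)
  show "\<Squnion>\<^bsub>?N\<^esub>A = uclosure L (\<Union>A)" if "A \<subseteq> {D. uclosed L D}"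
    by (rule ops(2); (rule facts; assumption)?; use that in blast)
  show "D \<sqinter>\<^bsub>?N\<^esub> E = D \<inter> E" if "uclosed L D" "uclosed L E"
    by (rule ops(3); (rule facts; assumption)?; use that in blast)
qed

lemma uclosed_generator_mono:
  assumes "uclosed L D" "generator L i b \<in> D" "a \<in> part i L" "a \<sqsubseteq> b"
  shows "generator L i a \<in> D"
  by (rule uclosedD(2)[OF assms(1) _ assms(2)]) (use assms generator_mono in simp_all)

text \<open>Any presenting set of elements can be enlarged to all those whose generator lies in D.
  This canonical choice gives joins within a part and the values of the right adjoints.\<close>

lemma uclosed_part_iff:
  assumes "uclosed L D"
  shows "D \<in> uclosed_part L i \<longleftrightarrow> D = uclosure L (generator L i ` {a \<in> part i L. generator L i a \<in> D})"
proof
  assume "D = uclosure L (generator L i ` {a \<in> part i L. generator L i a \<in> D})"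
  then show "D \<in> uclosed_part L i" unfolding uclosed_part_def by blast
next
  let ?A = "{a \<in> part i L. generator L i a \<in> D}"
  assume "D \<in> uclosed_part L i"
  then obtain A where A: "A \<subseteq> part i L" "D = uclosure L (generator L i ` A)"
    unfolding uclosed_part_def by blast
  have "generator L i ` A \<subseteq> D" unfolding A(2) by (rule uclosure_upper)
  then have "A \<subseteq> ?A" using A(1) by blast
  then have "D \<subseteq> uclosure L (generator L i ` ?A)" unfolding A(2) by (intro uclosure_mono image_mono)
  moreover have "uclosure L (generator L i ` ?A) \<subseteq> D" by (rule uclosure_least[OF assms]) blast
  ultimately show "D = uclosure L (generator L i ` ?A)" by blast
qed

lemma generator_image: "A \<subseteq> part i L \<Longrightarrow> generator L i ` A \<subseteq> pairs L"
  by (intro image_subsetI generator_pairs) (rule subsetD)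

lemma uclosed_of_part: "D \<in> uclosed_part L i \<Longrightarrow> uclosed L D"
  unfolding uclosed_part_def using uclosed_uclosure generator_image by blast

lemma uclosed_partI: "A \<subseteq> part i L \<Longrightarrow> uclosure L (generator L i ` A) \<in> uclosed_part L i"
  unfolding uclosed_part_def by blast

lemma part_uclosed_biframe [simp]: "part i (uclosed_biframe L) = uclosed_part L i"
  by (simp add: part_def uclosed_biframe_def)

lemma carrier_uclosed_biframe [simp]: "carrier (uclosed_biframe L) = {D. uclosed L D}"
  by (simp add: uclosed_biframe_def)

lemma le_uclosed_biframe [simp]: "le (uclosed_biframe L) = (\<subseteq>)"
  by (simp add: uclosed_biframe_def)

lemma uclosed_top:
  assumes "uclosed L D" "(\<top>, \<top>) \<in> D"
  shows "D = pairs L"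
proof
  show "D \<subseteq> pairs L" by (rule uclosed_subset[OF assms(1)])
  have "component i p \<sqsubseteq> component i (\<top>, \<top>)" if "p \<in> pairs L" for p i
    using that by (cases i) simp_all
  then show "pairs L \<subseteq> D" using uclosedD(2)[OF assms(1) _ assms(2)] by blast
qed

section \<open>The join map from closed sets onto L, and its right adjoints\<close>

lemma pairs_join_le_iff_subset:
  "\<lbrakk>uclosed L D; k \<in> carrier L\<rbrakk> \<Longrightarrow> pairs_join L D \<sqsubseteq> k \<longleftrightarrow> D \<subseteq> {p \<in> pairs L. wedge L p \<sqsubseteq> k}"
  using uclosed_subset by (auto simp: pairs_join_le_iff)

text \<open>The pairs with wedge below \<open>k\<close> form a closed set, so a bound for the wedges
  of X persists on the closure.\<close>

lemma pairs_join_uclosure_le_iff: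
  assumes "X \<subseteq> pairs L" "k \<in> carrier L"
  shows "pairs_join L (uclosure L X) \<sqsubseteq> k \<longleftrightarrow> (\<forall>p\<in>X. wedge L p \<sqsubseteq> k)"
  unfolding pairs_join_le_iff_subset[OF uclosed_uclosure[OF assms(1)] assms(2)]
    uclosure_subset_iff[OF uclosed_principal[OF assms(2)]]
  using assms(1) by blast

lemma pairs_join_uclosure:
  assumes "X \<subseteq> pairs L"
  shows "pairs_join L (uclosure L X) = \<Squnion>(wedge L ` X)"
  by (rule sup_eqI[symmetric])
    (use assms uclosure_subset[OF assms] in \<open>auto simp: wedge_image_carrier pairs_join_uclosure_le_iff\<close>)

lemma pairs_join_generators:
  assumes "A \<subseteq> part i L"
  shows "pairs_join L (uclosure L (generator L i ` A)) = \<Squnion>A"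
proof -
  have "wedge L ` generator L i ` A = A"
    unfolding image_image by (simp add: wedge_generator subsetD[OF assms] cong: image_cong_simp)
  then show ?thesis by (simp add: pairs_join_uclosure[OF generator_image[OF assms]])
qed

text \<open>The join map is left adjoint to sending \<open>k\<close> to the pairs with wedge below
  \<open>k\<close>, hence preserves joins. It preserves binary meets by distributivity in L, because
  the meet of a pair of D with a pair of E lies in both sets.\<close>

lemma uclosed_biframe_hom: "frame_hom (uclosed_biframe L) L (pairs_join L)"
  unfolding frame_hom_def
proof (intro conjI ballI allI impI)
  let ?N = "uclosed_biframe L"
  interpret N: frame ?N by (rule uclosed_biframe_frame)
  show "pairs_join L \<in> carrier ?N \<rightarrow> carrier L"
    using uclosed_subset by (auto simp only: Pi_iff carrier_uclosed_biframe mem_Collect_eq intro!: pairs_join_closed)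
  have "\<top>\<^bsub>?N\<^esub> = pairs L"
    by (rule N.top_eqI) (simp_all add: uclosed_pairs uclosed_subset)
  moreover have "\<top> \<sqsubseteq> pairs_join L (pairs L)"
  proof -
    have "wedge L (\<top>, \<top>) = \<top>" by (simp add: wedge_component meet_top)
    then show ?thesis using wedge_le_pairs_join[OF subset_refl top_pair] by simp
  qed
  ultimately show "pairs_join L \<top>\<^bsub>?N\<^esub> = \<top>" by (simp add: top_le_iff)
next
  fix D E assume "D \<in> carrier (uclosed_biframe L)" "E \<in> carrier (uclosed_biframe L)"
  then have D: "uclosed L D" and E: "uclosed L E" by simp_all
  have p: "D \<subseteq> pairs L" "E \<subseteq> pairs L" "D \<inter> E \<subseteq> pairs L"
    using D E uclosed_subset by blast+
  have "pairs_join L (D \<inter> E) = pairs_join L D \<sqinter> pairs_join L E"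
  proof (rule le_antisym)
    have "pairs_join L (D \<inter> E) \<sqsubseteq> pairs_join L D" "pairs_join L (D \<inter> E) \<sqsubseteq> pairs_join L E"
      using p by (simp_all add: pairs_join_le_iff wedge_le_pairs_join)
    then show "pairs_join L (D \<inter> E) \<sqsubseteq> pairs_join L D \<sqinter> pairs_join L E"
      using p by (simp add: le_meet_iff)
    have "wedge L d \<sqinter> wedge L e \<sqsubseteq> pairs_join L (D \<inter> E)" if d: "d \<in> D" and e: "e \<in> E" for d e
    proof -
      have de: "d \<in> pairs L" "e \<in> pairs L" using d e p by blast+
      have "pair_meet L d e \<in> D"
        by (rule uclosedD(2)[OF D _ d]) (use de in \<open>simp_all add: meet_left\<close>)
      moreover have "pair_meet L d e \<in> E"
        by (rule uclosedD(2)[OF E _ e]) (use de in \<open>simp_all add: meet_right\<close>)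
      ultimately have "wedge L (pair_meet L d e) \<sqsubseteq> pairs_join L (D \<inter> E)"
        by (intro wedge_le_pairs_join[OF p(3)] IntI)
      then show ?thesis using de by (simp add: wedge_pair_meet)
    qed
    then show "pairs_join L D \<sqinter> pairs_join L E \<sqsubseteq> pairs_join L (D \<inter> E)"
      unfolding pairs_join_wedge[of L D] pairs_join_wedge[of L E]
      using p by (subst sup_meet_sup_le_iff) (simp_all add: wedge_image_carrier)
  qed (use p in simp_all)
  then show "pairs_join L (D \<sqinter>\<^bsub>uclosed_biframe L\<^esub> E) = pairs_join L D \<sqinter> pairs_join L E"
    using uclosed_biframe_frame(3) D E by simp
next
  fix A assume "A \<subseteq> carrier (uclosed_biframe L)"
  then have A: "A \<subseteq> {D. uclosed L D}" by simp
  have im: "pairs_join L ` A \<subseteq> carrier L" using A uclosed_subset by auto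
  have U: "\<Union>A \<subseteq> pairs L" by (rule Union_uclosed_pairs[OF A])
  have "\<Squnion>(pairs_join L ` A) = pairs_join L (uclosure L (\<Union>A))"
  proof (rule sup_eqI[OF im])
    show "pairs_join L (uclosure L (\<Union>A)) \<in> carrier L" using uclosure_subset[OF U] by simp
    show "pairs_join L (uclosure L (\<Union>A)) \<sqsubseteq> z \<longleftrightarrow> (\<forall>a\<in>pairs_join L ` A. a \<sqsubseteq> z)" if z: "z \<in> carrier L" for z
    proof -
      have "pairs_join L D \<sqsubseteq> z \<longleftrightarrow> (\<forall>p\<in>D. wedge L p \<sqsubseteq> z)" if "D \<in> A" for D
        using that A z uclosed_subset by (intro pairs_join_le_iff) blast+
      then show ?thesis unfolding pairs_join_uclosure_le_iff[OF U z] by auto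
    qed
  qed
  then show "pairs_join L (\<Squnion>\<^bsub>uclosed_biframe L\<^esub>A) = \<Squnion>(pairs_join L ` A)"
    using uclosed_biframe_frame(2)[OF A] by simp
qed

text \<open>A pair is the meet of the two generators of its components, so
  \<open>uclosure_Int\<close> splits its closure into one element from each part. Hence the parts
  generate, and this closure is the lifted wedge of the pair.\<close>

lemma uclosure_generators:
  assumes p: "p \<in> pairs L"
  shows "uclosure L {p} =
    uclosure L (generator L True ` {component True p}) \<inter> uclosure L (generator L False ` {component False p})"
proof -
  have "pair_meet L (generator L True (component True p)) (generator L False (component False p)) = p"
    using p by (intro pair_eqI) (simp_all add: generator_def meet_top meet_comm[of L \<top>])
  then have "{pair_meet L x y |x y. x \<in> generator L True ` {component True p}
      \<and> y \<in> generator L False ` {component False p}} = {p}"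
    by (intro Set.set_eqI) (simp only: image_insert image_empty mem_Collect_eq singleton_iff, metis)
  moreover have g: "generator L i ` {component i p} \<subseteq> pairs L" for i using p by (simp add: pairsD)
  ultimately show ?thesis by (simp only: uclosure_Int[OF g g])
qed

lemma biframe_uclosed: "biframe (uclosed_biframe L)"
proof -
  let ?N = "uclosed_biframe L"
  interpret N: frame ?N by (rule uclosed_biframe_frame)
  have sub: "subframe (part i ?N) ?N" for i
    unfolding subframe_def
  proof (intro conjI ballI allI impI)
    show "part i ?N \<subseteq> carrier ?N" using uclosed_of_part by auto
    have "uclosure L (generator L i ` {\<top>}) = pairs L"
      by (rule uclosed_top[OF uclosed_uclosure])
        (use uclosure_upper[of "generator L i ` {\<top>}" L] in \<open>simp_all add: generator_def top_pair\<close>)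
    moreover have "\<top>\<^bsub>?N\<^esub> = pairs L"
      by (rule N.top_eqI) (simp_all add: uclosed_pairs uclosed_subset)
    ultimately show "\<top>\<^bsub>?N\<^esub> \<in> part i ?N"
      using uclosed_partI[of "{\<top>}" i] by simp
  next
    fix D E assume "D \<in> part i ?N" "E \<in> part i ?N"
    then obtain A B where AB: "A \<subseteq> part i L" "B \<subseteq> part i L"
      "D = uclosure L (generator L i ` A)" "E = uclosure L (generator L i ` B)"
      by (auto simp: uclosed_part_def)
    have meet: "pair_meet L (generator L i a) (generator L i b) = generator L i (a \<sqinter> b)" for a b
      by (cases i) (simp_all add: pair_meet_def generator_def meet_top)
    have "{pair_meet L x y |x y. x \<in> generator L i ` A \<and> y \<in> generator L i ` B}
        = {generator L i (a \<sqinter> b) |a b. a \<in> A \<and> b \<in> B}"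
      unfolding meet[symmetric] by blast
    also have "\<dots> = generator L i ` {a \<sqinter> b |a b. a \<in> A \<and> b \<in> B}" by blast
    finally have "D \<inter> E = uclosure L (generator L i ` {a \<sqinter> b |a b. a \<in> A \<and> b \<in> B})"
      using AB by (simp add: uclosure_Int generator_image)
    moreover have "{a \<sqinter> b |a b. a \<in> A \<and> b \<in> B} \<subseteq> part i L"
      using subsetD[OF AB(1)] subsetD[OF AB(2)] part_meet[of _ i] by blast
    ultimately have "D \<inter> E \<in> uclosed_part L i" using uclosed_partI by simp
    moreover have "uclosed L D" "uclosed L E"
      unfolding AB using AB by (simp_all add: uclosed_uclosure generator_image)
    ultimately show "D \<sqinter>\<^bsub>?N\<^esub> E \<in> part i ?N"
      by (simp add: uclosed_biframe_frame(3))
  next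
    fix \<D> assume "\<D> \<subseteq> part i ?N"
    then have D: "\<D> \<subseteq> uclosed_part L i" by simp
    then have uD: "\<D> \<subseteq> {D. uclosed L D}" using uclosed_of_part by blast
    let ?A = "{a \<in> part i L. \<exists>D\<in>\<D>. generator L i a \<in> D}"
    have gA: "generator L i ` ?A \<subseteq> pairs L" by (rule generator_image) blast
    have "uclosure L (\<Union>\<D>) = uclosure L (generator L i ` ?A)"
    proof
      have "D \<subseteq> uclosure L (generator L i ` ?A)" if DD: "D \<in> \<D>" for D
      proof -
        have "D = uclosure L (generator L i ` {a \<in> part i L. generator L i a \<in> D})"
          using DD D uD uclosed_part_iff by blast
        also have "\<dots> \<subseteq> uclosure L (generator L i ` ?A)" using DD by (intro uclosure_mono image_mono) blast
        finally show ?thesis .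
      qed
      then show "uclosure L (\<Union>\<D>) \<subseteq> uclosure L (generator L i ` ?A)"
        by (intro uclosure_least uclosed_uclosure gA) blast
      show "uclosure L (generator L i ` ?A) \<subseteq> uclosure L (\<Union>\<D>)"
        by (rule uclosure_mono) blast
    qed
    then have "uclosure L (\<Union>\<D>) \<in> uclosed_part L i" using uclosed_partI[of ?A i] by simp
    then show "\<Squnion>\<^bsub>?N\<^esub>\<D> \<in> part i ?N" using uclosed_biframe_frame(2)[OF uD] by simp
  qed
  show ?thesis
  proof unfold_locales
    show "subframe (part1 ?N) ?N" "subframe (part2 ?N) ?N"
      using sub[of True] sub[of False] by (simp_all only: part_def if_True if_False)
    fix S assume S: "subframe S ?N" "part1 ?N \<union> part2 ?N \<subseteq> S"
    have "part i ?N \<subseteq> S" for i using S(2) by (auto simp only: part_def split: if_splits)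
    then have parts: "uclosed_part L i \<subseteq> S" for i by simp
    \<comment> \<open>The closure of a single pair is a meet of one element of each part, and every
      closed set is the join of the closures of its pairs; so a subframe containing both parts is
      everything.\<close>
    have single: "uclosure L {p} \<in> S" if p: "p \<in> pairs L" for p
    proof -
      have g: "uclosure L (generator L i ` {component i p}) \<in> S" for i
        using p pairsD[OF p, of i] parts[of i] uclosed_partI[of "{component i p}" i] by blast
      have u: "uclosed L (uclosure L (generator L i ` {component i p}))" for i
        using p by (intro uclosed_uclosure generator_image) (simp add: pairsD)
      show ?thesis
        using N.subframeD(3)[OF S(1) g[of True] g[of False]]
        by (simp only: uclosure_generators[OF p] uclosed_biframe_frame(3)[OF u u])
    qed
    show "S = carrier ?N"
    proof
      show "S \<subseteq> carrier ?N" by (rule N.subframeD(1)[OF S(1)])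
      show "carrier ?N \<subseteq> S"
      proof
        fix D assume "D \<in> carrier ?N"
        then have D: "uclosed L D" by simp
        have Dp: "D \<subseteq> pairs L" by (rule uclosed_subset[OF D])
        let ?A = "(\<lambda>p. uclosure L {p}) ` D"
        have A: "?A \<subseteq> {D. uclosed L D}" using Dp uclosed_uclosure by auto
        have "?A \<subseteq> S" using single Dp by blast
        then have "\<Squnion>\<^bsub>?N\<^esub>?A \<in> S" by (rule N.subframeD(4)[OF S(1)])
        moreover have "uclosure L (\<Union>?A) = D"
        proof
          have "uclosure L {p} \<subseteq> D" if "p \<in> D" for p using that by (intro uclosure_least[OF D]) simp
          then show "uclosure L (\<Union>?A) \<subseteq> D" by (intro uclosure_least[OF D]) blast
          show "D \<subseteq> uclosure L (\<Union>?A)"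
            using uclosure_upper[of "\<Union>?A" L] uclosure_upper[of _ L] by blast
        qed
        ultimately show "D \<in> S" using uclosed_biframe_frame(2)[OF A] by simp
      qed
    qed
  qed
qed

lemma dense_surjection_uclosed: "dense_surjection (uclosed_biframe L) L (pairs_join L)"
proof -
  let ?N = "uclosed_biframe L"
  interpret N: biframe ?N by (rule biframe_uclosed)
  have img: "pairs_join L ` part i ?N = part i L" for i
  proof (intro equalityI subsetI)
    fix x assume "x \<in> pairs_join L ` part i ?N"
    then obtain A where A: "A \<subseteq> part i L" "x = pairs_join L (uclosure L (generator L i ` A))"
      by (auto simp: uclosed_part_def)
    then show "x \<in> part i L" by (simp add: pairs_join_generators part_sup)
  next
    fix x assume x: "x \<in> part i L"
    then have "pairs_join L (uclosure L (generator L i ` {x})) = x"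
      by (subst pairs_join_generators) simp_all
    moreover have "uclosure L (generator L i ` {x}) \<in> part i ?N" using x uclosed_partI[of "{x}" i] by simp
    ultimately show "x \<in> pairs_join L ` part i ?N" by (metis imageI)
  qed
  \<comment> \<open>Density is built into \<open>uclosed\<close>: a closed set with zero join
    consists of pairs with zero wedge, and these belong to every closed set.\<close>
  have "D = \<bottom>\<^bsub>?N\<^esub>" if D: "D \<in> carrier ?N" "pairs_join L D = \<bottom>" for D
  proof -
    have uD: "uclosed L D" using D by simp
    then have "pairs_join L D \<sqsubseteq> \<bottom>" using D by simp
    then have "D \<subseteq> {p \<in> pairs L. wedge L p \<sqsubseteq> \<bottom>}"
      using pairs_join_le_iff_subset[OF uD bottom_closed] by blast
    then have "wedge L p = \<bottom>" "p \<in> pairs L" if "p \<in> D" for p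
      using that by (auto simp: le_bottom_iff)
    then have "D \<subseteq> E" if "uclosed L E" for E
      using uclosedD(3)[OF that] by blast
    then show ?thesis using uD by (intro N.bottom_eqI[symmetric]) simp_all
  qed
  then show ?thesis
    using img[of True] img[of False] uclosed_biframe_hom
    by unfold_locales (auto simp: biframe_hom_def surjective_hom_def dense_hom_def part_def)
qed

text \<open>The adjoint is an element of the i-th part, hence the closure of its own generators.
  Each of these belongs to some \<open>b\<close> below \<open>a\<close>, so it already lies in the
  closure of the generator of \<open>a\<close>.\<close>

lemma adj_uclosed:
  assumes a: "a \<in> part i L"
  shows "dense_surjection.adj (uclosed_biframe L) L (pairs_join L) i a = uclosure L (generator L i ` {a})"
proof -
  let ?N = "uclosed_biframe L"
  interpret N: dense_surjection ?N L "pairs_join L" by (rule dense_surjection_uclosed)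
  have r: "uclosure L (generator L i ` {a}) \<in> uclosed_part L i" using a uclosed_partI[of "{a}" i] by simp
  have "pairs_join L (uclosure L (generator L i ` {a})) = a"
    using a by (subst pairs_join_generators) simp_all
  then have 1: "uclosure L (generator L i ` {a}) \<subseteq> N.adj i a"
    using N.le_adj_iff[of a "uclosure L (generator L i ` {a})" i] a r by simp
  have adj: "N.adj i a \<in> uclosed_part L i" using N.adj_part[of a i] a by simp
  then have u: "uclosed L (N.adj i a)" by (rule uclosed_of_part)
  let ?A = "{b \<in> part i L. generator L i b \<in> N.adj i a}"
  have eq: "N.adj i a = uclosure L (generator L i ` ?A)" using adj uclosed_part_iff[OF u] by blast
  have sub: "N.adj i a \<subseteq> {p \<in> pairs L. wedge L p \<sqsubseteq> a}"
    using pairs_join_le_iff_subset[OF u, of a] N.h_adj[OF a] a by simp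
  have ur: "uclosed L (uclosure L (generator L i ` {a}))" by (rule uclosed_of_part[OF r])
  have ga: "generator L i a \<in> uclosure L (generator L i ` {a})" by (rule subsetD[OF uclosure_upper]) simp
  have "generator L i b \<in> uclosure L (generator L i ` {a})" if b: "b \<in> ?A" for b
  proof -
    have "wedge L (generator L i b) \<sqsubseteq> a" using b sub by blast
    then have "b \<sqsubseteq> a" using b by (simp add: wedge_generator)
    then show ?thesis using b by (intro uclosed_generator_mono[OF ur ga]) simp_all
  qed
  then have "uclosure L (generator L i ` ?A) \<subseteq> uclosure L (generator L i ` {a})"
    by (intro uclosure_least[OF ur]) blast
  then show ?thesis using 1 eq by simp
qed

text \<open>The last two clauses of \<open>uclosed\<close> are tailored to this: the cover clause
  makes lifted covers cover, and the approximation clause makes the lifted stars admissible.\<close>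

lemma lifted_quniformity_uclosed:
  "lifted_quniformity (lift_quni (uclosed_biframe L) L (pairs_join L)) L (pairs_join L)"
proof (rule lifted_quniformityI[OF dense_surjection_uclosed qu_biframe_axioms])
  let ?N = "uclosed_biframe L"
  interpret N: dense_surjection ?N L "pairs_join L" by (rule dense_surjection_uclosed)
  show "pairs_join ?N (N.lift_cover U) = \<top>\<^bsub>?N\<^esub>" if U: "U \<in> quni L" for U
  proof -
    have Up: "U \<subseteq> pairs L" by (rule quni_subset[OF U])
    have aU: "N.adj_pair ` U \<subseteq> pairs ?N" using Up N.adj_pair_pairs by blast
    have J: "uclosed L (pairs_join ?N (N.adj_pair ` U))"
      using N.M.pairs_join_closed[OF aU] by simp
    have "u \<in> pairs_join ?N (N.adj_pair ` U)" if u: "u \<in> U" for u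
    proof -
      have up: "u \<in> pairs L" using u Up by blast
      have ucl: "uclosed L (uclosure L (generator L i ` {component i u}))" for i
        using up by (intro uclosed_uclosure generator_image) (simp add: pairsD)
      have "wedge ?N (N.adj_pair u) = uclosure L {u}"
        using up by (simp add: wedge_component adj_uclosed pairsD uclosure_generators[OF up]
            uclosed_biframe_frame(3)[OF ucl[of True] ucl[of False], simplified])
      moreover have "wedge ?N (N.adj_pair u) \<subseteq> pairs_join ?N (N.adj_pair ` U)"
        using N.M.wedge_le_pairs_join[OF aU imageI[OF u]] by simp
      ultimately show ?thesis using uclosure_upper[of "{u}" L] by blast
    qed
    \<comment> \<open>The meet of the top pair with \<open>u\<close> is \<open>u\<close>, so the
      cover clause applied to the top pair turns a closed set containing U into the whole.\<close>
    then have "(\<top>, \<top>) \<in> pairs_join ?N (N.adj_pair ` U)"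
      using quni_pairs[OF U] by (intro uclosedD(5)[OF J top_pair U]) (simp add: pair_meet_top)
    then have "pairs_join ?N (N.adj_pair ` U) = pairs L" by (rule uclosed_top[OF J])
    moreover have "\<top>\<^bsub>?N\<^esub> = pairs L"
      by (rule N.M.top_eqI) (simp_all add: uclosed_pairs uclosed_subset)
    ultimately show ?thesis using N.pairs_join_lift_cover[OF Up] by simp
  qed
  fix i X assume "X \<in> part i ?N"
  then have X: "X \<in> uclosed_part L i" by simp
  then have uX: "uclosed L X" by (rule uclosed_of_part)
  let ?Y = "{Y \<in> part i ?N. \<exists>U\<in>quni L. star i ?N Y (N.lift_cover U) \<sqsubseteq>\<^bsub>?N\<^esub> X}"
  let ?Z = "\<Squnion>\<^bsub>?N\<^esub>?Y"
  have Yc: "?Y \<subseteq> carrier ?N" using uclosed_of_part by auto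
  have uZ: "uclosed L ?Z" using N.M.sup_closed[OF Yc] by simp
  \<comment> \<open>By the approximation clause for \<open>?Z\<close> it suffices to treat pairs
    uniformly below the generator. The i-th component of such a pair has a star inside
    \<open>a\<close> for some U, and then \<open>star_lift_le\<close> puts the closure of its
    generator into \<open>?Y\<close>.\<close>
  have "generator L i a \<in> ?Z" if a: "a \<in> part i L" "generator L i a \<in> X" for a
  proof (rule uclosedD(4)[OF uZ])
    show "generator L i a \<in> pairs L" using a by simp
    fix q assume q: "q \<in> pairs L" and b: "\<And>j. below j L (component j q) (component j (generator L i a))"
    let ?c = "component i q"
    have c: "?c \<in> part i L" using q pairsD by blast
    obtain U where U: "U \<in> quni L" "star i L ?c U \<sqsubseteq> a"
      using b[of i] unfolding below_def by auto
    let ?Q = "uclosure L (generator L i ` {?c})"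
    have Qp: "?Q \<in> part i ?N" using c uclosed_partI[of "{?c}" i] by simp
    then have uQ: "uclosed L ?Q" using uclosed_of_part by simp
    have fQ: "pairs_join L ?Q = ?c" using c by (subst pairs_join_generators) simp_all
    have s: "star i L ?c U \<in> part i L" using U by simp
    have "star i ?N ?Q (N.lift_cover U) \<sqsubseteq>\<^bsub>?N\<^esub> N.adj i (star i L (pairs_join L ?Q) U)"
      using uQ U by (intro N.star_lift_le quni_subset) simp_all
    then have "star i ?N ?Q (N.lift_cover U) \<subseteq> uclosure L (generator L i ` {star i L ?c U})"
      by (simp only: fQ adj_uclosed[OF s] le_uclosed_biframe)
    also have "\<dots> \<subseteq> X"
      using uclosed_generator_mono[OF uX a(2) s U(2)] by (intro uclosure_least[OF uX]) simp
    finally have "?Q \<in> ?Y" using Qp U(1) by auto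
    then have "?Q \<subseteq> ?Z" using N.M.sup_upper[OF Yc] by simp
    moreover have "generator L i ?c \<in> ?Q" by (rule subsetD[OF uclosure_upper]) simp
    ultimately have "generator L i ?c \<in> ?Z" by blast
    then show "q \<in> ?Z"
    proof (rule uclosedD(2)[OF uZ q])
      \<comment> \<open>The other coordinate of the generator is \<top>, so only the i-th coordinate
        matters.\<close>
      have "component j q \<sqsubseteq> component j (generator L i ?c) \<longleftrightarrow> True" for j
        using q by (cases "j = i") (simp_all add: component_generator(2)[of i, simplified])
      then show "component j q \<sqsubseteq> component j (generator L i ?c)" for j by simp
    qed
  qed
  then have "generator L i ` {a \<in> part i L. generator L i a \<in> X} \<subseteq> ?Z" by blast
  then have "uclosure L (generator L i ` {a \<in> part i L. generator L i a \<in> X}) \<subseteq> ?Z"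
    by (rule uclosure_least[OF uZ])
  then show "X \<sqsubseteq>\<^bsub>?N\<^esub> ?Z" using X uclosed_part_iff[OF uX] by simp
qed

text \<open>Bicompleteness makes the join map injective on closed sets, while D and the set of all
  pairs with wedge below its join have the same join by \<open>wedges_generate\<close>.\<close>

lemma uclosed_is_principal:
  assumes "bicomplete TYPE(('a \<times> 'a) set) L" "uclosed L D"
  shows "D = {p \<in> pairs L. wedge L p \<sqsubseteq> pairs_join L D}"
proof -
  let ?M = "lift_quni (uclosed_biframe L) L (pairs_join L)"
  interpret M: lifted_quniformity ?M L "pairs_join L" by (rule lifted_quniformity_uclosed)
  have "qu_iso ?M L (pairs_join L)"
    using assms(1) M.qu_biframe_M M.qu_surjection_h M.dense unfolding bicomplete_def by blast
  then obtain g where "\<And>x. x \<in> carrier ?M \<Longrightarrow> g (pairs_join L x) = x"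
    unfolding qu_iso_def by blast
  then have g: "uclosed L E \<Longrightarrow> g (pairs_join L E) = E" for E by (simp add: lift_quni_def)
  let ?k = "pairs_join L D"
  let ?G = "{p \<in> pairs L. wedge L p \<sqsubseteq> ?k}"
  have k: "?k \<in> carrier L" using uclosed_subset[OF assms(2)] by simp
  have "pairs_join L ?G = ?k" unfolding pairs_join_wedge[of L ?G] by (rule wedges_generate[OF k, symmetric])
  then show ?thesis using g[OF assms(2)] g[OF uclosed_principal[OF k]] by simp
qed

end

section \<open>Frame congruences and quotients\<close>

context frame
begin

text \<open>Congruences are defined through the operations of \<open>square_order\<close>, which are
  choices determined by the order. Computing them componentwise makes the definition usable.\<close>

lemma square_order_frame:
  shows "frame (square_order L)"
    and "A \<subseteq> carrier L \<times> carrier L \<Longrightarrow> \<Squnion>\<^bsub>square_order L\<^esub>A = (\<Squnion>(fst ` A), \<Squnion>(snd ` A))"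
    and "p \<in> carrier L \<times> carrier L \<Longrightarrow> q \<in> carrier L \<times> carrier L \<Longrightarrow>
      p \<sqinter>\<^bsub>square_order L\<^esub> q = (fst p \<sqinter> fst q, snd p \<sqinter> snd q)"
proof -
  let ?S = "square_order L"
  have S: "carrier ?S = carrier L \<times> carrier L" "eq ?S = (=)"
    "le ?S = (\<lambda>p q. fst p \<sqsubseteq> fst q \<and> snd p \<sqsubseteq> snd q)"
    by (simp_all add: square_order_def)
  note ops = frame_of_operations[of ?S "\<lambda>A. (\<Squnion>(fst ` A), \<Squnion>(snd ` A))"
      "\<lambda>p q. (fst p \<sqinter> fst q, snd p \<sqinter> snd q)", unfolded S]
  have proj: "fst ` A \<subseteq> carrier L" "snd ` A \<subseteq> carrier L" if "A \<subseteq> carrier L \<times> carrier L" for A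
    using that by force+
  have refl: "fst p \<sqsubseteq> fst p \<and> snd p \<sqsubseteq> snd p" if "p \<in> carrier L \<times> carrier L" for p
    using that by auto
  have antisym: "p = q"
    if "p \<in> carrier L \<times> carrier L" "q \<in> carrier L \<times> carrier L"
      "fst p \<sqsubseteq> fst q \<and> snd p \<sqsubseteq> snd q" "fst q \<sqsubseteq> fst p \<and> snd q \<sqsubseteq> snd p" for p q
    using that le_antisym by (simp add: prod_eq_iff mem_Times_iff)
  have trans: "fst p \<sqsubseteq> fst r \<and> snd p \<sqsubseteq> snd r"
    if "p \<in> carrier L \<times> carrier L" "q \<in> carrier L \<times> carrier L" "r \<in> carrier L \<times> carrier L"
      "fst p \<sqsubseteq> fst q \<and> snd p \<sqsubseteq> snd q" "fst q \<sqsubseteq> fst r \<and> snd q \<sqsubseteq> snd r" for p q r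
    using that le_trans[of "fst p" "fst q" "fst r"] le_trans[of "snd p" "snd q" "snd r"]
    by (simp add: mem_Times_iff)
  have closed: "(\<Squnion>(fst ` A), \<Squnion>(snd ` A)) \<in> carrier L \<times> carrier L" if "A \<subseteq> carrier L \<times> carrier L" for A
    using proj[OF that] by simp
  have lub: "fst (\<Squnion>(fst ` A), \<Squnion>(snd ` A)) \<sqsubseteq> fst z \<and> snd (\<Squnion>(fst ` A), \<Squnion>(snd ` A)) \<sqsubseteq> snd z \<longleftrightarrow>
      (\<forall>a\<in>A. fst a \<sqsubseteq> fst z \<and> snd a \<sqsubseteq> snd z)"
    if "A \<subseteq> carrier L \<times> carrier L" "z \<in> carrier L \<times> carrier L" for A z
    using proj[OF that(1)] that(2) by (auto simp: sup_le_iff mem_Times_iff)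
  have m_closed: "(fst p \<sqinter> fst q, snd p \<sqinter> snd q) \<in> carrier L \<times> carrier L"
    if "p \<in> carrier L \<times> carrier L" "q \<in> carrier L \<times> carrier L" for p q
    using that by (simp add: mem_Times_iff)
  have glb: "fst r \<sqsubseteq> fst (fst p \<sqinter> fst q, snd p \<sqinter> snd q) \<and> snd r \<sqsubseteq> snd (fst p \<sqinter> fst q, snd p \<sqinter> snd q) \<longleftrightarrow>
      (fst r \<sqsubseteq> fst p \<and> snd r \<sqsubseteq> snd p) \<and> fst r \<sqsubseteq> fst q \<and> snd r \<sqsubseteq> snd q"
    if "p \<in> carrier L \<times> carrier L" "q \<in> carrier L \<times> carrier L" "r \<in> carrier L \<times> carrier L" for p q r
    using that by (auto simp: le_meet_iff mem_Times_iff)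
  let ?m = "\<lambda>p q. (fst p \<sqinter> fst q, snd p \<sqinter> snd q)"
  have distrib: "fst (?m p (\<Squnion>(fst ` A), \<Squnion>(snd ` A))) \<sqsubseteq> fst (\<Squnion>(fst ` ?m p ` A), \<Squnion>(snd ` ?m p ` A))
      \<and> snd (?m p (\<Squnion>(fst ` A), \<Squnion>(snd ` A))) \<sqsubseteq> snd (\<Squnion>(fst ` ?m p ` A), \<Squnion>(snd ` ?m p ` A))"
    if p: "p \<in> carrier L \<times> carrier L" and A: "A \<subseteq> carrier L \<times> carrier L" for p A
  proof -
    have "fst p \<in> carrier L" "snd p \<in> carrier L" using p by (simp_all add: mem_Times_iff)
    then have "fst p \<sqinter> \<Squnion>(fst ` A) = \<Squnion>(fst ` ?m p ` A)" "snd p \<sqinter> \<Squnion>(snd ` A) = \<Squnion>(snd ` ?m p ` A)"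
      using proj[OF A] by (simp_all add: meet_Sup_distrib image_image)
    moreover have "\<Squnion>(fst ` ?m p ` A) \<in> carrier L" "\<Squnion>(snd ` ?m p ` A) \<in> carrier L"
      using proj[of "?m p ` A", OF image_subsetI[OF m_closed[OF p subsetD[OF A]]]] by (simp_all only: sup_closed)
    ultimately show ?thesis by simp
  qed
  note facts = refl antisym trans closed lub m_closed glb distrib
  show "frame ?S" by (rule ops(1); (rule facts; assumption)?; rule HOL.refl)
  show "\<Squnion>\<^bsub>?S\<^esub>A = (\<Squnion>(fst ` A), \<Squnion>(snd ` A))" if "A \<subseteq> carrier L \<times> carrier L"
    by (rule ops(2); (rule facts; assumption)?; (rule HOL.refl | rule that))
  show "p \<sqinter>\<^bsub>?S\<^esub> q = (fst p \<sqinter> fst q, snd p \<sqinter> snd q)"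
    if "p \<in> carrier L \<times> carrier L" "q \<in> carrier L \<times> carrier L"
    by (rule ops(3); (rule facts; assumption)?; (rule HOL.refl | rule that))
qed

lemma frame_congruence_iff:
  "frame_congruence L \<Theta> \<longleftrightarrow> equiv (carrier L) \<Theta>
    \<and> (\<forall>x x' y y'. (x, x') \<in> \<Theta> \<longrightarrow> (y, y') \<in> \<Theta> \<longrightarrow> (x \<sqinter> y, x' \<sqinter> y') \<in> \<Theta>)
    \<and> (\<forall>A\<subseteq>\<Theta>. (\<Squnion>(fst ` A), \<Squnion>(snd ` A)) \<in> \<Theta>)"
proof -
  let ?S = "square_order L"
  interpret S: frame ?S by (rule square_order_frame)
  have "subframe \<Theta> ?S \<longleftrightarrow> (\<forall>x x' y y'. (x, x') \<in> \<Theta> \<longrightarrow> (y, y') \<in> \<Theta> \<longrightarrow> (x \<sqinter> y, x' \<sqinter> y') \<in> \<Theta>)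
    \<and> (\<forall>A\<subseteq>\<Theta>. (\<Squnion>(fst ` A), \<Squnion>(snd ` A)) \<in> \<Theta>)" if e: "equiv (carrier L) \<Theta>"
  proof -
    have sub: "\<Theta> \<subseteq> carrier L \<times> carrier L" using e by (auto dest: equiv_type)
    have c: "carrier ?S = carrier L \<times> carrier L" by (simp add: square_order_def)
    have "\<top>\<^bsub>?S\<^esub> = (\<top>, \<top>)" by (rule S.top_eqI) (auto simp: square_order_def)
    moreover have "(\<top>, \<top>) \<in> \<Theta>" using e by (auto simp: equiv_def dest: refl_onD)
    moreover have "(\<forall>p\<in>\<Theta>. \<forall>q\<in>\<Theta>. p \<sqinter>\<^bsub>?S\<^esub> q \<in> \<Theta>) \<longleftrightarrow> (\<forall>p\<in>\<Theta>. \<forall>q\<in>\<Theta>. (fst p \<sqinter> fst q, snd p \<sqinter> snd q) \<in> \<Theta>)"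
      by (intro ball_cong HOL.refl) (simp only: square_order_frame(3)[OF subsetD[OF sub] subsetD[OF sub]])
    moreover have "\<dots> \<longleftrightarrow> (\<forall>x x' y y'. (x, x') \<in> \<Theta> \<longrightarrow> (y, y') \<in> \<Theta> \<longrightarrow> (x \<sqinter> y, x' \<sqinter> y') \<in> \<Theta>)"
      by (simp add: split_paired_Ball_Sigma Ball_def)
    moreover have "(\<forall>A\<subseteq>\<Theta>. \<Squnion>\<^bsub>?S\<^esub>A \<in> \<Theta>) \<longleftrightarrow> (\<forall>A\<subseteq>\<Theta>. (\<Squnion>(fst ` A), \<Squnion>(snd ` A)) \<in> \<Theta>)"
      using square_order_frame(2) sub by (metis subset_trans)
    ultimately show ?thesis unfolding subframe_def using sub c by simp
  qed
  then show ?thesis unfolding frame_congruence_def by blast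
qed

text \<open>The values of \<phi> carry no structure. Besides a homomorphism, \<phi> can thus be
  \<open>\<lambda>x. x \<sqinter> a\<close>, or the map sending \<open>x\<close> to the set of
  \<open>w\<close> with \<open>x \<sqinter> w\<close> below a fixed element.\<close>

lemma frame_congruence_kernel:
  assumes meet: "\<And>x x' y y'. \<lbrakk>x \<in> carrier L; x' \<in> carrier L; y \<in> carrier L; y' \<in> carrier L; \<phi> x = \<phi> x'; \<phi> y = \<phi> y'\<rbrakk>
      \<Longrightarrow> \<phi> (x \<sqinter> y) = \<phi> (x' \<sqinter> y')"
    and sup: "\<And>A. \<lbrakk>A \<subseteq> carrier L \<times> carrier L; \<And>p. p \<in> A \<Longrightarrow> \<phi> (fst p) = \<phi> (snd p)\<rbrakk>
      \<Longrightarrow> \<phi> (\<Squnion>(fst ` A)) = \<phi> (\<Squnion>(snd ` A))"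
  shows "frame_congruence L {(x, y) \<in> carrier L \<times> carrier L. \<phi> x = \<phi> y}" (is "frame_congruence L ?\<Theta>")
  unfolding frame_congruence_iff
proof (intro conjI allI impI)
  show "equiv (carrier L) ?\<Theta>" by (auto simp: equiv_def refl_on_def sym_def trans_def)
  show "(x \<sqinter> y, x' \<sqinter> y') \<in> ?\<Theta>" if "(x, x') \<in> ?\<Theta>" "(y, y') \<in> ?\<Theta>" for x x' y y'
    using that meet[of x x' y y'] by simp
  show "(\<Squnion>(fst ` A), \<Squnion>(snd ` A)) \<in> ?\<Theta>" if A: "A \<subseteq> ?\<Theta>" for A
  proof -
    have "A \<subseteq> carrier L \<times> carrier L" "\<And>p. p \<in> A \<Longrightarrow> \<phi> (fst p) = \<phi> (snd p)" using A by auto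
    moreover from this have "fst ` A \<subseteq> carrier L" "snd ` A \<subseteq> carrier L" by force+
    ultimately show ?thesis using sup[of A] by simp
  qed
qed

lemma frame_congruence_Delta:
  assumes a: "a \<in> carrier L"
  shows "frame_congruence L (Delta L a)"
  unfolding Delta_def
proof (rule frame_congruence_kernel)
  show "x \<sqinter> y \<sqinter> a = x' \<sqinter> y' \<sqinter> a"
    if "x \<in> carrier L" "x' \<in> carrier L" "y \<in> carrier L" "y' \<in> carrier L"
      "x \<sqinter> a = x' \<sqinter> a" "y \<sqinter> a = y' \<sqinter> a" for x x' y y'
    using that a by (metis meet_assoc meet_comm)
  show "\<Squnion>(fst ` A) \<sqinter> a = \<Squnion>(snd ` A) \<sqinter> a"
    if A: "A \<subseteq> carrier L \<times> carrier L" "\<And>p. p \<in> A \<Longrightarrow> fst p \<sqinter> a = snd p \<sqinter> a" for A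
  proof -
    have c: "fst ` A \<subseteq> carrier L" "snd ` A \<subseteq> carrier L" using A(1) by force+
    have "(\<lambda>x. a \<sqinter> x) ` fst ` A = (\<lambda>x. a \<sqinter> x) ` snd ` A"
      unfolding image_image using A(2) by (intro image_cong HOL.refl) (simp add: meet_comm[of L a])
    then show ?thesis using a c by (simp add: meet_comm[of L _ a] meet_Sup_distrib)
  qed
qed

lemma frame_congruence_full: "frame_congruence L (carrier L \<times> carrier L)"
  using frame_congruence_kernel[of "\<lambda>_. ()"] by (simp add: case_prod_unfold flip: mem_Times_iff)

lemma frame_congruence_Inter:
  assumes "\<C> \<noteq> {}" "\<And>\<Theta>. \<Theta> \<in> \<C> \<Longrightarrow> frame_congruence L \<Theta>"
  shows "frame_congruence L (\<Inter>\<C>)"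
  unfolding frame_congruence_iff
proof (intro conjI allI impI)
  note C = assms(2)[unfolded frame_congruence_iff]
  show "equiv (carrier L) (\<Inter>\<C>)"
  proof (rule equivI)
    have e: "refl_on (carrier L) \<Theta>" "sym \<Theta>" "trans \<Theta>" "\<Theta> \<subseteq> carrier L \<times> carrier L" if "\<Theta> \<in> \<C>" for \<Theta>
      using C[OF that] by (auto simp: equiv_def dest: equiv_type)
    show "\<Inter>\<C> \<subseteq> carrier L \<times> carrier L" using assms(1) e(4) by blast
    show "refl_on (carrier L) (\<Inter>\<C>)" using e(1) by (simp add: refl_on_def)
    show "sym (\<Inter>\<C>)" using e(2) unfolding sym_def by blast
    show "trans (\<Inter>\<C>)" using e(3) unfolding trans_def by blast
  qed
  show "(x \<sqinter> y, x' \<sqinter> y') \<in> \<Inter>\<C>" if "(x, x') \<in> \<Inter>\<C>" "(y, y') \<in> \<Inter>\<C>" for x x' y y'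
    using that C by (intro InterI) blast
  show "(\<Squnion>(fst ` A), \<Squnion>(snd ` A)) \<in> \<Inter>\<C>" if "A \<subseteq> \<Inter>\<C>" for A
    using that C by (intro InterI) blast
qed

text \<open>The join in \<open>congruence_frame L\<close> is a choice among least upper bounds; the
  intersection is shown to be the only one, which determines the choice.\<close>

lemma sup_congruence_frame:
  assumes "\<And>\<Theta>. \<Theta> \<in> \<C> \<Longrightarrow> frame_congruence L \<Theta>"
  shows "\<Squnion>\<^bsub>congruence_frame L\<^esub>\<C> = \<Inter>{\<Psi>. frame_congruence L \<Psi> \<and> \<Union>\<C> \<subseteq> \<Psi>}" (is "_ = ?I")
proof -
  have I: "frame_congruence L ?I"
  proof (rule frame_congruence_Inter)
    have "\<Union>\<C> \<subseteq> carrier L \<times> carrier L"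
      using equiv_type[OF conjunct1[OF assms[unfolded frame_congruence_iff]]] by blast
    then show "{\<Psi>. frame_congruence L \<Psi> \<and> \<Union>\<C> \<subseteq> \<Psi>} \<noteq> {}" using frame_congruence_full by blast
  qed blast
  have U: "Upper (congruence_frame L) \<C> = {\<Psi>. frame_congruence L \<Psi> \<and> \<Union>\<C> \<subseteq> \<Psi>}"
    using assms by (auto simp: Upper_def congruence_frame_def)
  have "is_lub (congruence_frame L) \<Theta> \<C> \<longleftrightarrow> \<Theta> = ?I" for \<Theta>
    unfolding U least_def using I by (auto simp: congruence_frame_def)
  then show ?thesis unfolding Lattice.sup_def by simp
qed

lemma frame_congruenceD:
  assumes "frame_congruence L \<Theta>"
  shows "equiv (carrier L) \<Theta>"
    and "(x, x') \<in> \<Theta> \<Longrightarrow> (y, y') \<in> \<Theta> \<Longrightarrow> (x \<sqinter> y, x' \<sqinter> y') \<in> \<Theta>"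
    and "A \<subseteq> \<Theta> \<Longrightarrow> (\<Squnion>(fst ` A), \<Squnion>(snd ` A)) \<in> \<Theta>"
  using assms unfolding frame_congruence_iff by blast+

end

section \<open>The quotient of a biframe by a frame congruence, and factorization through it\<close>

locale biframe_quotient = M: biframe M for M :: "('a, 'r) biframe_scheme" +
  fixes \<Theta> :: "('a \<times> 'a) set"
  assumes congruence: "frame_congruence M \<Theta>"
begin

abbreviation "Q \<equiv> quotient_biframe M \<Theta>"
abbreviation "q \<equiv> quotient_map \<Theta>"

lemmas congruence_meet = M.frame_congruenceD(2)[OF congruence]
  and congruence_sup = M.frame_congruenceD(3)[OF congruence]
  and congruence_equiv = M.frame_congruenceD(1)[OF congruence]

lemma congruence_refl: "x \<in> carrier M \<Longrightarrow> (x, x) \<in> \<Theta>"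
  using congruence_equiv by (auto elim!: equivE dest: refl_onD)

lemma congruence_sym: "(x, y) \<in> \<Theta> \<Longrightarrow> (y, x) \<in> \<Theta>"
  using congruence_equiv by (auto elim!: equivE dest: symD)

lemma congruence_trans: "(x, y) \<in> \<Theta> \<Longrightarrow> (y, z) \<in> \<Theta> \<Longrightarrow> (x, z) \<in> \<Theta>"
  using congruence_equiv by (auto elim!: equivE dest: transD)

lemma congruence_carrier: "(x, y) \<in> \<Theta> \<Longrightarrow> x \<in> carrier M \<and> y \<in> carrier M"
  using equiv_type[OF congruence_equiv] by blast

lemma carrier_quotient: "carrier Q = q ` carrier M"
  by (auto simp: quotient_biframe_def quotient_def quotient_map_def)

lemma mem_quotient_map: "y \<in> q x \<longleftrightarrow> (x, y) \<in> \<Theta>"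
  by (simp add: quotient_map_def)

lemma quotient_map_eq_iff: "\<lbrakk>x \<in> carrier M; y \<in> carrier M\<rbrakk> \<Longrightarrow> q x = q y \<longleftrightarrow> (x, y) \<in> \<Theta>"
  unfolding quotient_map_def using congruence_equiv by (simp add: eq_equiv_class_iff)

lemma quotient_le_iff:
  assumes "x \<in> carrier M" "y \<in> carrier M"
  shows "q x \<sqsubseteq>\<^bsub>Q\<^esub> q y \<longleftrightarrow> (x \<sqinter>\<^bsub>M\<^esub> y, x) \<in> \<Theta>"
proof
  assume "q x \<sqsubseteq>\<^bsub>Q\<^esub> q y"
  then obtain a b where ab: "(x, a) \<in> \<Theta>" "(y, b) \<in> \<Theta>" "a \<sqsubseteq>\<^bsub>M\<^esub> b"
    by (auto simp: quotient_biframe_def mem_quotient_map)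
  then have "(x \<sqinter>\<^bsub>M\<^esub> y, a \<sqinter>\<^bsub>M\<^esub> b) \<in> \<Theta>" by (intro congruence_meet)
  moreover have "a \<sqinter>\<^bsub>M\<^esub> b = a" using ab congruence_carrier by (intro M.meet_absorb) blast+
  ultimately show "(x \<sqinter>\<^bsub>M\<^esub> y, x) \<in> \<Theta>" using congruence_trans[OF _ congruence_sym[OF ab(1)]] by simp
next
  assume "(x \<sqinter>\<^bsub>M\<^esub> y, x) \<in> \<Theta>"
  then have "x \<sqinter>\<^bsub>M\<^esub> y \<in> q x" "y \<in> q y"
    using assms congruence_refl congruence_sym by (simp_all add: mem_quotient_map)
  then show "q x \<sqsubseteq>\<^bsub>Q\<^esub> q y" using assms M.meet_right[of x y] by (auto simp: quotient_biframe_def)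
qed

text \<open>Both directions are closure properties of the congruence: meeting the relation for the
  join with \<open>a\<close> gives the relation for \<open>a\<close>, and joining the relations for
  all \<open>a\<close> gives back the one for the join, by distributivity.\<close>

lemma quotient_sup_le_iff:
  assumes A: "A \<subseteq> carrier M" and z: "z \<in> carrier M"
  shows "q (\<Squnion>\<^bsub>M\<^esub>A) \<sqsubseteq>\<^bsub>Q\<^esub> q z \<longleftrightarrow> (\<forall>a\<in>A. q a \<sqsubseteq>\<^bsub>Q\<^esub> q z)"
proof
  assume "q (\<Squnion>\<^bsub>M\<^esub>A) \<sqsubseteq>\<^bsub>Q\<^esub> q z"
  then have le: "(\<Squnion>\<^bsub>M\<^esub>A \<sqinter>\<^bsub>M\<^esub> z, \<Squnion>\<^bsub>M\<^esub>A) \<in> \<Theta>" using A z by (simp add: quotient_le_iff)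
  show "\<forall>a\<in>A. q a \<sqsubseteq>\<^bsub>Q\<^esub> q z"
  proof
    fix a assume a: "a \<in> A"
    then have ac: "a \<in> carrier M" and eq: "a \<sqinter>\<^bsub>M\<^esub> \<Squnion>\<^bsub>M\<^esub>A = a"
      using A M.sup_upper[OF A a] by (auto intro: M.meet_absorb)
    have "(a \<sqinter>\<^bsub>M\<^esub> (\<Squnion>\<^bsub>M\<^esub>A \<sqinter>\<^bsub>M\<^esub> z), a \<sqinter>\<^bsub>M\<^esub> \<Squnion>\<^bsub>M\<^esub>A) \<in> \<Theta>"
      by (rule congruence_meet[OF congruence_refl[OF ac] le])
    then have "(a \<sqinter>\<^bsub>M\<^esub> z, a) \<in> \<Theta>" using ac A z by (simp add: eq flip: M.meet_assoc)
    then show "q a \<sqsubseteq>\<^bsub>Q\<^esub> q z" using ac z by (simp add: quotient_le_iff)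
  qed
next
  assume le: "\<forall>a\<in>A. q a \<sqsubseteq>\<^bsub>Q\<^esub> q z"
  let ?B = "(\<lambda>a. (z \<sqinter>\<^bsub>M\<^esub> a, a)) ` A"
  have "?B \<subseteq> \<Theta>"
    using le A z quotient_le_iff by (auto simp: subset_iff meet_comm[of M z])
  then have "(\<Squnion>\<^bsub>M\<^esub>(fst ` ?B), \<Squnion>\<^bsub>M\<^esub>(snd ` ?B)) \<in> \<Theta>" by (rule congruence_sup)
  then have "(z \<sqinter>\<^bsub>M\<^esub> \<Squnion>\<^bsub>M\<^esub>A, \<Squnion>\<^bsub>M\<^esub>A) \<in> \<Theta>" using A z by (simp add: image_image M.meet_Sup_distrib)
  then show "q (\<Squnion>\<^bsub>M\<^esub>A) \<sqsubseteq>\<^bsub>Q\<^esub> q z" using A z by (simp add: quotient_le_iff meet_comm)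
qed

lemma le_quotient_meet_iff:
  assumes "x \<in> carrier M" "y \<in> carrier M" "z \<in> carrier M"
  shows "q z \<sqsubseteq>\<^bsub>Q\<^esub> q (x \<sqinter>\<^bsub>M\<^esub> y) \<longleftrightarrow> q z \<sqsubseteq>\<^bsub>Q\<^esub> q x \<and> q z \<sqsubseteq>\<^bsub>Q\<^esub> q y"
proof -
  have "(z \<sqinter>\<^bsub>M\<^esub> (x \<sqinter>\<^bsub>M\<^esub> y), z) \<in> \<Theta> \<longleftrightarrow> (z \<sqinter>\<^bsub>M\<^esub> x, z) \<in> \<Theta> \<and> (z \<sqinter>\<^bsub>M\<^esub> y, z) \<in> \<Theta>" (is "?l \<longleftrightarrow> ?x \<and> ?y")
  proof (intro iffI conjI)
    assume l: ?l
    have "(x \<sqinter>\<^bsub>M\<^esub> (z \<sqinter>\<^bsub>M\<^esub> (x \<sqinter>\<^bsub>M\<^esub> y)), x \<sqinter>\<^bsub>M\<^esub> z) \<in> \<Theta>" "(y \<sqinter>\<^bsub>M\<^esub> (z \<sqinter>\<^bsub>M\<^esub> (x \<sqinter>\<^bsub>M\<^esub> y)), y \<sqinter>\<^bsub>M\<^esub> z) \<in> \<Theta>"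
      using congruence_meet[OF congruence_refl l] assms by blast+
    moreover have "x \<sqinter>\<^bsub>M\<^esub> (z \<sqinter>\<^bsub>M\<^esub> (x \<sqinter>\<^bsub>M\<^esub> y)) = z \<sqinter>\<^bsub>M\<^esub> (x \<sqinter>\<^bsub>M\<^esub> y)"
      "y \<sqinter>\<^bsub>M\<^esub> (z \<sqinter>\<^bsub>M\<^esub> (x \<sqinter>\<^bsub>M\<^esub> y)) = z \<sqinter>\<^bsub>M\<^esub> (x \<sqinter>\<^bsub>M\<^esub> y)"
      using assms by (metis M.meet_assoc M.meet_closed M.meet_idem M.meet_left_commute)+
    ultimately show ?x ?y
      using l congruence_trans congruence_sym by (metis meet_comm)+
  next
    assume xy: "?x \<and> ?y"
    then have "((z \<sqinter>\<^bsub>M\<^esub> x) \<sqinter>\<^bsub>M\<^esub> (z \<sqinter>\<^bsub>M\<^esub> y), z \<sqinter>\<^bsub>M\<^esub> z) \<in> \<Theta>" using congruence_meet by blast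
    moreover have "(z \<sqinter>\<^bsub>M\<^esub> x) \<sqinter>\<^bsub>M\<^esub> (z \<sqinter>\<^bsub>M\<^esub> y) = z \<sqinter>\<^bsub>M\<^esub> (x \<sqinter>\<^bsub>M\<^esub> y)"
      using assms by (metis M.meet_assoc M.meet_closed M.meet_idem M.meet_left_commute)
    ultimately show ?l using assms by (simp add: M.meet_idem)
  qed
  then show ?thesis using assms by (simp add: quotient_le_iff)
qed

lemma quotient_frame:
  shows "frame Q"
    and "A \<subseteq> carrier M \<Longrightarrow> \<Squnion>\<^bsub>Q\<^esub>(q ` A) = q (\<Squnion>\<^bsub>M\<^esub>A)"
    and "x \<in> carrier M \<Longrightarrow> y \<in> carrier M \<Longrightarrow> q x \<sqinter>\<^bsub>Q\<^esub> q y = q (x \<sqinter>\<^bsub>M\<^esub> y)"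
proof -
  \<comment> \<open>Representatives turn joins and meets into functions on classes, as
    \<open>frame_of_operations\<close> requires; \<open>S_q\<close> and \<open>m_q\<close> later
    show that the choice does not matter.\<close>
  define rep where "rep X = (SOME x. x \<in> carrier M \<and> q x = X)" for X
  have rep: "rep X \<in> carrier M" "q (rep X) = X" if "X \<in> carrier Q" for X
    using someI_ex[of "\<lambda>x. x \<in> carrier M \<and> q x = X"] that unfolding carrier_quotient rep_def by blast+
  have q_closed: "q x \<in> carrier Q" if "x \<in> carrier M" for x using that by (simp add: carrier_quotient)
  define S where "S A = q (\<Squnion>\<^bsub>M\<^esub>(rep ` A))" for A
  define m where "m X Y = q (rep X \<sqinter>\<^bsub>M\<^esub> rep Y)" for X Y
  have repA: "rep ` A \<subseteq> carrier M" if "A \<subseteq> carrier Q" for A using rep(1) that by blast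
  have S_closed: "S A \<in> carrier Q" if "A \<subseteq> carrier Q" for A
    unfolding S_def using repA[OF that] by (intro q_closed M.sup_closed)
  have m_closed: "m X Y \<in> carrier Q" if "X \<in> carrier Q" "Y \<in> carrier Q" for X Y
    unfolding m_def using rep that by (intro q_closed M.meet_closed)
  have eq: "eq Q = (=)" by (simp add: quotient_biframe_def)
  have refl: "X \<sqsubseteq>\<^bsub>Q\<^esub> X" if "X \<in> carrier Q" for X
    using quotient_le_iff[of "rep X" "rep X"] rep[OF that] congruence_refl by (simp add: M.meet_idem)
  have antisym: "X = Y" if "X \<in> carrier Q" "Y \<in> carrier Q" "X \<sqsubseteq>\<^bsub>Q\<^esub> Y" "Y \<sqsubseteq>\<^bsub>Q\<^esub> X" for X Y
  proof -
    note r = rep[OF that(1)] rep[OF that(2)]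
    have "(rep X \<sqinter>\<^bsub>M\<^esub> rep Y, rep X) \<in> \<Theta>" "(rep X \<sqinter>\<^bsub>M\<^esub> rep Y, rep Y) \<in> \<Theta>"
      using quotient_le_iff[of "rep X" "rep Y"] quotient_le_iff[of "rep Y" "rep X"] r that(3,4)
      by (simp_all add: meet_comm[of M "rep Y"])
    then have "(rep X, rep Y) \<in> \<Theta>" using congruence_sym congruence_trans by blast
    then show ?thesis using quotient_map_eq_iff[of "rep X" "rep Y"] r by simp
  qed
  have trans: "X \<sqsubseteq>\<^bsub>Q\<^esub> Z"
    if "X \<in> carrier Q" "Y \<in> carrier Q" "Z \<in> carrier Q" "X \<sqsubseteq>\<^bsub>Q\<^esub> Y" "Y \<sqsubseteq>\<^bsub>Q\<^esub> Z" for X Y Z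
  proof -
    note r = rep[OF that(1)] rep[OF that(2)] rep[OF that(3)]
    have xy: "(rep X \<sqinter>\<^bsub>M\<^esub> rep Y, rep X) \<in> \<Theta>" and yz: "(rep Y \<sqinter>\<^bsub>M\<^esub> rep Z, rep Y) \<in> \<Theta>"
      using quotient_le_iff[of "rep X" "rep Y"] quotient_le_iff[of "rep Y" "rep Z"] r that(4,5) by simp_all
    have "(rep X \<sqinter>\<^bsub>M\<^esub> (rep Y \<sqinter>\<^bsub>M\<^esub> rep Z), rep X \<sqinter>\<^bsub>M\<^esub> rep Y) \<in> \<Theta>"
      by (rule congruence_meet[OF congruence_refl[OF r(1)] yz])
    then have 1: "(rep X \<sqinter>\<^bsub>M\<^esub> (rep Y \<sqinter>\<^bsub>M\<^esub> rep Z), rep X) \<in> \<Theta>" using xy congruence_trans by blast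
    have "((rep X \<sqinter>\<^bsub>M\<^esub> rep Y) \<sqinter>\<^bsub>M\<^esub> rep Z, rep X \<sqinter>\<^bsub>M\<^esub> rep Z) \<in> \<Theta>"
      by (rule congruence_meet[OF xy congruence_refl[OF r(5)]])
    then have "(rep X \<sqinter>\<^bsub>M\<^esub> rep Z, rep X) \<in> \<Theta>"
      using 1 r congruence_sym congruence_trans by (metis M.meet_assoc)
    then show ?thesis using quotient_le_iff[of "rep X" "rep Z"] r by simp
  qed
  have lub: "S A \<sqsubseteq>\<^bsub>Q\<^esub> Z \<longleftrightarrow> (\<forall>a\<in>A. a \<sqsubseteq>\<^bsub>Q\<^esub> Z)" if A: "A \<subseteq> carrier Q" and Z: "Z \<in> carrier Q" for A Z
    using quotient_sup_le_iff[OF repA[OF A] rep(1)[OF Z]] rep(2)[OF Z] rep(2)[OF subsetD[OF A]]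
    unfolding S_def by simp
  have glb: "Z \<sqsubseteq>\<^bsub>Q\<^esub> m X Y \<longleftrightarrow> Z \<sqsubseteq>\<^bsub>Q\<^esub> X \<and> Z \<sqsubseteq>\<^bsub>Q\<^esub> Y"
    if "X \<in> carrier Q" "Y \<in> carrier Q" "Z \<in> carrier Q" for X Y Z
    using le_quotient_meet_iff[of "rep X" "rep Y" "rep Z"] rep that unfolding m_def by simp
  have q_mono: "q x \<sqsubseteq>\<^bsub>Q\<^esub> q y" if "x \<sqsubseteq>\<^bsub>M\<^esub> y" "x \<in> carrier M" "y \<in> carrier M" for x y
    using that congruence_refl by (simp add: quotient_le_iff M.meet_absorb)
  have S_q: "S (q ` A) = q (\<Squnion>\<^bsub>M\<^esub>A)" if A: "A \<subseteq> carrier M" for A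
  proof (rule antisym)
    have qA: "q ` A \<subseteq> carrier Q" using A q_closed by blast
    show "S (q ` A) \<in> carrier Q" by (rule S_closed[OF qA])
    show c: "q (\<Squnion>\<^bsub>M\<^esub>A) \<in> carrier Q" using A by (intro q_closed M.sup_closed)
    show "S (q ` A) \<sqsubseteq>\<^bsub>Q\<^esub> q (\<Squnion>\<^bsub>M\<^esub>A)"
      unfolding lub[OF qA c] using A q_mono[OF M.sup_upper[OF A]] by auto
    have "q a \<sqsubseteq>\<^bsub>Q\<^esub> S (q ` A)" if "a \<in> A" for a
      using lub[OF qA S_closed[OF qA]] refl[OF S_closed[OF qA]] that by blast
    then show "q (\<Squnion>\<^bsub>M\<^esub>A) \<sqsubseteq>\<^bsub>Q\<^esub> S (q ` A)"
      using quotient_sup_le_iff[OF A M.sup_closed[OF repA[OF qA]]] unfolding S_def by simp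
  qed
  have m_q: "m (q x) (q y) = q (x \<sqinter>\<^bsub>M\<^esub> y)" if x: "x \<in> carrier M" and y: "y \<in> carrier M" for x y
  proof -
    have "(rep (q x), x) \<in> \<Theta>" "(rep (q y), y) \<in> \<Theta>"
      using rep[OF q_closed[OF x]] rep[OF q_closed[OF y]] x y quotient_map_eq_iff by blast+
    then have "(rep (q x) \<sqinter>\<^bsub>M\<^esub> rep (q y), x \<sqinter>\<^bsub>M\<^esub> y) \<in> \<Theta>" by (rule congruence_meet)
    then show ?thesis unfolding m_def using congruence_carrier quotient_map_eq_iff by blast
  qed
  have distrib: "m X (S A) \<sqsubseteq>\<^bsub>Q\<^esub> S (m X ` A)" if X: "X \<in> carrier Q" and A: "A \<subseteq> carrier Q" for X A
  proof -
    note x = rep[OF X]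
    have c: "\<Squnion>\<^bsub>M\<^esub>(rep ` A) \<in> carrier M" "(\<lambda>a. rep X \<sqinter>\<^bsub>M\<^esub> a) ` rep ` A \<subseteq> carrier M"
      using repA[OF A] x by auto
    have "m X (S A) = q (rep X \<sqinter>\<^bsub>M\<^esub> \<Squnion>\<^bsub>M\<^esub>(rep ` A))"
      using m_q[OF x(1) c(1)] x(2) unfolding S_def by simp
    also have "\<dots> = q (\<Squnion>\<^bsub>M\<^esub>((\<lambda>a. rep X \<sqinter>\<^bsub>M\<^esub> a) ` rep ` A))"
      using x repA[OF A] by (simp add: M.meet_Sup_distrib)
    also have "\<dots> = S (q ` (\<lambda>a. rep X \<sqinter>\<^bsub>M\<^esub> a) ` rep ` A)" by (rule S_q[OF c(2), symmetric])
    also have "q ` (\<lambda>a. rep X \<sqinter>\<^bsub>M\<^esub> a) ` rep ` A = m X ` A" by (simp add: image_image m_def)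
    finally have "m X (S A) = S (m X ` A)" .
    moreover have "m X ` A \<subseteq> carrier Q" by (intro image_subsetI m_closed[OF X subsetD[OF A]])
    ultimately show ?thesis using refl[OF S_closed] by simp
  qed
  note ops = frame_of_operations[of Q S m, OF eq]
  note facts = refl antisym trans S_closed lub m_closed glb distrib
  show "frame Q" by (rule ops(1); rule facts; assumption)
  have sup: "\<Squnion>\<^bsub>Q\<^esub>A = S A" if "A \<subseteq> carrier Q" for A
    by (rule ops(2); (rule that | rule facts; assumption))
  have meet: "X \<sqinter>\<^bsub>Q\<^esub> Y = m X Y" if "X \<in> carrier Q" "Y \<in> carrier Q" for X Y
    by (rule ops(3); (rule that | rule facts; assumption))
  show "\<Squnion>\<^bsub>Q\<^esub>(q ` A) = q (\<Squnion>\<^bsub>M\<^esub>A)" if A: "A \<subseteq> carrier M"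
  proof -
    have "q ` A \<subseteq> carrier Q" using A by (auto intro: q_closed)
    then show ?thesis by (simp only: sup S_q[OF A])
  qed
  show "q x \<sqinter>\<^bsub>Q\<^esub> q y = q (x \<sqinter>\<^bsub>M\<^esub> y)" if "x \<in> carrier M" "y \<in> carrier M"
    using m_q[OF that] meet[OF q_closed[OF that(1)] q_closed[OF that(2)]] by simp
qed

lemma quotient_frame_hom: "frame_hom M Q q"
proof -
  interpret Q: frame Q by (rule quotient_frame)
  have "q \<top>\<^bsub>M\<^esub> = \<top>\<^bsub>Q\<^esub>"
  proof (rule Q.top_eqI[symmetric])
    fix X assume "X \<in> carrier Q"
    then obtain x where x: "x \<in> carrier M" "X = q x" unfolding carrier_quotient by blast
    then show "X \<sqsubseteq>\<^bsub>Q\<^esub> q \<top>\<^bsub>M\<^esub>" by (simp add: quotient_le_iff M.meet_top congruence_refl)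
  qed (simp add: carrier_quotient)
  then show ?thesis
    unfolding frame_hom_def using quotient_frame by (simp add: carrier_quotient)
qed

lemma quotient_part [simp]: "part i Q = q ` part i M"
  by (simp add: part_def quotient_biframe_def)

lemma quotient_biframe: "biframe Q"
proof -
  interpret Q: frame Q by (rule quotient_frame)
  have sub: "subframe (part i Q) Q" for i
    using subframe_image[OF M.frame_axioms Q.frame_axioms quotient_frame_hom M.subframe_part] by simp
  show ?thesis
  proof unfold_locales
    show "subframe (part1 Q) Q" "subframe (part2 Q) Q"
      using sub[of True] sub[of False] by (simp_all only: part_def if_True if_False)
    fix S assume S: "subframe S Q" "part1 Q \<union> part2 Q \<subseteq> S"
    have "q ` part1 M \<subseteq> S" "q ` part2 M \<subseteq> S" using S(2) by (simp_all add: quotient_biframe_def)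
    then have "part1 M \<union> part2 M \<subseteq> {x \<in> carrier M. q x \<in> S}"
      using M.part_subset[of True] M.part_subset[of False] by (auto simp: part_def)
    then have "{x \<in> carrier M. q x \<in> S} = carrier M"
      by (rule M.generated[OF subframe_preimage[OF M.frame_axioms Q.frame_axioms quotient_frame_hom S(1)]])
    then have "carrier Q \<subseteq> S" unfolding carrier_quotient by blast
    then show "S = carrier Q" using Q.subframeD(1)[OF S(1)] by blast
  qed
qed

lemma quotient_biframe_hom: "biframe_hom M Q q" "surjective_hom M Q q"
  using quotient_frame_hom by (simp_all add: biframe_hom_def surjective_hom_def quotient_biframe_def)

text \<open>The value is read off from a chosen representative of the class, which is meaningful
  when \<open>h\<close> is constant on classes, as in \<open>factor_quotient_map\<close>.\<close>

definition factor :: "('a \<Rightarrow> 'b) \<Rightarrow> 'a set \<Rightarrow> 'b" where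
  "factor h X = h (SOME x. x \<in> X)"

lemma factor_quotient_map:
  assumes "\<And>x y. (x, y) \<in> \<Theta> \<Longrightarrow> h x = h y" "x \<in> carrier M"
  shows "factor h (q x) = h x"
proof -
  have "x \<in> q x" using assms(2) by (simp add: mem_quotient_map congruence_refl)
  then have "(SOME y. y \<in> q x) \<in> q x" by (rule someI)
  then show ?thesis using assms(1) by (simp add: factor_def mem_quotient_map)
qed

lemma factor_dense_surjection:
  assumes "dense_surjection M L h" and kernel: "\<And>x y. (x, y) \<in> \<Theta> \<Longrightarrow> h x = h y"
  shows "dense_surjection Q L (factor h)"
proof -
  interpret h: dense_surjection M L h by fact
  interpret Q: biframe Q by (rule quotient_biframe)
  note fq = factor_quotient_map[of h, OF kernel]
  note q_hom = quotient_frame_hom[unfolded frame_hom_def]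
  have "frame_hom Q L (factor h)"
    unfolding frame_hom_def
  proof (intro conjI ballI allI impI)
    show "factor h \<in> carrier Q \<rightarrow> carrier L" by (auto simp: carrier_quotient fq)
    show "factor h \<top>\<^bsub>Q\<^esub> = \<top>\<^bsub>L\<^esub>" using fq[of "\<top>\<^bsub>M\<^esub>"] q_hom by simp
    show "factor h (X \<sqinter>\<^bsub>Q\<^esub> Y) = factor h X \<sqinter>\<^bsub>L\<^esub> factor h Y" if "X \<in> carrier Q" "Y \<in> carrier Q" for X Y
      using that by (auto simp: carrier_quotient fq quotient_frame(3))
    show "factor h (\<Squnion>\<^bsub>Q\<^esub>A) = \<Squnion>\<^bsub>L\<^esub>(factor h ` A)" if A: "A \<subseteq> carrier Q" for A
    proof -
      obtain B where B: "B \<subseteq> carrier M" "A = q ` B"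
        using A unfolding carrier_quotient by (rule subset_imageE)
      have "factor h ` A = h ` B"
        unfolding B(2) image_image by (intro image_cong HOL.refl fq subsetD[OF B(1)])
      then show ?thesis using B by (simp add: quotient_frame(2) fq h.h_sup)
    qed
  qed
  moreover have img: "factor h ` q ` part i M = part i L" for i
  proof -
    have "factor h ` q ` part i M = h ` part i M"
      unfolding image_image by (intro image_cong HOL.refl fq M.part_carrier)
    then show ?thesis by (simp add: h.h_part)
  qed
  moreover have "dense_hom Q L (factor h)"
    unfolding dense_hom_def carrier_quotient
    using fq h.h_eq_bottom_iff q_hom quotient_frame(2)[of "{}"] by (auto simp: M.sup_empty Q.sup_empty)
  ultimately show ?thesis
    using img[of True] img[of False]
    by unfold_locales (simp_all add: biframe_hom_def surjective_hom_def part_def quotient_biframe_def)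
qed

end

section \<open>The bicompletion as a quotient of the Samuel compactification\<close>

text \<open>What the argument takes from the Samuel compactification: covers of M map to covers of
  L, every finite uniform cover of L contains the image of a cover of M, and M is bicomplete at the
  type that carries its closed sets.\<close>

locale samuel = qu_dense_surjection M L h + L: qu_biframe L
  for M :: "'b qubiframe" and L :: "'a qubiframe" and h +
  assumes image_quni: "\<And>V. V \<in> quni M \<Longrightarrow> image_cover L h V \<in> quni L"
    and finite_base: "\<And>W. \<lbrakk>W \<in> quni L; finitely_generated L W\<rbrakk> \<Longrightarrow> \<exists>V\<in>quni M. image_cover L h V \<subseteq> W"
    and bicomplete_M: "bicomplete TYPE(('b \<times> 'b) set) M"
begin

text \<open>The two pairs \<open>(u, \<top>)\<close> and \<open>(\<top>, y)\<close>, where \<open>y\<close> is the largest element of the other part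
  disjoint from \<open>u'\<close>, generate a uniform cover whose star at \<open>u'\<close> is below \<open>u\<close>. Hence the relation
  of being uniformly below does not change under the totally bounded coreflection.\<close>

lemma below_finite_cover:
  assumes "below i L u' u" "u \<in> part i L"
  obtains W where "W \<in> quni L" "finitely_generated L W" "star i L u' W \<sqsubseteq>\<^bsub>L\<^esub> u"
proof -
  obtain U where U: "U \<in> quni L" "star i L u' U \<sqsubseteq>\<^bsub>L\<^esub> u" and u': "u' \<in> part i L"
    using assms(1) unfolding below_def by blast
  let ?A = "{v \<in> part (\<not> i) L. u' \<sqinter>\<^bsub>L\<^esub> v = \<bottom>\<^bsub>L\<^esub>}"
  define y where "y = \<Squnion>\<^bsub>L\<^esub>?A"
  have A: "?A \<subseteq> part (\<not> i) L" "?A \<subseteq> carrier L" by auto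
  have y: "y \<in> part (\<not> i) L" unfolding y_def by (rule L.part_sup[OF A(1)])
  have u'c: "u' \<in> carrier L" using u' by simp
  have "u' \<sqinter>\<^bsub>L\<^esub> y \<sqsubseteq>\<^bsub>L\<^esub> \<bottom>\<^bsub>L\<^esub>"
    unfolding y_def using A(2) u'c by (subst L.meet_sup_le_iff) auto
  then have disjoint: "u' \<sqinter>\<^bsub>L\<^esub> y = \<bottom>\<^bsub>L\<^esub>" using u'c y by (simp add: L.le_bottom_iff)
  let ?p = "generator L i u" and ?r = "generator L (\<not> i) y"
  have r: "component (\<not> i) ?r = y" "component i ?r = \<top>\<^bsub>L\<^esub>"
    using component_generator[of "\<not> i" L y] by simp_all
  have pr: "{?p, ?r} \<subseteq> pairs L" using assms(2) y by (simp add: L.generator_pairs)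
  define W where "W = down L {?p, ?r}"
  have UW: "U \<subseteq> W"
  proof
    \<comment> \<open>Either the other component of \<open>w\<close> misses \<open>u'\<close> and so
      lies under \<open>y\<close>, or the i-th component is a joinand of the star of
      \<open>u'\<close> and so lies under \<open>u\<close>.\<close>
    fix w assume w: "w \<in> U"
    then have wp: "w \<in> pairs L" using U L.quni_pairs by blast
    have "\<exists>s\<in>{?p, ?r}. \<forall>j. component j w \<sqsubseteq>\<^bsub>L\<^esub> component j s"
    proof (cases "u' \<sqinter>\<^bsub>L\<^esub> component (\<not> i) w = \<bottom>\<^bsub>L\<^esub>")
      case True
      then have "component (\<not> i) w \<sqsubseteq>\<^bsub>L\<^esub> y"
        unfolding y_def using wp by (intro L.sup_upper[OF A(2)]) (simp add: pairsD)
      then have "component j w \<sqsubseteq>\<^bsub>L\<^esub> component j ?r" for j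
        using wp r by (cases "j = i") simp_all
      then show ?thesis by blast
    next
      case False
      then have "component i w \<sqsubseteq>\<^bsub>L\<^esub> star i L u' U"
        using w U by (intro L.star_upper L.quni_subset)
      then have "component i w \<sqsubseteq>\<^bsub>L\<^esub> u"
        using U assms(2) wp by (meson L.le_trans L.pairs_carrier L.part_carrier L.star_quni_part)
      then have "component j w \<sqsubseteq>\<^bsub>L\<^esub> component j ?p" for j
        using wp by (cases "j = i") simp_all
      then show ?thesis by blast
    qed
    then show "w \<in> W" unfolding W_def mem_down_iff using wp by blast
  qed
  have Wp: "W \<subseteq> pairs L" unfolding W_def by (rule L.down_subset)
  have "pairs_join L U \<sqsubseteq>\<^bsub>L\<^esub> pairs_join L W"
    using UW Wp L.wedge_le_pairs_join[OF Wp] by (subst L.pairs_join_le_iff) (auto simp: L.quni_subset[OF U(1)])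
  then have "pairs_join L W = \<top>\<^bsub>L\<^esub>" using Wp by (simp add: L.quni_join[OF U(1)] L.top_le_iff)
  then have "paircover L W" using Wp L.down_down[OF pr] by (simp add: L.paircover_iff W_def)
  then have "W \<in> quni L" using UW U L.quni_upward by blast
  moreover have "finitely_generated L W"
    unfolding finitely_generated_def W_def using pr by (intro exI[of _ "{?p, ?r}"]) (simp add: pairs_def)
  moreover have "star i L u' W \<sqsubseteq>\<^bsub>L\<^esub> u"
  proof -
    have "component i w \<sqsubseteq>\<^bsub>L\<^esub> u" if w: "w \<in> W" "u' \<sqinter>\<^bsub>L\<^esub> component (\<not> i) w \<noteq> \<bottom>\<^bsub>L\<^esub>" for w
    proof -
      have wp: "w \<in> pairs L" using w Wp by blast
      \<comment> \<open>A pair of W that meets \<open>u'\<close> cannot lie under the generator of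
        \<open>y\<close>, which is disjoint from \<open>u'\<close>; so it lies under the generator
        of \<open>u\<close>.\<close>
      have "\<not> component (\<not> i) w \<sqsubseteq>\<^bsub>L\<^esub> y"
      proof
        assume "component (\<not> i) w \<sqsubseteq>\<^bsub>L\<^esub> y"
        then have "u' \<sqinter>\<^bsub>L\<^esub> component (\<not> i) w \<sqsubseteq>\<^bsub>L\<^esub> u' \<sqinter>\<^bsub>L\<^esub> y"
          using u'c y wp by (intro L.meet_mono) simp_all
        then show False using w(2) disjoint u'c wp by (simp add: L.le_bottom_iff)
      qed
      moreover have "(\<forall>j. component j w \<sqsubseteq>\<^bsub>L\<^esub> component j ?p) \<or> (\<forall>j. component j w \<sqsubseteq>\<^bsub>L\<^esub> component j ?r)"
        using w(1) unfolding W_def mem_down_iff by blast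
      ultimately have "component i w \<sqsubseteq>\<^bsub>L\<^esub> component i ?p" using r(1) by metis
      then show ?thesis by simp
    qed
    then show ?thesis using Wp assms(2) by (simp add: L.star_le_iff)
  qed
  ultimately show thesis by (rule that)
qed

text \<open>A finite cover W witnessing the relation in L contains the image of a cover V of M. By
  density a pair of V meeting \<open>adj i u'\<close> has an image meeting \<open>u'\<close>, so the
  i-th component of the image lies under \<open>u\<close>, and that of the pair under
  \<open>adj i u\<close>. Finiteness of W is what makes V available.\<close>

lemma below_adj:
  assumes "below i L u' u" "u \<in> part i L"
  shows "below i M (adj i u') (adj i u)"
proof -
  have u': "u' \<in> part i L" using assms(1) below_part by metis
  obtain W where W: "W \<in> quni L" "finitely_generated L W" "star i L u' W \<sqsubseteq>\<^bsub>L\<^esub> u"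
    using below_finite_cover assms by blast
  obtain V where V: "V \<in> quni M" "image_cover L h V \<subseteq> W" using finite_base W by blast
  have "component i v \<sqsubseteq>\<^bsub>M\<^esub> adj i u"
    if v: "v \<in> V" "adj i u' \<sqinter>\<^bsub>M\<^esub> component (\<not> i) v \<noteq> \<bottom>\<^bsub>M\<^esub>" for v
  proof -
    have vp: "v \<in> pairs M" using v V M.quni_pairs by blast
    have "h (adj i u' \<sqinter>\<^bsub>M\<^esub> component (\<not> i) v) \<noteq> \<bottom>\<^bsub>L\<^esub>"
      using v(2) vp u' h_eq_bottom_iff[of "adj i u' \<sqinter>\<^bsub>M\<^esub> component (\<not> i) v"] by simp
    then have n: "u' \<sqinter>\<^bsub>L\<^esub> component (\<not> i) (map_prod h h v) \<noteq> \<bottom>\<^bsub>L\<^esub>" using vp u' by simp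
    have "map_prod h h v \<in> image_cover L h V"
      unfolding mem_image_cover_iff using v vp by (auto intro!: bexI[of _ v])
    then have "component i (map_prod h h v) \<sqsubseteq>\<^bsub>L\<^esub> star i L u' W"
      using V(2) W n by (intro L.star_upper L.quni_subset) blast+
    then have "h (component i v) \<sqsubseteq>\<^bsub>L\<^esub> u"
      using W assms(2) vp
      by (simp, meson L.le_trans L.part_carrier L.star_quni_part M.pairs_carrier h_closed)
    then show ?thesis using vp assms(2) by (simp add: le_adj_iff pairsD)
  qed
  then have "star i M (adj i u') V \<sqsubseteq>\<^bsub>M\<^esub> adj i u"
    using V assms(2) by (subst M.star_le_iff) (simp_all add: M.quni_subset)
  then show ?thesis unfolding below_def using V u' by auto
qed

text \<open>Testing the pairs uniformly below \<open>p\<close>, and not \<open>p\<close> itself,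
  builds the approximation clause into the set: the plain preimage of D under h \<times> h is
  contained in it but need not be closed.\<close>

definition pullback :: "('a \<times> 'a) set \<Rightarrow> ('b \<times> 'b) set" where
  "pullback D = {p \<in> pairs M. \<forall>q\<in>pairs M. (\<forall>i. below i M (component i q) (component i p)) \<longrightarrow> map_prod h h q \<in> D}"

lemma pullbackI:
  assumes "p \<in> pairs M"
    and "\<And>q. \<lbrakk>q \<in> pairs M; \<And>i. below i M (component i q) (component i p)\<rbrakk> \<Longrightarrow> map_prod h h q \<in> D"
  shows "p \<in> pullback D"
  using assms unfolding pullback_def by blast

lemma pullbackD:
  "\<lbrakk>p \<in> pullback D; q \<in> pairs M; \<And>i. below i M (component i q) (component i p)\<rbrakk> \<Longrightarrow> map_prod h h q \<in> D"
  unfolding pullback_def by blast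

text \<open>The approximation clause comes from interpolation in M. The cover clause needs a star
  refinement, because membership is tested only on pairs uniformly below the given one.\<close>

lemma uclosed_pullback:
  assumes D: "uclosed L D"
  shows "uclosed M (pullback D)"
proof (rule uclosedI)
  show "pullback D \<subseteq> pairs M" unfolding pullback_def by (rule Collect_restrict)
next
  fix p p' assume p: "p \<in> pairs M" and p': "p' \<in> pullback D" and le: "\<And>i. component i p \<sqsubseteq>\<^bsub>M\<^esub> component i p'"
  have pp': "p' \<in> pairs M" using p' by (simp add: pullback_def)
  show "p \<in> pullback D"
  proof (rule pullbackI[OF p])
    fix q assume q: "q \<in> pairs M" and b: "\<And>i. below i M (component i q) (component i p)"
    show "map_prod h h q \<in> D"
      using M.below_mono_right[OF b le] p pp' by (intro pullbackD[OF p' q]) simp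
  qed
next
  fix p assume p: "p \<in> pairs M" "wedge M p = \<bottom>\<^bsub>M\<^esub>"
  show "p \<in> pullback D"
  proof (rule pullbackI[OF p(1)])
    fix q assume q: "q \<in> pairs M" and b: "\<And>i. below i M (component i q) (component i p)"
    have "wedge M q \<sqsubseteq>\<^bsub>M\<^esub> wedge M p" using p q M.below_le[OF b] by (intro M.wedge_mono) simp_all
    then have "wedge M q = \<bottom>\<^bsub>M\<^esub>" using p q by (simp add: M.le_bottom_iff)
    then have "wedge L (map_prod h h q) = \<bottom>\<^bsub>L\<^esub>" using q by (simp flip: h_wedge)
    then show "map_prod h h q \<in> D" using q by (intro uclosedD(3)[OF D]) simp_all
  qed
next
  fix p assume p: "p \<in> pairs M"
    and *: "\<And>r. \<lbrakk>r \<in> pairs M; \<And>i. below i M (component i r) (component i p)\<rbrakk> \<Longrightarrow> r \<in> pullback D"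
  show "p \<in> pullback D"
  proof (rule pullbackI[OF p])
    fix q assume q: "q \<in> pairs M" and b: "\<And>i. below i M (component i q) (component i p)"
    \<comment> \<open>Interpolating in each component produces a pair strictly in between: it
      belongs to the pullback by hypothesis, and \<open>q\<close> is uniformly below it.\<close>
    have "\<exists>z. below i M (component i q) z \<and> below i M z (component i p)" for i
      using M.below_interpolate[OF b[of i]] p by (metis M.pairs_carrier)
    then obtain z where z: "\<And>i. below i M (component i q) (z i)" "\<And>i. below i M (z i) (component i p)"
      by metis
    have r: "component i (z True, z False) = z i" for i by (cases i) simp_all
    have "(z True, z False) \<in> pairs M" using below_part[OF z(2)] by (simp add: mem_pairs_iff r)
    then have "(z True, z False) \<in> pullback D" using z(2) by (intro *) (simp_all add: r)
    then show "map_prod h h q \<in> D" using q by (rule pullbackD) (simp add: r z(1))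
  qed
next
  fix p W assume p: "p \<in> pairs M" and W: "W \<in> quni M" and *: "\<And>w. w \<in> W \<Longrightarrow> pair_meet M p w \<in> pullback D"
  show "p \<in> pullback D"
  proof (rule pullbackI[OF p])
    fix q assume q: "q \<in> pairs M" and b: "\<And>i. below i M (component i q) (component i p)"
    \<comment> \<open>For \<open>v\<close> in V the pair \<open>w\<close> of its stars lies in W and
      has \<open>v\<close> uniformly below it, so the meet of \<open>q\<close> and \<open>v\<close>
      is uniformly below that of \<open>p\<close> and \<open>w\<close>, and its image lies in D. The
      image of V is then the cover of L used for D.\<close>
    obtain V where V: "V \<in> quni M" "star_cover M V \<subseteq> W" using M.star_refinement W by blast
    show "map_prod h h q \<in> D"
    proof (rule uclosedD(5)[OF D _ image_quni[OF V(1)]])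
      show "map_prod h h q \<in> pairs L" using q by simp
      fix x assume "x \<in> image_cover L h V"
      then obtain v where v: "v \<in> V" "\<And>i. component i x \<sqsubseteq>\<^bsub>L\<^esub> h (component i v)" and x: "x \<in> pairs L"
        unfolding mem_image_cover_iff by blast
      have vp: "v \<in> pairs M" using v V M.quni_pairs by blast
      define w where "w = (star True M (fst v) V, star False M (snd v) V)"
      have w: "component i w = star i M (component i v) V" for i
        by (cases i) (simp_all add: w_def component_def)
      have wp: "w \<in> pairs M" using V by (simp add: mem_pairs_iff w)
      then have "w \<in> star_cover M V"
        unfolding mem_star_cover_iff using v(1) V(1)
        by (auto simp: w M.quni_subset intro!: bexI[of _ v])
      then have pw: "pair_meet M p w \<in> pullback D" using V(2) * by blast
      have "below i M (component i (pair_meet M q v)) (component i (pair_meet M p w))" for i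
      proof -
        have "below i M (component i v) (component i w)"
          unfolding below_def using vp V by (auto simp: w pairsD M.quni_subset intro!: bexI[of _ V])
        then show ?thesis using b[of i] p wp by (simp add: M.below_meet)
      qed
      then have "map_prod h h (pair_meet M q v) \<in> D" using q vp by (intro pullbackD[OF pw]) simp_all
      then show "pair_meet L (map_prod h h q) x \<in> D"
      proof (rule uclosedD(2)[OF D, rotated])
        show "component i (pair_meet L (map_prod h h q) x) \<sqsubseteq>\<^bsub>L\<^esub> component i (map_prod h h (pair_meet M q v))" for i
          using q vp x v(2)[of i] by (simp add: L.meet_mono)
        show "pair_meet L (map_prod h h q) x \<in> pairs L" using q x by simp
      qed
    qed
  qed
qed

text \<open>The witness is the join of the pullback, which is principal because M is bicomplete; it
  remains to see that a pair lies in D exactly when its lift lies in the pullback.\<close>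

lemma uclosed_eq_below:
  assumes D: "uclosed L D"
  obtains k where "k \<in> carrier M" "D = {p \<in> pairs L. wedge M (adj_pair p) \<sqsubseteq>\<^bsub>M\<^esub> k}"
proof -
  let ?k = "pairs_join M (pullback D)"
  have k: "?k \<in> carrier M" using M.uclosed_subset[OF uclosed_pullback[OF D]] by simp
  have P: "p \<in> pullback D \<longleftrightarrow> p \<in> pairs M \<and> wedge M p \<sqsubseteq>\<^bsub>M\<^esub> ?k" for p
    using M.uclosed_is_principal[OF bicomplete_M uclosed_pullback[OF D]] by blast
  have "p \<in> D \<longleftrightarrow> adj_pair p \<in> pullback D" if p: "p \<in> pairs L" for p
  proof
    assume pD: "p \<in> D"
    show "adj_pair p \<in> pullback D"
    proof (rule pullbackI)
      show "adj_pair p \<in> pairs M" using p by simp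
      fix q assume q: "q \<in> pairs M" and b: "\<And>i. below i M (component i q) (component i (adj_pair p))"
      have "component i (map_prod h h q) \<sqsubseteq>\<^bsub>L\<^esub> component i p" for i
        using M.below_le[OF b[of i]] q p by (simp add: le_adj_iff pairsD)
      then show "map_prod h h q \<in> D" using q by (intro uclosedD(2)[OF D _ pD]) simp_all
    qed
  next
    assume a: "adj_pair p \<in> pullback D"
    show "p \<in> D"
    proof (rule uclosedD(4)[OF D p])
      fix q assume q: "q \<in> pairs L" and b: "\<And>i. below i L (component i q) (component i p)"
      \<comment> \<open>By \<open>below_adj\<close> the lift of \<open>q\<close> is uniformly below
        the lift of \<open>p\<close>, so the pullback sends it back into D; its image is
        \<open>q\<close> itself.\<close>
      have "map_prod h h (adj_pair q) \<in> D"
        using q p below_adj[OF b] by (intro pullbackD[OF a]) (simp_all add: pairsD)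
      then show "q \<in> D" using q by simp
    qed
  qed
  note D_iff = this
  have "p \<in> D \<longleftrightarrow> p \<in> pairs L \<and> wedge M (adj_pair p) \<sqsubseteq>\<^bsub>M\<^esub> ?k" for p
  proof (cases "p \<in> pairs L")
    case True
    then show ?thesis by (simp add: D_iff P)
  next
    case False
    then show ?thesis using L.uclosed_subset[OF D] by blast
  qed
  then show thesis by (intro that[OF k]) blast
qed

section \<open>The congruence generated by the open congruences of the k_U\<close>

abbreviation "\<Theta> \<equiv> samuel_Theta M h L"
abbreviation "k U \<equiv> pairs_join M (lift_cover U)"

lemma samuel_K_eq: "samuel_K M h L U = lift_cover U"
proof -
  have "samuel_K M h L U = (\<Union>p\<in>U. down M {adj_pair p})"
    by (simp add: samuel_K_def adj_pair_def adj_def part_def case_prod_unfold)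
  also have "\<dots> = lift_cover U"
    by (rule Set.set_eqI) (simp add: mem_lift_cover_iff mem_down_iff)
  finally show ?thesis .
qed

lemma k_eq: "U \<in> quni L \<Longrightarrow> k U = pairs_join M (adj_pair ` U)"
  by (simp add: pairs_join_lift_cover L.quni_subset)

lemma adj_pair_image: "U \<in> quni L \<Longrightarrow> adj_pair ` U \<subseteq> pairs M"
  using L.quni_pairs by (intro image_subsetI adj_pair_pairs)

lemma k_closed: "U \<in> quni L \<Longrightarrow> k U \<in> carrier M"
  by (simp add: k_eq adj_pair_image)

lemma h_k: "U \<in> quni L \<Longrightarrow> h (k U) = \<top>\<^bsub>L\<^esub>"
proof -
  assume U: "U \<in> quni L"
  have "map_prod h h ` adj_pair ` U = U"
    unfolding image_image using L.quni_pairs[OF U] by (simp cong: image_cong_simp)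
  then show ?thesis using U by (simp add: k_eq h_pairs_join adj_pair_image L.quni_join)
qed

lemma Theta_eq: "\<Theta> = \<Inter>{\<Psi>. frame_congruence M \<Psi> \<and> (\<forall>U\<in>quni L. Delta M (k U) \<subseteq> \<Psi>)}"
proof -
  have "\<Theta> = \<Inter>{\<Psi>. frame_congruence M \<Psi> \<and> \<Union>((\<lambda>U. Delta M (k U)) ` quni L) \<subseteq> \<Psi>}"
    unfolding samuel_Theta_def samuel_K_eq
    by (rule M.sup_congruence_frame) (auto intro: M.frame_congruence_Delta k_closed)
  then show ?thesis by (simp add: UN_subset_iff)
qed

lemma frame_congruence_Theta: "frame_congruence M \<Theta>"
proof -
  have "Delta M (k U) \<subseteq> carrier M \<times> carrier M" for U by (auto simp: Delta_def)
  then show ?thesis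
    unfolding Theta_eq using M.frame_congruence_full by (intro M.frame_congruence_Inter) blast+
qed

lemma Delta_subset_Theta: "U \<in> quni L \<Longrightarrow> Delta M (k U) \<subseteq> \<Theta>"
  unfolding Theta_eq by blast

lemma Theta_least:
  "frame_congruence M \<Psi> \<Longrightarrow> (\<And>U. U \<in> quni L \<Longrightarrow> Delta M (k U) \<subseteq> \<Psi>) \<Longrightarrow> \<Theta> \<subseteq> \<Psi>"
  unfolding Theta_eq by blast

text \<open>The kernel of \<open>h\<close> is a frame congruence, and it contains each generating
  congruence because \<open>h\<close> maps k_U to 1. This is what lets \<open>h\<close> factor
  through the quotient.\<close>

lemma Theta_kernel:
  assumes "(x, y) \<in> \<Theta>"
  shows "h x = h y"
proof -
  have "frame_congruence M {(x, y) \<in> carrier M \<times> carrier M. h x = h y}"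
  proof (rule M.frame_congruence_kernel)
    show "h (\<Squnion>\<^bsub>M\<^esub>(fst ` A)) = h (\<Squnion>\<^bsub>M\<^esub>(snd ` A))"
      if A: "A \<subseteq> carrier M \<times> carrier M" "\<And>p. p \<in> A \<Longrightarrow> h (fst p) = h (snd p)" for A
    proof -
      have "fst ` A \<subseteq> carrier M" "snd ` A \<subseteq> carrier M" using A(1) by force+
      moreover have "h ` fst ` A = h ` snd ` A"
        unfolding image_image using A(2) by (intro image_cong HOL.refl)
      ultimately show ?thesis by (simp add: h_sup)
    qed
  qed simp
  moreover have "Delta M (k U) \<subseteq> {(x, y) \<in> carrier M \<times> carrier M. h x = h y}" if U: "U \<in> quni L" for U
  proof -
    have "h x = h y" if xy: "x \<in> carrier M" "y \<in> carrier M" "x \<sqinter>\<^bsub>M\<^esub> k U = y \<sqinter>\<^bsub>M\<^esub> k U" for x y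
    proof -
      have "h x \<sqinter>\<^bsub>L\<^esub> h (k U) = h y \<sqinter>\<^bsub>L\<^esub> h (k U)"
        using xy k_closed[OF U] by (metis h_meet)
      then show ?thesis using xy by (simp add: h_k[OF U] L.meet_top)
    qed
    then show ?thesis unfolding Delta_def by blast
  qed
  ultimately have "\<Theta> \<subseteq> {(x, y) \<in> carrier M \<times> carrier M. h x = h y}" by (rule Theta_least)
  then show ?thesis using assms by blast
qed

text \<open>The relation \<open>?\<Psi>\<close> is the largest frame congruence for which the
  principal downset of \<open>m\<close> is a union of classes. It therefore suffices that each
  generating congruence is contained in it, and this is where the cover clause for D enters.\<close>

lemma Theta_saturated:
  assumes D: "uclosed L D" and m: "m \<in> carrier M" "D = {p \<in> pairs L. wedge M (adj_pair p) \<sqsubseteq>\<^bsub>M\<^esub> m}"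
    and xy: "(x, y) \<in> \<Theta>" and x: "x \<sqsubseteq>\<^bsub>M\<^esub> m"
  shows "y \<sqsubseteq>\<^bsub>M\<^esub> m"
proof -
  let ?\<phi> = "\<lambda>z. {w \<in> carrier M. z \<sqinter>\<^bsub>M\<^esub> w \<sqsubseteq>\<^bsub>M\<^esub> m}"
  let ?\<Psi> = "{(x, y) \<in> carrier M \<times> carrier M. ?\<phi> x = ?\<phi> y}"
  have \<phi>: "?\<phi> x = ?\<phi> y \<longleftrightarrow> (\<forall>w\<in>carrier M. x \<sqinter>\<^bsub>M\<^esub> w \<sqsubseteq>\<^bsub>M\<^esub> m \<longleftrightarrow> y \<sqinter>\<^bsub>M\<^esub> w \<sqsubseteq>\<^bsub>M\<^esub> m)" for x y
    by blast
  have "frame_congruence M ?\<Psi>"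
  proof (rule M.frame_congruence_kernel)
    fix x x' y y'
    assume c: "x \<in> carrier M" "x' \<in> carrier M" "y \<in> carrier M" "y' \<in> carrier M"
      and e: "?\<phi> x = ?\<phi> x'" "?\<phi> y = ?\<phi> y'"
    show "?\<phi> (x \<sqinter>\<^bsub>M\<^esub> y) = ?\<phi> (x' \<sqinter>\<^bsub>M\<^esub> y')"
      unfolding \<phi>
    proof
      fix w assume w: "w \<in> carrier M"
      have "x \<sqinter>\<^bsub>M\<^esub> (y \<sqinter>\<^bsub>M\<^esub> w) \<sqsubseteq>\<^bsub>M\<^esub> m \<longleftrightarrow> x' \<sqinter>\<^bsub>M\<^esub> (y \<sqinter>\<^bsub>M\<^esub> w) \<sqsubseteq>\<^bsub>M\<^esub> m"
        using e(1) c w unfolding \<phi> by simp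
      also have "\<dots> \<longleftrightarrow> y \<sqinter>\<^bsub>M\<^esub> (x' \<sqinter>\<^bsub>M\<^esub> w) \<sqsubseteq>\<^bsub>M\<^esub> m"
        by (simp only: M.meet_left_commute[OF c(2,3) w])
      also have "\<dots> \<longleftrightarrow> y' \<sqinter>\<^bsub>M\<^esub> (x' \<sqinter>\<^bsub>M\<^esub> w) \<sqsubseteq>\<^bsub>M\<^esub> m"
        using e(2) c w unfolding \<phi> by simp
      also have "\<dots> \<longleftrightarrow> x' \<sqinter>\<^bsub>M\<^esub> (y' \<sqinter>\<^bsub>M\<^esub> w) \<sqsubseteq>\<^bsub>M\<^esub> m"
        by (simp only: M.meet_left_commute[OF c(2,4) w])
      finally show "(x \<sqinter>\<^bsub>M\<^esub> y) \<sqinter>\<^bsub>M\<^esub> w \<sqsubseteq>\<^bsub>M\<^esub> m \<longleftrightarrow> (x' \<sqinter>\<^bsub>M\<^esub> y') \<sqinter>\<^bsub>M\<^esub> w \<sqsubseteq>\<^bsub>M\<^esub> m"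
        using c w by (simp add: M.meet_assoc)
    qed
  next
    fix A assume A: "A \<subseteq> carrier M \<times> carrier M" "\<And>p. p \<in> A \<Longrightarrow> ?\<phi> (fst p) = ?\<phi> (snd p)"
    have c: "fst ` A \<subseteq> carrier M" "snd ` A \<subseteq> carrier M" using A(1) by force+
    show "?\<phi> (\<Squnion>\<^bsub>M\<^esub>(fst ` A)) = ?\<phi> (\<Squnion>\<^bsub>M\<^esub>(snd ` A))"
      unfolding \<phi>
    proof
      fix w assume w: "w \<in> carrier M"
      have "w \<sqinter>\<^bsub>M\<^esub> fst p \<sqsubseteq>\<^bsub>M\<^esub> m \<longleftrightarrow> w \<sqinter>\<^bsub>M\<^esub> snd p \<sqsubseteq>\<^bsub>M\<^esub> m" if "p \<in> A" for p
        using A(2)[OF that] w unfolding \<phi> by (simp add: meet_comm[of M w])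
      then show "\<Squnion>\<^bsub>M\<^esub>(fst ` A) \<sqinter>\<^bsub>M\<^esub> w \<sqsubseteq>\<^bsub>M\<^esub> m \<longleftrightarrow> \<Squnion>\<^bsub>M\<^esub>(snd ` A) \<sqinter>\<^bsub>M\<^esub> w \<sqsubseteq>\<^bsub>M\<^esub> m"
        unfolding meet_comm[of M _ w] M.meet_sup_le_iff[OF w c(1) m(1)] M.meet_sup_le_iff[OF w c(2) m(1)] by simp
    qed
  qed
  moreover have "Delta M (k U) \<subseteq> ?\<Psi>" if U: "U \<in> quni L" for U
  proof -
    note kc = k_closed[OF U]
    \<comment> \<open>Meeting with k_U does not affect being below \<open>m\<close>. If the lift of
      \<open>p\<close> lies below \<open>x\<close>, then the lift of its meet with any
      \<open>u\<close> in U lies below \<open>x \<sqinter> k U\<close>, so these meets are in D, and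
      hence so is \<open>p\<close>; join-density of the lifted wedges concludes.\<close>
    have cover: "x \<sqsubseteq>\<^bsub>M\<^esub> m" if x: "x \<in> carrier M" "x \<sqinter>\<^bsub>M\<^esub> k U \<sqsubseteq>\<^bsub>M\<^esub> m" for x
    proof -
      have "wedge M (adj_pair p) \<sqsubseteq>\<^bsub>M\<^esub> m" if p: "p \<in> pairs L" "wedge M (adj_pair p) \<sqsubseteq>\<^bsub>M\<^esub> x" for p
      proof -
        have "pair_meet L p u \<in> D" if u: "u \<in> U" for u
        proof -
          have up: "u \<in> pairs L" using u U L.quni_pairs by blast
          have "wedge M (adj_pair u) \<sqsubseteq>\<^bsub>M\<^esub> k U"
            unfolding k_eq[OF U] using u by (intro M.wedge_le_pairs_join[OF adj_pair_image[OF U]] imageI)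
          then have "wedge M (adj_pair p) \<sqinter>\<^bsub>M\<^esub> wedge M (adj_pair u) \<sqsubseteq>\<^bsub>M\<^esub> x \<sqinter>\<^bsub>M\<^esub> k U"
            using p x up kc by (intro M.meet_mono) simp_all
          then have "wedge M (adj_pair (pair_meet L p u)) \<sqsubseteq>\<^bsub>M\<^esub> m"
            using p x up kc m(1) M.le_trans[of _ "x \<sqinter>\<^bsub>M\<^esub> k U" m] by (simp add: wedge_adj_pair_meet)
          then show ?thesis unfolding m(2) using p up by simp
        qed
        then have "p \<in> D" by (rule uclosedD(5)[OF D p(1) U])
        then show ?thesis unfolding m(2) by blast
      qed
      then show ?thesis using le_iff_adj[OF x(1) m(1)] by blast
    qed
    \<comment> \<open>The elements \<open>x \<sqinter> w\<close> and \<open>y \<sqinter> w\<close>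
      agree after meeting with k_U, so by \<open>cover\<close> a bound on the first is a bound on
      the second.\<close>
    have half: "y \<sqinter>\<^bsub>M\<^esub> w \<sqsubseteq>\<^bsub>M\<^esub> m"
      if "x \<in> carrier M" "y \<in> carrier M" "x \<sqinter>\<^bsub>M\<^esub> k U = y \<sqinter>\<^bsub>M\<^esub> k U" "w \<in> carrier M" "x \<sqinter>\<^bsub>M\<^esub> w \<sqsubseteq>\<^bsub>M\<^esub> m" for x y w
    proof (rule cover)
      have "(y \<sqinter>\<^bsub>M\<^esub> w) \<sqinter>\<^bsub>M\<^esub> k U = (x \<sqinter>\<^bsub>M\<^esub> w) \<sqinter>\<^bsub>M\<^esub> k U"
        using that kc by (metis M.meet_assoc meet_comm)
      moreover have "(x \<sqinter>\<^bsub>M\<^esub> w) \<sqinter>\<^bsub>M\<^esub> k U \<sqsubseteq>\<^bsub>M\<^esub> x \<sqinter>\<^bsub>M\<^esub> w" using that kc by (intro M.meet_left) simp_all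
      ultimately show "(y \<sqinter>\<^bsub>M\<^esub> w) \<sqinter>\<^bsub>M\<^esub> k U \<sqsubseteq>\<^bsub>M\<^esub> m"
        using that kc m(1) M.le_trans[of _ "x \<sqinter>\<^bsub>M\<^esub> w" m] by simp
    qed (use that in simp)
    show ?thesis
    proof
      fix z assume "z \<in> Delta M (k U)"
      then obtain x y where z: "z = (x, y)" "x \<in> carrier M" "y \<in> carrier M" "x \<sqinter>\<^bsub>M\<^esub> k U = y \<sqinter>\<^bsub>M\<^esub> k U"
        unfolding Delta_def by blast
      have "?\<phi> x = ?\<phi> y"
        unfolding \<phi> using half[OF z(2,3,4)] half[OF z(3,2) z(4)[symmetric]] by (intro ballI iffI)
      then show "z \<in> ?\<Psi>" using z by simp
    qed
  qed
  ultimately have "\<Theta> \<subseteq> ?\<Psi>" by (rule Theta_least)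
  then have e: "?\<phi> x = ?\<phi> y" "x \<in> carrier M" "y \<in> carrier M" using xy by blast+
  then show ?thesis
    using x unfolding \<phi> by (metis M.meet_top M.top_closed)
qed

end

section \<open>The quotient with its lifted quasi-uniformity\<close>

sublocale samuel \<subseteq> quotient: biframe_quotient M "samuel_Theta M h L"
  by unfold_locales (rule frame_congruence_Theta)

context samuel
begin

abbreviation "Q \<equiv> quotient_biframe M \<Theta>"
abbreviation "\<nu> \<equiv> quotient_map \<Theta>"
abbreviation "\<gamma> \<equiv> quotient.factor h"

lemma \<gamma>_\<nu>: "x \<in> carrier M \<Longrightarrow> \<gamma> (\<nu> x) = h x"
  by (rule quotient.factor_quotient_map[OF Theta_kernel])

sublocale \<gamma>: dense_surjection Q L \<gamma>
  by (rule quotient.factor_dense_surjection[OF dense_surjection_axioms Theta_kernel])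

lemma \<nu>_hom: "biframe_hom M Q \<nu>"
  by (rule quotient.quotient_biframe_hom)

lemma \<nu>_meet: "x \<in> carrier M \<Longrightarrow> y \<in> carrier M \<Longrightarrow> \<nu> (x \<sqinter>\<^bsub>M\<^esub> y) = \<nu> x \<sqinter>\<^bsub>Q\<^esub> \<nu> y"
  by (simp add: quotient.quotient_frame(3))

lemma \<nu>_mono: "x \<sqsubseteq>\<^bsub>M\<^esub> y \<Longrightarrow> x \<in> carrier M \<Longrightarrow> y \<in> carrier M \<Longrightarrow> \<nu> x \<sqsubseteq>\<^bsub>Q\<^esub> \<nu> y"
  by (simp add: quotient.quotient_le_iff M.meet_absorb quotient.congruence_refl)

text \<open>A representative of the largest lift of \<open>a\<close> along \<gamma> that is taken
  from the i-th part has image \<open>a\<close> under \<open>h\<close>, hence lies below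
  \<open>adj i a\<close>; so the class of \<open>adj i a\<close> is already the largest
  lift.\<close>

lemma \<gamma>_adj:
  assumes a: "a \<in> part i L"
  shows "\<gamma>.adj i a = \<nu> (adj i a)"
proof (rule \<gamma>.M.le_antisym)
  have n: "\<nu> (adj i a) \<in> part i Q" using a by simp
  then show "\<nu> (adj i a) \<in> carrier Q" by (rule \<gamma>.M.part_carrier)
  show "\<nu> (adj i a) \<sqsubseteq>\<^bsub>Q\<^esub> \<gamma>.adj i a"
    using a n \<gamma>.le_adj_iff[of a "\<nu> (adj i a)" i] by (simp add: \<gamma>_\<nu>)
  have "\<gamma>.adj i a \<in> part i Q" using a by (intro \<gamma>.adj_part) simp
  then obtain x where x: "x \<in> part i M" "\<gamma>.adj i a = \<nu> x" by auto
  then have "h x = a" using \<gamma>.h_adj[OF a] \<gamma>_\<nu>[of x] by simp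
  then have "x \<sqsubseteq>\<^bsub>M\<^esub> adj i a" using x a by (simp add: le_adj_iff)
  then show "\<gamma>.adj i a \<sqsubseteq>\<^bsub>Q\<^esub> \<nu> (adj i a)" unfolding x(2) using x a by (intro \<nu>_mono) simp_all
qed (use a in simp)

lemma \<gamma>_wedge_adj:
  assumes p: "p \<in> pairs L"
  shows "wedge Q (\<gamma>.adj_pair p) = \<nu> (wedge M (adj_pair p))"
  using p by (simp add: wedge_component \<gamma>_adj pairsD \<nu>_meet)

text \<open>By \<open>\<gamma>_adj\<close> the two downsets have the same generators. This
  identifies the images of the K_U with the covers lifted along \<gamma>.\<close>

lemma image_lift_cover:
  assumes U: "U \<in> quni L"
  shows "image_cover Q \<nu> (lift_cover U) = \<gamma>.lift_cover U"
proof (intro equalityI subsetI)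
  fix p assume "p \<in> image_cover Q \<nu> (lift_cover U)"
  then obtain w where w: "w \<in> lift_cover U" "\<And>i. component i p \<sqsubseteq>\<^bsub>Q\<^esub> \<nu> (component i w)" and p: "p \<in> pairs Q"
    unfolding mem_image_cover_iff by blast
  obtain u where u: "u \<in> U" "\<And>i. component i w \<sqsubseteq>\<^bsub>M\<^esub> adj i (component i u)" and wp: "w \<in> pairs M"
    using w(1) unfolding mem_lift_cover_iff by blast
  have up: "u \<in> pairs L" using u U L.quni_pairs by blast
  have "component i p \<sqsubseteq>\<^bsub>Q\<^esub> \<gamma>.adj i (component i u)" for i
  proof -
    have "\<nu> (component i w) \<sqsubseteq>\<^bsub>Q\<^esub> \<nu> (adj i (component i u))" using wp up u(2) by (intro \<nu>_mono) simp_all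
    moreover have "\<nu> (component i w) \<in> carrier Q" "\<nu> (adj i (component i u)) \<in> carrier Q"
      using wp up by (simp_all add: quotient.carrier_quotient)
    ultimately show ?thesis
      unfolding \<gamma>_adj[OF pairsD[OF up]] using w(2)[of i] p by (meson \<gamma>.M.le_trans \<gamma>.M.pairs_carrier)
  qed
  then show "p \<in> \<gamma>.lift_cover U" unfolding \<gamma>.mem_lift_cover_iff using u(1) p by blast
next
  fix p assume "p \<in> \<gamma>.lift_cover U"
  then obtain u where u: "u \<in> U" "\<And>i. component i p \<sqsubseteq>\<^bsub>Q\<^esub> \<gamma>.adj i (component i u)" and p: "p \<in> pairs Q"
    unfolding \<gamma>.mem_lift_cover_iff by blast
  have up: "u \<in> pairs L" using u U L.quni_pairs by blast
  have "adj_pair u \<in> lift_cover U"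
    unfolding mem_lift_cover_iff using u(1) up by (auto intro!: bexI[of _ u])
  moreover have "component i p \<sqsubseteq>\<^bsub>Q\<^esub> \<nu> (component i (adj_pair u))" for i
    using u(2)[of i] by (simp add: \<gamma>_adj[OF pairsD[OF up]])
  ultimately show "p \<in> image_cover Q \<nu> (lift_cover U)" unfolding mem_image_cover_iff using p by blast
qed

text \<open>The covers lift because the class of k_U is 1. Admissibility is inherited from M: the
  classes of the elements uniformly below \<open>x\<close> lie in the required set, and \<nu>
  preserves their join.\<close>

lemma lifted_quniformity_Q: "lifted_quniformity (lift_quni Q L \<gamma>) L \<gamma>"
proof (rule lifted_quniformityI[OF \<gamma>.dense_surjection_axioms L.qu_biframe_axioms])
  fix U assume U: "U \<in> quni L"
  \<comment> \<open>k_U and 1 have the same meet with k_U, so the generating congruence of U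
    identifies them.\<close>
  have "(k U, \<top>\<^bsub>M\<^esub>) \<in> Delta M (k U)"
    using k_closed[OF U] by (simp add: Delta_def M.meet_idem meet_comm[of M "\<top>\<^bsub>M\<^esub>"] M.meet_top)
  then have "(k U, \<top>\<^bsub>M\<^esub>) \<in> \<Theta>" using Delta_subset_Theta[OF U] by blast
  then have "\<nu> (k U) = \<nu> \<top>\<^bsub>M\<^esub>" using k_closed[OF U] by (simp add: quotient.quotient_map_eq_iff)
  moreover have "\<nu> \<top>\<^bsub>M\<^esub> = \<top>\<^bsub>Q\<^esub>" using \<nu>_hom by (simp add: biframe_hom_def frame_hom_def)
  moreover have "pairs_join Q (\<gamma>.adj_pair ` U) = \<nu> (pairs_join M (adj_pair ` U))"
  proof -
    have "wedge Q ` \<gamma>.adj_pair ` U = \<nu> ` wedge M ` adj_pair ` U"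
      unfolding image_image by (intro image_cong HOL.refl \<gamma>_wedge_adj L.quni_pairs[OF U])
    then show ?thesis
      using adj_pair_image[OF U] by (simp add: pairs_join_wedge quotient.quotient_frame(2) M.wedge_image_carrier)
  qed
  ultimately show "pairs_join Q (\<gamma>.lift_cover U) = \<top>\<^bsub>Q\<^esub>"
    by (simp add: \<gamma>.pairs_join_lift_cover L.quni_subset[OF U] k_eq[OF U])
next
  fix i X assume "X \<in> part i Q"
  then obtain x where x: "x \<in> part i M" "X = \<nu> x" by auto
  let ?Y = "{Y \<in> part i Q. \<exists>U\<in>quni L. star i Q Y (\<gamma>.lift_cover U) \<sqsubseteq>\<^bsub>Q\<^esub> X}"
  have Yc: "?Y \<subseteq> carrier Q" using \<gamma>.M.part_subset by blast
  have "\<nu> y \<in> ?Y" if y: "below i M y x" for y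
  proof -
    have yp: "y \<in> part i M" using y by (rule below_part)
    obtain W where W: "W \<in> quni M" "star i M y W \<sqsubseteq>\<^bsub>M\<^esub> x" using y unfolding below_def by blast
    \<comment> \<open>The refinement leaves room for one more star: \<open>adj i (h ?s)\<close> may
      exceed the star \<open>?s\<close>, but it stays below \<open>star i M ?s V\<close>, hence
      below \<open>star i M y W\<close> and \<open>x\<close>.\<close>
    obtain V where V: "V \<in> quni M" "star_cover M V \<subseteq> W" using M.star_refinement W by blast
    let ?U = "image_cover L h V" and ?s = "star i M y V"
    have U: "?U \<in> quni L" by (rule image_quni[OF V(1)])
    have s: "?s \<in> part i M" using V by simp
    have hs: "star i L (h y) ?U \<in> part i L" "h ?s \<in> part i L" using U s by simp_all
    have "adj i (star i L (h y) ?U) \<sqsubseteq>\<^bsub>M\<^esub> adj i (h ?s)"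
      using V yp hs by (intro adj_mono star_image_le M.quni_subset) simp_all
    moreover have "adj i (h ?s) \<sqsubseteq>\<^bsub>M\<^esub> star i M ?s V" by (rule adj_h_le_star[OF s V(1)])
    moreover have "star i M ?s V \<sqsubseteq>\<^bsub>M\<^esub> star i M y W"
      using V W yp by (intro M.star_star_le) (simp_all add: M.quni_subset M.le_star)
    moreover have c: "adj i (star i L (h y) ?U) \<in> carrier M" "adj i (h ?s) \<in> carrier M"
        "star i M ?s V \<in> carrier M" "star i M y W \<in> carrier M" "x \<in> carrier M"
      using hs V W x by (simp_all add: M.quni_subset)
    ultimately have "adj i (star i L (h y) ?U) \<sqsubseteq>\<^bsub>M\<^esub> x" using W(2) by (meson M.le_trans)
    then have "\<nu> (adj i (star i L (h y) ?U)) \<sqsubseteq>\<^bsub>Q\<^esub> X" unfolding x(2) using c by (intro \<nu>_mono)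
    moreover have "star i Q (\<nu> y) (\<gamma>.lift_cover ?U) \<sqsubseteq>\<^bsub>Q\<^esub> \<nu> (adj i (star i L (h y) ?U))"
      using \<gamma>.star_lift_le[OF L.quni_subset[OF U], of "\<nu> y" i] yp
      by (simp add: \<gamma>_\<nu> \<gamma>_adj[OF hs(1)] quotient.carrier_quotient)
    moreover have "star i Q (\<nu> y) (\<gamma>.lift_cover ?U) \<in> carrier Q"
      by (simp add: \<gamma>.lift_cover_def \<gamma>.M.down_subset)
    moreover have "\<nu> (adj i (star i L (h y) ?U)) \<in> carrier Q" "X \<in> carrier Q"
      using c x by (simp_all add: quotient.carrier_quotient)
    ultimately have "star i Q (\<nu> y) (\<gamma>.lift_cover ?U) \<sqsubseteq>\<^bsub>Q\<^esub> X" by (meson \<gamma>.M.le_trans)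
    then show ?thesis using yp U by auto
  qed
  then have sub: "\<nu> ` {y. below i M y x} \<subseteq> ?Y" by blast
  have "X = \<Squnion>\<^bsub>Q\<^esub>(\<nu> ` {y. below i M y x})"
    using quotient.quotient_frame(2)[OF M.below_carrier, of i x] M.admissible[OF x(1)] x(2) by simp
  also have "\<dots> \<sqsubseteq>\<^bsub>Q\<^esub> \<Squnion>\<^bsub>Q\<^esub>?Y"
    using sub Yc by (intro \<gamma>.M.sup_least \<gamma>.M.sup_upper \<gamma>.M.sup_closed) blast+
  finally show "X \<sqsubseteq>\<^bsub>Q\<^esub> \<Squnion>\<^bsub>Q\<^esub>?Y" .
qed

sublocale C: lifted_quniformity "lift_quni Q L \<gamma>" L \<gamma>
  by (rule lifted_quniformity_Q)

text \<open>The type \<open>'m\<close> can stay free because \<open>bicompleteI\<close> reduces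
  bicompleteness to the question whether each closed set of pairs of L is the trace of an element of
  the quotient, and this does not involve the type of the competing biframe.\<close>

lemma is_bicompletion_Q: "is_bicompletion TYPE('m) (lift_quni Q L \<gamma>) \<gamma> L"
proof -
  let ?C = "lift_quni Q L \<gamma>"
  note same = same_biframe_lift_quni[of Q L \<gamma>]
  note ops = same_biframe_operations[OF same]
  interpret completion: qu_completion ?C L \<gamma>
    by (rule qu_completionI[OF C.qu_biframe_M L.biframe_axioms C.qu_surjection_h C.dense])
  have "\<exists>m\<in>carrier ?C. D = completion.below_pairs m" if D: "uclosed L D" for D
  proof -
    obtain m where m: "m \<in> carrier M" "D = {p \<in> pairs L. wedge M (adj_pair p) \<sqsubseteq>\<^bsub>M\<^esub> m}"
      using uclosed_eq_below[OF D] by blast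
    have "wedge ?C (C.adj_pair p) \<sqsubseteq>\<^bsub>?C\<^esub> \<nu> m \<longleftrightarrow> wedge M (adj_pair p) \<sqsubseteq>\<^bsub>M\<^esub> m" if p: "p \<in> pairs L" for p
    proof -
      let ?w = "wedge M (adj_pair p)"
      have w: "?w \<in> carrier M" using p by simp
      have "C.adj = \<gamma>.adj" by (rule lift_cover_cong(1)[OF same \<gamma>.dense_surjection_axioms])
      then have "wedge ?C (C.adj_pair p) = wedge Q (\<gamma>.adj_pair p)"
        by (simp add: wedge_def C.adj_pair_def \<gamma>.adj_pair_def ops)
      then have "wedge ?C (C.adj_pair p) \<sqsubseteq>\<^bsub>?C\<^esub> \<nu> m \<longleftrightarrow> (?w \<sqinter>\<^bsub>M\<^esub> m, ?w) \<in> \<Theta>"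
        using quotient.quotient_le_iff[OF w m(1)] by (simp add: \<gamma>_wedge_adj[OF p] lift_quni_def)
      \<comment> \<open>The order of the classes says that \<open>?w\<close> is congruent to its
        meet with \<open>m\<close>. That meet lies below \<open>m\<close>, so saturation carries
        \<open>?w\<close> below \<open>m\<close> as well.\<close>
      also have "\<dots> \<longleftrightarrow> ?w \<sqsubseteq>\<^bsub>M\<^esub> m"
      proof
        assume "(?w \<sqinter>\<^bsub>M\<^esub> m, ?w) \<in> \<Theta>"
        then show "?w \<sqsubseteq>\<^bsub>M\<^esub> m" using Theta_saturated[OF D m] M.meet_right[OF w m(1)] by blast
      next
        assume "?w \<sqsubseteq>\<^bsub>M\<^esub> m"
        then show "(?w \<sqinter>\<^bsub>M\<^esub> m, ?w) \<in> \<Theta>"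
          using M.meet_absorb[OF _ w m(1)] quotient.congruence_refl[OF w] by simp
      qed
      finally show ?thesis .
    qed
    then have "D = completion.below_pairs (\<nu> m)"
      unfolding completion.below_pairs_def m(2) by blast
    moreover have "\<nu> m \<in> carrier ?C"
      using m(1) quotient.carrier_quotient by (simp add: lift_quni_def)
    ultimately show ?thesis by blast
  qed
  then have "bicomplete TYPE('m) ?C" by (rule completion.bicompleteI)
  then show ?thesis
    unfolding is_bicompletion_def using C.qu_biframe_M C.qu_surjection_h C.dense by blast
qed

lemma base_of_image_K:
  "base_of ((\<lambda>U. image_cover (lift_quni Q L \<gamma>) \<nu> (samuel_K M h L U)) ` quni L) (quni (lift_quni Q L \<gamma>))"
proof -
  note same = same_biframe_lift_quni[of Q L \<gamma>]
  have "image_cover (lift_quni Q L \<gamma>) \<nu> (samuel_K M h L U) = C.lift_cover U" if "U \<in> quni L" for U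
    unfolding samuel_K_eq lift_cover_cong(2)[OF same \<gamma>.dense_surjection_axioms] image_lift_cover[OF that, symmetric]
    by (simp add: image_cover_def same_biframe_operations(8)[OF same])
  then show ?thesis using C.base_of_lift by (simp cong: image_cong_simp)
qed

end

text \<open>L and its totally bounded coreflection differ only in their covers. Covers of the
  coreflection contain finite covers of L and so are covers of L by upward closure, while a finite
  cover of L is itself a cover of the coreflection.\<close>

lemma totally_bounded_samuel:
  fixes K :: "'b qubiframe"
  assumes "qu_biframe L" "is_samuel_compactification TYPE(('b \<times> 'b) set) K \<rho> L"
  shows "samuel K L \<rho>"
proof -
  let ?B = "totally_bounded_coreflection L"
  interpret L: qu_biframe L by fact
  note K = assms(2)[unfolded is_samuel_compactification_def is_bicompletion_def]
  interpret K: qu_biframe K using K by blast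
  have same: "same_biframe ?B L" by (simp add: same_biframe_def totally_bounded_coreflection_def)
  note homs = biframe_hom_cong[OF _ same, of K K \<rho>]
  have "biframe_hom K L \<rho>" "surjective_hom K L \<rho>" "dense_hom K L \<rho>"
    using K homs unfolding qu_surjection_def qu_hom_def by (simp_all add: same_biframe_def)
  then interpret \<rho>: qu_dense_surjection K L \<rho> by unfold_locales
  have image: "image_cover L \<rho> V = image_cover ?B \<rho> V" for V
    by (simp add: image_cover_def same_biframe_operations(8)[OF same])
  have quni_B: "quni ?B = {V. paircover L V \<and> (\<exists>U\<in>quni L. finitely_generated L U \<and> U \<subseteq> V)}"
    by (simp add: totally_bounded_coreflection_def)
  show ?thesis
  proof unfold_locales
    show "image_cover L \<rho> V \<in> quni L" if "V \<in> quni K" for V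
    proof -
      have "image_cover L \<rho> V \<in> quni ?B"
        unfolding image using that K unfolding qu_surjection_def qu_hom_def by blast
      then show ?thesis unfolding quni_B using L.quni_upward by blast
    qed
    show "\<exists>V\<in>quni K. image_cover L \<rho> V \<subseteq> W" if "W \<in> quni L" "finitely_generated L W" for W
    proof -
      have "W \<in> quni ?B" unfolding quni_B using that L.quni_paircover by blast
      then show ?thesis unfolding image using K unfolding qu_surjection_def base_of_def by blast
    qed
    show "bicomplete TYPE(('b \<times> 'b) set) K" using K by blast
  qed
qed

theorem proposition2p7:
  fixes L :: "'a qubiframe" and CBL :: "'b qubiframe" and \<rho> :: "'b \<Rightarrow> 'a"
  assumes "qu_biframe L"
    and "is_samuel_compactification TYPE(('b \<times> 'b) set) CBL \<rho> L"
  shows "\<exists>(CL :: 'b set qubiframe) \<gamma>.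
      is_bicompletion TYPE('m) CL \<gamma> L
    \<and> biframe.truncate CL = quotient_biframe CBL (samuel_Theta CBL \<rho> L)
    \<and> base_of ((\<lambda>U. image_cover CL (quotient_map (samuel_Theta CBL \<rho> L)) (samuel_K CBL \<rho> L U)) ` quni L)
        (quni CL)
    \<and> (\<forall>x\<in>carrier CBL. \<rho> x = \<gamma> (quotient_map (samuel_Theta CBL \<rho> L) x))"
proof -
  interpret samuel CBL L \<rho> by (rule totally_bounded_samuel[OF assms])
  show ?thesis
    by (intro exI[of _ "lift_quni Q L \<gamma>"] exI[of _ \<gamma>] conjI ballI)
      (simp_all add: is_bicompletion_Q truncate_lift_quni base_of_image_K \<gamma>_\<nu>)
qed

end
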